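(* Let $\mathfrak{g}$ be a finite-dimensional complex simple Lie algebra. The set $\mathbf{CP}_{\mathfrak{g}}=\{f_\phi\}_\phi$ ($\phi$ ranging over all finite-dimensional representations of $\mathfrak{g}$) is a commutative monoid under the resolution product $f_\phi*f_\varphi:=\rho^{-1}(\tilde f_\phi*\tilde f_\varphi)$, with unit element $z_0$. Moreover, the linearization map $\rho:\mathbf{CP}_{\mathfrak{g}}\to\widetilde{\mathbf{CP}_{\mathfrak{g}}}$, $f_\phi\mapsto\tilde f_\phi$, is an isomorphism of monoids with respect to the resolution products.
   Context: Fix a Cartan subalgebra $\mathfrak{h}$ with root system $\Phi$, simple roots $\alpha_1,\dots,\alpha_n$, coroots $h_{\alpha_1},\dots,h_{\alpha_n}$ (a basis of $\mathfrak{h}$), and root vectors $E_\alpha$, $\alpha\in\Phi$. For a finite-dimensional representation $\phi:\mathfrak{g}\to\mathfrak{gl}(V)$: $f_\phi(z)=\det\big(z_0I+\sum_{i=1}^n z_i\phi(h_{\alpha_i})+\sum_{\alpha\in\Phi}z_\alpha\phi(E_\alpha)\big)$ and $\tilde f_\phi(z_0,\dots,z_n)=\det\big(z_0I+\sum_{i=1}^n z_i\phi(h_{\alpha_i})\big)$. $\widetilde{\mathbf{CP}_{\mathfrak{g}}}=\{\tilde f_\phi\}_\phi$. The map $\rho:\mathbf{CP}_{\mathfrak{g}}\to\widetilde{\mathbf{CP}_{\mathfrak{g}}}$, $\rho(f_\phi)=\tilde f_\phi$, is a bijection. With $\Gamma_\phi$ the set of weights of $\phi$ and $d_\lambda$ the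 multiplicity of $\lambda$, the resolution product on $\widetilde{\mathbf{CP}_{\mathfrak{g}}}$ is $\tilde f_\phi*\tilde f_\varphi=\prod_{\lambda\in\Gamma_\phi,\mu\in\Gamma_\varphi}\big(z_0+\sum_{i=1}^n(\lambda(h_{\alpha_i})+\mu(h_{\alpha_i}))z_i\big)^{d_\lambda d_\mu}$. *)

theory Defs
  imports Complex_Main "HOL-Algebra.Group" "Jordan_Normal_Form.VS_Connect"
    "Jordan_Normal_Form.Determinant"
begin

definition lie_algebra :: "(complex \<Rightarrow> 'g::ab_group_add \<Rightarrow> 'g) \<Rightarrow> ('g \<Rightarrow> 'g \<Rightarrow> 'g) \<Rightarrow> bool" where
  "lie_algebra sc br \<longleftrightarrow> vector_space sc \<and>
     (\<forall>x y z. br (x + y) z = br x z + br y z \<and> br x (y + z) = br x y + br x z) \<and>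
     (\<forall>a x y. br (sc a x) y = sc a (br x y) \<and> br x (sc a y) = sc a (br x y)) \<and>
     (\<forall>x. br x x = 0) \<and>
     (\<forall>x y z. br x (br y z) + br y (br z x) + br z (br x y) = 0)"

definition lie_fin_dim :: "(complex \<Rightarrow> 'g::ab_group_add \<Rightarrow> 'g) \<Rightarrow> bool" where
  "lie_fin_dim sc \<longleftrightarrow> (\<exists>B. finite B \<and> Modules.module.span sc B = UNIV)"

definition lie_ideal :: "(complex \<Rightarrow> 'g::ab_group_add \<Rightarrow> 'g) \<Rightarrow> ('g \<Rightarrow> 'g \<Rightarrow> 'g) \<Rightarrow> 'g set \<Rightarrow> bool" where
  "lie_ideal sc br I \<longleftrightarrow> Modules.module.subspace sc I \<and> (\<forall>x y. y \<in> I \<longrightarrow> br x y \<in> I)"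

definition simple_lie_algebra :: "(complex \<Rightarrow> 'g::ab_group_add \<Rightarrow> 'g) \<Rightarrow> ('g \<Rightarrow> 'g \<Rightarrow> 'g) \<Rightarrow> bool" where
  "simple_lie_algebra sc br \<longleftrightarrow> lie_algebra sc br \<and> lie_fin_dim sc \<and>
     (\<exists>x y. br x y \<noteq> 0) \<and>
     (\<forall>I. lie_ideal sc br I \<longrightarrow> I = {0} \<or> I = UNIV)"

definition lie_subalgebra :: "(complex \<Rightarrow> 'g::ab_group_add \<Rightarrow> 'g) \<Rightarrow> ('g \<Rightarrow> 'g \<Rightarrow> 'g) \<Rightarrow> 'g set \<Rightarrow> bool" where
  "lie_subalgebra sc br H \<longleftrightarrow> Modules.module.subspace sc H \<and> (\<forall>x\<in>H. \<forall>y\<in>H. br x y \<in> H)"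

fun lower_central :: "(complex \<Rightarrow> 'g::ab_group_add \<Rightarrow> 'g) \<Rightarrow> ('g \<Rightarrow> 'g \<Rightarrow> 'g) \<Rightarrow> 'g set \<Rightarrow> nat \<Rightarrow> 'g set" where
  "lower_central sc br H 0 = H"
| "lower_central sc br H (Suc k) =
     Modules.module.span sc {br x y | x y. x \<in> H \<and> y \<in> lower_central sc br H k}"

definition nilpotent_subalgebra :: "(complex \<Rightarrow> 'g::ab_group_add \<Rightarrow> 'g) \<Rightarrow> ('g \<Rightarrow> 'g \<Rightarrow> 'g) \<Rightarrow> 'g set \<Rightarrow> bool" where
  "nilpotent_subalgebra sc br H \<longleftrightarrow> (\<exists>k. lower_central sc br H k = {0})"

definition normalizer :: "('g \<Rightarrow> 'g \<Rightarrow> 'g) \<Rightarrow> 'g set \<Rightarrow> 'g set" where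
  "normalizer br H = {x. \<forall>y\<in>H. br x y \<in> H}"

definition cartan_subalgebra :: "(complex \<Rightarrow> 'g::ab_group_add \<Rightarrow> 'g) \<Rightarrow> ('g \<Rightarrow> 'g \<Rightarrow> 'g) \<Rightarrow> 'g set \<Rightarrow> bool" where
  "cartan_subalgebra sc br H \<longleftrightarrow> lie_subalgebra sc br H \<and> nilpotent_subalgebra sc br H \<and>
     normalizer br H = H"

text \<open>Linear functionals on H (elements of the dual of H), represented as functions on 'g
  that are linear on H and vanish outside H (canonical representative).\<close>
definition h_functional :: "(complex \<Rightarrow> 'g::ab_group_add \<Rightarrow> 'g) \<Rightarrow> 'g set \<Rightarrow> ('g \<Rightarrow> complex) \<Rightarrow> bool" where
  "h_functional sc H l \<longleftrightarrow>
     (\<forall>x\<in>H. \<forall>y\<in>H. l (x + y) = l x + l y) \<and> (\<forall>a. \<forall>x\<in>H. l (sc a x) = a * l x) \<and>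
     (\<forall>x. x \<notin> H \<longrightarrow> l x = 0)"

definition root_space :: "(complex \<Rightarrow> 'g::ab_group_add \<Rightarrow> 'g) \<Rightarrow> ('g \<Rightarrow> 'g \<Rightarrow> 'g) \<Rightarrow> 'g set \<Rightarrow> ('g \<Rightarrow> complex) \<Rightarrow> 'g set" where
  "root_space sc br H a = {x. \<forall>t\<in>H. br t x = sc (a t) x}"

definition roots :: "(complex \<Rightarrow> 'g::ab_group_add \<Rightarrow> 'g) \<Rightarrow> ('g \<Rightarrow> 'g \<Rightarrow> 'g) \<Rightarrow> 'g set \<Rightarrow> ('g \<Rightarrow> complex) set" where
  "roots sc br H = {a. h_functional sc H a \<and> (\<exists>t\<in>H. a t \<noteq> 0) \<and> root_space sc br H a \<noteq> {0}}"

definition simple_roots :: "(complex \<Rightarrow> 'g::ab_group_add \<Rightarrow> 'g) \<Rightarrow> ('g \<Rightarrow> 'g \<Rightarrow> 'g) \<Rightarrow> 'g set \<Rightarrow> nat \<Rightarrow> (nat \<Rightarrow> 'g \<Rightarrow> complex) \<Rightarrow> bool" where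
  "simple_roots sc br H n al \<longleftrightarrow>
     (\<forall>i\<in>{1..n}. al i \<in> roots sc br H) \<and> inj_on al {1..n} \<and>
     (\<forall>c::nat \<Rightarrow> complex. (\<forall>t\<in>H. (\<Sum>i=1..n. c i * al i t) = 0) \<longrightarrow> (\<forall>i\<in>{1..n}. c i = 0)) \<and>
     (\<forall>b\<in>roots sc br H. \<exists>k::nat \<Rightarrow> nat.
        (\<forall>t\<in>H. b t = (\<Sum>i=1..n. of_nat (k i) * al i t)) \<or>
        (\<forall>t\<in>H. b t = - (\<Sum>i=1..n. of_nat (k i) * al i t)))"

definition coroot :: "(complex \<Rightarrow> 'g::ab_group_add \<Rightarrow> 'g) \<Rightarrow> ('g \<Rightarrow> 'g \<Rightarrow> 'g) \<Rightarrow> 'g set \<Rightarrow> ('g \<Rightarrow> complex) \<Rightarrow> 'g" where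
  "coroot sc br H a = (THE t. t \<in> {br x y | x y. x \<in> root_space sc br H a \<and> y \<in> root_space sc br H (- a)}
                              \<and> a t = 2)"

definition root_vectors :: "(complex \<Rightarrow> 'g::ab_group_add \<Rightarrow> 'g) \<Rightarrow> ('g \<Rightarrow> 'g \<Rightarrow> 'g) \<Rightarrow> 'g set \<Rightarrow> (('g \<Rightarrow> complex) \<Rightarrow> 'g) \<Rightarrow> bool" where
  "root_vectors sc br H E \<longleftrightarrow> (\<forall>a\<in>roots sc br H. E a \<in> root_space sc br H a \<and> E a \<noteq> 0)"

definition lie_rep :: "(complex \<Rightarrow> 'g::ab_group_add \<Rightarrow> 'g) \<Rightarrow> ('g \<Rightarrow> 'g \<Rightarrow> 'g) \<Rightarrow> nat \<Rightarrow> ('g \<Rightarrow> complex mat) \<Rightarrow> bool" where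
  "lie_rep sc br d phi \<longleftrightarrow> (\<forall>x. phi x \<in> carrier_mat d d) \<and>
     (\<forall>x y. phi (x + y) = phi x + phi y) \<and> (\<forall>a x. phi (sc a x) = a \<cdot>\<^sub>m phi x) \<and>
     (\<forall>x y. phi (br x y) = phi x * phi y - phi y * phi x)"

definition weight_space :: "'g set \<Rightarrow> nat \<Rightarrow> ('g \<Rightarrow> complex mat) \<Rightarrow> ('g \<Rightarrow> complex) \<Rightarrow> complex vec set" where
  "weight_space H d phi l = {v \<in> carrier_vec d. \<forall>t\<in>H. phi t *\<^sub>v v = l t \<cdot>\<^sub>v v}"

definition weights :: "(complex \<Rightarrow> 'g::ab_group_add \<Rightarrow> 'g) \<Rightarrow> 'g set \<Rightarrow> nat \<Rightarrow> ('g \<Rightarrow> complex mat) \<Rightarrow> ('g \<Rightarrow> complex) set" where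
  "weights sc H d phi = {l. h_functional sc H l \<and> weight_space H d phi l \<noteq> {0\<^sub>v d}}"

definition weight_mult :: "'g set \<Rightarrow> nat \<Rightarrow> ('g \<Rightarrow> complex mat) \<Rightarrow> ('g \<Rightarrow> complex) \<Rightarrow> nat" where
  "weight_mult H d phi l =
     vectorspace.dim (class_ring :: complex ring)
       ((module_vec TYPE(complex) d)\<lparr>carrier := weight_space H d phi l\<rparr>)"

text \<open>Variables: z_0, z_i (i = 1..n), z_alpha (alpha a root).\<close>
datatype 'r cpvar = Z0 | ZH nat | ZE 'r

definition cp_full :: "(complex \<Rightarrow> 'g::ab_group_add \<Rightarrow> 'g) \<Rightarrow> ('g \<Rightarrow> 'g \<Rightarrow> 'g) \<Rightarrow> 'g set \<Rightarrow> nat \<Rightarrow> (nat \<Rightarrow> 'g \<Rightarrow> complex)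
   \<Rightarrow> (('g \<Rightarrow> complex) \<Rightarrow> 'g) \<Rightarrow> nat \<Rightarrow> ('g \<Rightarrow> complex mat) \<Rightarrow> ((('g \<Rightarrow> complex) cpvar) \<Rightarrow> complex) \<Rightarrow> complex" where
  "cp_full sc br H n al E d phi z = det (mat d d (\<lambda>(r, c).
      (if r = c then z Z0 else 0)
      + (\<Sum>i=1..n. z (ZH i) * (phi (coroot sc br H (al i)) $$ (r, c)))
      + (\<Sum>a\<in>roots sc br H. z (ZE a) * (phi (E a) $$ (r, c)))))"

definition cp_lin :: "(complex \<Rightarrow> 'g::ab_group_add \<Rightarrow> 'g) \<Rightarrow> ('g \<Rightarrow> 'g \<Rightarrow> 'g) \<Rightarrow> 'g set \<Rightarrow> nat \<Rightarrow> (nat \<Rightarrow> 'g \<Rightarrow> complex)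
   \<Rightarrow> nat \<Rightarrow> ('g \<Rightarrow> complex mat) \<Rightarrow> (nat \<Rightarrow> complex) \<Rightarrow> complex" where
  "cp_lin sc br H n al d phi z = det (mat d d (\<lambda>(r, c).
      (if r = c then z 0 else 0)
      + (\<Sum>i=1..n. z i * (phi (coroot sc br H (al i)) $$ (r, c)))))"

definition CP where
  "CP sc br H n al E = {cp_full sc br H n al E d phi | d phi. lie_rep sc br d phi}"

definition CP_lin where
  "CP_lin sc br H n al = {cp_lin sc br H n al d phi | d phi. lie_rep sc br d phi}"

definition rho where
  "rho sc br H n al E f = (SOME p. \<exists>d phi. lie_rep sc br d phi \<and>
      f = cp_full sc br H n al E d phi \<and> p = cp_lin sc br H n al d phi)"

definition res_prod_reps where
  "res_prod_reps sc br H n al d phi e psi = (\<lambda>z::nat \<Rightarrow> complex.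
     \<Prod>l\<in>weights sc H d phi. \<Prod>m\<in>weights sc H e psi.
       (z 0 + (\<Sum>i=1..n. (l (coroot sc br H (al i)) + m (coroot sc br H (al i))) * z i))
         ^ (weight_mult H d phi l * weight_mult H e psi m))"

definition res_prod_lin where
  "res_prod_lin sc br H n al p q = (SOME r. \<exists>d phi e psi.
      lie_rep sc br d phi \<and> lie_rep sc br e psi \<and>
      p = cp_lin sc br H n al d phi \<and> q = cp_lin sc br H n al e psi \<and>
      r = res_prod_reps sc br H n al d phi e psi)"

definition res_prod where
  "res_prod sc br H n al E f g =
     inv_into (CP sc br H n al E) (rho sc br H n al E)
       (res_prod_lin sc br H n al (rho sc br H n al E f) (rho sc br H n al E g))"

definition CP_monoid where
  "CP_monoid sc br H n al E =
     \<lparr>carrier = CP sc br H n al E, monoid.mult = res_prod sc br H n al E, one = (\<lambda>z. z Z0)\<rparr>"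

definition CP_lin_monoid where
  "CP_lin_monoid sc br H n al =
     \<lparr>carrier = CP_lin sc br H n al, monoid.mult = res_prod_lin sc br H n al, one = (\<lambda>z. z 0)\<rparr>"

end

theory Submission
  imports Defs "HOL-Computational_Algebra.Fundamental_Theorem_Algebra" "HOL-Library.Function_Algebras"
    "Jordan_Normal_Form.Jordan_Normal_Form_Uniqueness" "Jordan_Normal_Form.Schur_Decomposition"
begin

text \<open>
  For every representation \<open>phi\<close> the matrices \<open>phi h\<close>, \<open>h \<in> H\<close>, are simultaneously diagonalizable: \<open>H\<close> is spanned
  by coroots, and the semisimple element of an sl2-triple acts diagonalizably. Hence the linearized
  polynomial of \<open>phi\<close> is the product of \<open>z 0 + lam z\<close> over the weights, the resolution product of two
  linearized polynomials is the linearized polynomial of the tensor product representation, and it depends only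
  on the two polynomials. So everything reduces to the injectivity of the linearization map. The linearized
  polynomial determines the weights with their multiplicities, hence the traces of all products of elements of
  \<open>H\<close>; by invariance under the root vectors these determine the traces of all products of elements of the
  Lie algebra, in particular the power sums of the eigenvalues of \<open>phi x\<close> for every \<open>x\<close>, hence the
  full characteristic polynomial.

  The structure theory of \<open>H\<close> is obtained from traces alone. The vanishing of the traces of commutators on root
  strings gives Cartan's criterion, hence a nondegenerate Killing form, and the same computation on the sum of
  \<open>H\<close>, a root vector and the negative multiples of its root gives one-dimensional root spaces.
\<close>

section \<open>Generalized eigenspaces\<close>

text \<open>The definitions dictate what must be known about \<open>H\<close>, of which only
  nilpotency and self-normalization are given. \<open>weights\<close> and \<open>weight_mult\<close>
  count genuine joint eigenvectors, so the exponents in the resolution product are right only if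
  \<open>H\<close> acts diagonalizably. \<open>coroot\<close> is a definite description, usable only
  once opposite root spaces bracket into a line. \<open>res_prod\<close> inverts \<open>rho\<close>,
  so its values can be computed only once injectivity is known. Diagonalizability comes from
  excluding Jordan blocks directly in an sl2-action, with a Casimir element separating highest
  weights. Trace functionals on words are determined on \<open>H\<close> because a root letter
  \<open>E a\<close> can be traded for its coroot: letting \<open>E a\<close> act on the word with
  \<open>cor a\<close> in that place returns the original word with total coefficient -(2 + m), m a
  natural number, once the letters from \<open>H\<close> are split into multiples of
  \<open>cor a\<close> and elements killed by \<open>a\<close>. The 2 is \<open>a (cor a)\<close>.
  This takes the role of the Weyl group in Chevalley's theorem.\<close>

locale complex_vs = vector_space scale
  for scale :: "complex \<Rightarrow> 'v::ab_group_add \<Rightarrow> 'v" (infixr "*s" 75)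
begin

abbreviation lin :: "('v \<Rightarrow> 'v) \<Rightarrow> bool" where
  "lin \<equiv> Vector_Spaces.linear scale scale"

lemma linI:
  assumes "\<And>x y. f (x + y) = f x + f y" "\<And>c x. f (c *s x) = c *s f x"
  shows "lin f"
  using assms vector_space_axioms by (simp add: Vector_Spaces.linear_iff)

lemma lin_add: "lin f \<Longrightarrow> f (x + y) = f x + f y"
  and lin_scale: "lin f \<Longrightarrow> f (c *s x) = c *s f x"
  by (auto simp: Vector_Spaces.linear_iff)

lemma lin_zero: "lin f \<Longrightarrow> f 0 = 0"
  using lin_scale[of f 0 0] by simp

lemma lin_diff: "lin f \<Longrightarrow> f (x - y) = f x - f y"
  using lin_add[of f "x - y" y] by (simp add: algebra_simps)

lemma lin_sum: "lin f \<Longrightarrow> f (sum g A) = (\<Sum>a\<in>A. f (g a))"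
  by (induction A rule: infinite_finite_induct) (auto simp: lin_zero lin_add)

lemma lin_shift: "lin f \<Longrightarrow> lin (\<lambda>v. f v - \<mu> *s v)"
  by (rule linI) (auto simp: lin_add lin_scale algebra_simps)

text \<open>Finite-dimensionality of a subspace, because the ambient space may be
  infinite-dimensional, as it is for the functions on \<open>nat\<close> that later carry the
  representations.\<close>

definition fin :: "'v set \<Rightarrow> bool" where
  "fin W \<longleftrightarrow> subspace W \<and> (\<exists>B. finite B \<and> W \<subseteq> span B)"

lemma fin_subspace: "fin W \<Longrightarrow> subspace W"
  by (simp add: fin_def)

lemma fin_subset: "fin W \<Longrightarrow> subspace U \<Longrightarrow> U \<subseteq> W \<Longrightarrow> fin U"
  by (auto simp: fin_def)

lemma fin_span: "finite B \<Longrightarrow> fin (span B)"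
  by (auto simp: fin_def)

lemma fin_independent:
  assumes "fin W" "independent B" "B \<subseteq> W" shows "finite B"
proof -
  obtain C where "finite C" "W \<subseteq> span C" using assms(1) by (auto simp: fin_def)
  then show ?thesis using independent_span_bound[of C B] assms by auto
qed

lemma fin_basis_extend:
  assumes "fin W" "independent A" "A \<subseteq> W"
  obtains C where "A \<subseteq> C" "finite C" "independent C" "span C = W" "card C = dim W"
proof -
  obtain C where C: "A \<subseteq> C" "C \<subseteq> W" "independent C" "W \<subseteq> span C"
    using maximal_independent_subset_extend[OF assms(3,2)] by auto
  have "span C = W"
    using C span_minimal[OF C(2) fin_subspace[OF assms(1)]] by auto
  then show ?thesis
    using that C fin_independent[OF assms(1) C(3,2)] dim_span_eq_card_independent[OF C(3)] by metis
qed

lemma fin_basis: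
  assumes "fin W"
  obtains C where "finite C" "independent C" "span C = W" "card C = dim W"
  using fin_basis_extend[OF assms, of "{}"] independent_empty by auto

lemma fin_dim_less:
  assumes "fin W" "subspace U" "U \<subset> W" shows "dim U < dim W"
proof -
  have "fin U" using assms fin_subset by auto
  then obtain A where A: "finite A" "independent A" "span A = U" "card A = dim U"
    using fin_basis by metis
  have "A \<subseteq> W" using A(3) assms(3) span_superset by blast
  then obtain C where C: "A \<subseteq> C" "finite C" "independent C" "span C = W" "card C = dim W"
    using fin_basis_extend[OF assms(1) A(2)] by metis
  have "A \<noteq> C" using A(3) C(4) assms(3) by auto
  then show ?thesis using A(4) C psubset_card_mono[OF C(2), of A] by auto
qed

lemma fin_dim_eq_0: "fin W \<Longrightarrow> dim W = 0 \<longleftrightarrow> W = {0}"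
proof -
  assume "fin W"
  then obtain C where C: "finite C" "independent C" "span C = W" "card C = dim W"
    using fin_basis by metis
  have "C = {}" if "W = {0}"
  proof (rule ccontr)
    assume "C \<noteq> {}"
    then obtain c where "c \<in> C" by auto
    then have "c = 0" using C(3) that span_base by blast
    then show False using \<open>c \<in> C\<close> C(2) dependent_zero by blast
  qed
  then show ?thesis using C by auto
qed

lemma span_UN_family:
  assumes "finite L" "\<And>i. i \<in> L \<Longrightarrow> subspace (W i)"
  shows "x \<in> span (\<Union>i\<in>L. W i) \<longleftrightarrow> (\<exists>v. (\<forall>i\<in>L. v i \<in> W i) \<and> x = (\<Sum>i\<in>L. v i))"
  using assms
proof (induction L arbitrary: x rule: finite_induct)
  case (insert j L)
  have sj: "span (W j) = W j" using insert.prems by (simp add: span_eq_iff)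
  have "x \<in> span (\<Union>i\<in>insert j L. W i) \<longleftrightarrow> (\<exists>a b. x = a + b \<and> a \<in> W j \<and> b \<in> span (\<Union>i\<in>L. W i))"
    by (auto simp: span_Un sj)
  also have "\<dots> \<longleftrightarrow> (\<exists>a v. a \<in> W j \<and> (\<forall>i\<in>L. v i \<in> W i) \<and> x = a + (\<Sum>i\<in>L. v i))"
    using insert.IH insert.prems by auto
  also have "\<dots> \<longleftrightarrow> (\<exists>v. (\<forall>i\<in>insert j L. v i \<in> W i) \<and> x = (\<Sum>i\<in>insert j L. v i))"
  proof
    assume "\<exists>a v. a \<in> W j \<and> (\<forall>i\<in>L. v i \<in> W i) \<and> x = a + (\<Sum>i\<in>L. v i)"
    then obtain a v where av: "a \<in> W j" "\<forall>i\<in>L. v i \<in> W i" "x = a + (\<Sum>i\<in>L. v i)" by blast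
    have "(\<Sum>i\<in>insert j L. (v(j := a)) i) = a + (\<Sum>i\<in>L. v i)"
      using insert.hyps by (auto intro!: sum.cong)
    then show "\<exists>v. (\<forall>i\<in>insert j L. v i \<in> W i) \<and> x = (\<Sum>i\<in>insert j L. v i)"
      using av insert.hyps by (intro exI[of _ "v(j := a)"]) auto
  qed (use insert.hyps in auto)
  finally show ?case .
qed simp

text \<open>The union of the kernels of the powers of f - mu, as the least set that contains 0 and
  is closed under preimages of f - mu. Nilpotency arguments become rule inductions without an
  exponent to carry along.\<close>

inductive_set geneig :: "('v \<Rightarrow> 'v) \<Rightarrow> complex \<Rightarrow> 'v set" for f \<mu> where
  geneig_zero: "0 \<in> geneig f \<mu>"
| geneig_step: "f v - \<mu> *s v \<in> geneig f \<mu> \<Longrightarrow> v \<in> geneig f \<mu>"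

lemma geneig_shift: "lin f \<Longrightarrow> v \<in> geneig f \<mu> \<Longrightarrow> f v - \<mu> *s v \<in> geneig f \<mu>"
  by (erule geneig.cases) (auto simp: lin_zero intro: geneig_zero)

lemma geneig_add:
  assumes "lin f" "v \<in> geneig f \<mu>" "w \<in> geneig f \<mu>"
  shows "v + w \<in> geneig f \<mu>"
  using assms(2,3)
proof (induction arbitrary: w)
  case (geneig_step v)
  have e: "f (v + w) - \<mu> *s (v + w) = (f v - \<mu> *s v) + (f w - \<mu> *s w)"
    by (simp add: lin_add[OF assms(1)] scale_right_distrib)
  show ?case
    by (rule geneig.geneig_step, unfold e) (rule geneig_step.IH[OF geneig_shift[OF assms(1) geneig_step.prems]])
qed simp

lemma geneig_scale:
  assumes "lin f" "v \<in> geneig f \<mu>"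
  shows "c *s v \<in> geneig f \<mu>"
  using assms(2)
proof (induction)
  case (geneig_step v)
  have "f (c *s v) - \<mu> *s (c *s v) = c *s (f v - \<mu> *s v)"
    by (simp add: lin_scale[OF assms(1)] algebra_simps)
  then show ?case using geneig_step.IH by (metis geneig.geneig_step)
qed (simp add: geneig_zero)

lemma subspace_geneig: "lin f \<Longrightarrow> subspace (geneig f \<mu>)"
  by (simp add: subspace_def geneig_add geneig_scale geneig_zero)

lemma geneig_inv:
  assumes "lin f" "v \<in> geneig f \<mu>" shows "f v \<in> geneig f \<mu>"
  using geneig_add[OF assms(1) geneig_shift[OF assms] geneig_scale[OF assms], of \<mu>] by simp

text \<open>On an eigenvector for mu the operator f - nu is the nonzero scalar mu - nu, so no power
  of it can kill a nonzero one.\<close>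

lemma geneig_eigenvector:
  assumes "lin f" "v \<in> geneig f \<nu>" "f v = \<mu> *s v" "\<mu> \<noteq> \<nu>"
  shows "v = 0"
  using assms(2,3)
proof (induction)
  case (geneig_step v)
  have e: "f v - \<nu> *s v = (\<mu> - \<nu>) *s v" using geneig_step by (simp add: algebra_simps)
  have "f (f v - \<nu> *s v) = \<mu> *s (f v - \<nu> *s v)"
    by (simp add: lin_diff[OF assms(1)] lin_scale[OF assms(1)] geneig_step algebra_simps)
  then show ?case using geneig_step e assms(4) by auto
qed simp

lemma geneig_funpow:
  assumes "(f ^^ k) v = 0" shows "v \<in> geneig f 0"
proof -
  have "(f ^^ k) v \<in> geneig f 0 \<Longrightarrow> v \<in> geneig f 0"
    by (induction k) (use geneig_step[of f _ 0] in auto)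
  then show ?thesis using assms geneig_zero by simp
qed

lemma geneig_funpow_ex:
  assumes "v \<in> geneig f 0" shows "\<exists>k. (f ^^ k) v = 0"
  using assms
proof (induction)
  case (geneig_step v)
  then obtain k where "(f ^^ k) (f v) = 0" by auto
  then have "(f ^^ Suc k) v = 0" by (simp add: funpow_swap1)
  then show ?case by blast
qed (rule exI[of _ 0], simp)

text \<open>On the generalized eigenspace for nu, f - mu is the nonzero scalar nu - mu plus a
  locally nilpotent operator, hence invertible, and the inverse stays inside every invariant
  subspace.\<close>

lemma geneig_solve:
  assumes f: "lin f" and W: "subspace W" "\<And>v. v \<in> W \<Longrightarrow> f v \<in> W"
    and "w \<in> geneig f \<nu>" "w \<in> W" "\<mu> \<noteq> \<nu>"
  shows "\<exists>s\<in>W \<inter> geneig f \<nu>. f s - \<mu> *s s = w"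
  using assms(4,5)
proof (induction)
  case geneig_zero
  then show ?case using W(1) by (intro bexI[of _ 0]) (auto simp: lin_zero[OF f] subspace_0 geneig.geneig_zero)
next
  case (geneig_step w)
  have "f w - \<nu> *s w \<in> W" using W geneig_step.prems by (auto intro: subspace_diff subspace_scale)
  then obtain s where s: "s \<in> W" "s \<in> geneig f \<nu>" "f s - \<mu> *s s = f w - \<nu> *s w"
    using geneig_step.IH by auto
  \<comment> \<open>If (f - mu) s = (f - nu) w, then (f - mu)(w - s) = (nu - mu) w, and dividing
    solves the equation for w.\<close>
  let ?u = "(1 / (\<nu> - \<mu>)) *s (w - s)"
  have "w \<in> geneig f \<nu>" using geneig_step.hyps by (rule geneig.geneig_step)
  then have "?u \<in> W \<inter> geneig f \<nu>"
    using s geneig_step.prems W subspace_geneig[OF f] by (auto intro!: subspace_scale subspace_diff)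
  moreover have "f ?u - \<mu> *s ?u = (1 / (\<nu> - \<mu>)) *s ((f w - \<mu> *s w) - (f s - \<mu> *s s))"
    by (simp add: lin_scale[OF f] lin_diff[OF f] algebra_simps)
  moreover have "(f w - \<mu> *s w) - (f s - \<mu> *s s) = (\<nu> - \<mu>) *s w"
    unfolding s(3) by (simp add: algebra_simps)
  ultimately show ?case using assms(6) by (intro bexI[of _ ?u]) auto
qed

section \<open>Polynomials in an operator and the primary decomposition\<close>

definition poly_op :: "('v \<Rightarrow> 'v) \<Rightarrow> complex poly \<Rightarrow> 'v \<Rightarrow> 'v" where
  "poly_op f p v = fold_coeffs (\<lambda>c w. c *s v + f w) p 0"

lemma poly_op_0 [simp]: "poly_op f 0 v = 0"
  by (simp add: poly_op_def)

lemma poly_op_pCons: "lin f \<Longrightarrow> poly_op f (pCons c p) v = c *s v + f (poly_op f p v)"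
  by (cases "c = 0 \<and> p = 0") (auto simp: poly_op_def lin_zero)

lemma poly_op_add: "lin f \<Longrightarrow> poly_op f (p + q) v = poly_op f p v + poly_op f q v"
  by (induction p q rule: poly_induct2) (auto simp: poly_op_pCons lin_add algebra_simps)

lemma poly_op_smult: "lin f \<Longrightarrow> poly_op f (Polynomial.smult c p) v = c *s poly_op f p v"
  by (induction p) (auto simp: poly_op_pCons lin_scale lin_zero algebra_simps)

lemma poly_op_linear_factor:
  "lin f \<Longrightarrow> poly_op f ([:- \<mu>, 1:] * q) v = f (poly_op f q v) - \<mu> *s poly_op f q v"
  unfolding mult_pCons_left by (simp add: poly_op_add poly_op_smult poly_op_pCons del: smult_minus_left)

lemma poly_op_monom: "lin f \<Longrightarrow> poly_op f (monom 1 k) v = (f ^^ k) v"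
  by (induction k) (auto simp: monom_0 monom_Suc poly_op_pCons lin_zero)

lemma poly_op_in:
  "lin f \<Longrightarrow> subspace W \<Longrightarrow> (\<And>v. v \<in> W \<Longrightarrow> f v \<in> W) \<Longrightarrow> v \<in> W \<Longrightarrow> poly_op f p v \<in> W"
  by (induction p) (auto simp: poly_op_pCons intro: subspace_add subspace_scale subspace_0)

text \<open>The iterates v, f v, f (f v), ... cannot all be independent in a finite-dimensional
  space, so some iterate equals a polynomial of lower degree in f applied to v.\<close>

lemma annihilating_poly:
  assumes f: "lin f" and W: "fin W" "\<And>v. v \<in> W \<Longrightarrow> f v \<in> W" and v: "v \<in> W"
  shows "\<exists>p. p \<noteq> 0 \<and> poly_op f p v = 0"
proof -
  let ?S = "\<lambda>k. (\<lambda>i. (f ^^ i) v) ` {..<k}"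
  have fW: "(f ^^ i) v \<in> W" for i by (induction i) (use W v in auto)
  have "\<exists>k. (f ^^ k) v \<in> span (?S k)"
  proof (rule ccontr)
    assume "\<not> ?thesis"
    then have n: "(f ^^ k) v \<notin> span (?S k)" for k by blast
    have "independent (?S k) \<and> card (?S k) = k" for k
    proof (induction k)
      case (Suc k)
      have "?S (Suc k) = insert ((f ^^ k) v) (?S k)" by (auto simp: lessThan_Suc)
      then show ?case using Suc n[of k] span_superset[of "?S k"]
        by (auto simp: independent_insert card_insert_if)
    qed (simp add: independent_empty)
    moreover obtain B where B: "finite B" "W \<subseteq> span B" using W(1) by (auto simp: fin_def)
    ultimately have i: "independent (?S (Suc (card B)))" "card (?S (Suc (card B))) = Suc (card B)"
      by blast+
    have "?S (Suc (card B)) \<subseteq> span B" using fW B(2) by blast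
    then show False using independent_span_bound[OF B(1) i(1)] i(2) by simp
  qed
  then obtain k where k: "(f ^^ k) v \<in> span (?S k)" by blast
  define P where "P = {q :: complex poly. q = 0 \<or> degree q < k}"
  have "span (?S k) \<subseteq> (\<lambda>q. poly_op f q v) ` P"
  proof (rule span_minimal)
    show "?S k \<subseteq> (\<lambda>q. poly_op f q v) ` P"
    proof
      fix x assume "x \<in> ?S k"
      then obtain i where i: "i < k" "x = (f ^^ i) v" by auto
      show "x \<in> (\<lambda>q. poly_op f q v) ` P"
        using i by (intro image_eqI[of _ _ "monom 1 i"]) (auto simp: P_def poly_op_monom[OF f] degree_monom_eq)
    qed
    show "subspace ((\<lambda>q. poly_op f q v) ` P)"
    proof (rule subspaceI)
      show "0 \<in> (\<lambda>q. poly_op f q v) ` P" by (intro image_eqI[of _ _ 0]) (auto simp: P_def)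
    next
      fix x y assume "x \<in> (\<lambda>q. poly_op f q v) ` P" "y \<in> (\<lambda>q. poly_op f q v) ` P"
      then obtain p q where "p \<in> P" "q \<in> P" "x = poly_op f p v" "y = poly_op f q v" by auto
      moreover from this have "p + q \<in> P" by (auto simp: P_def intro: degree_add_less)
      ultimately show "x + y \<in> (\<lambda>q. poly_op f q v) ` P"
        by (intro image_eqI[of _ _ "p + q"]) (auto simp: poly_op_add[OF f])
    next
      fix c x assume "x \<in> (\<lambda>q. poly_op f q v) ` P"
      then obtain p where "p \<in> P" "x = poly_op f p v" by auto
      then show "c *s x \<in> (\<lambda>q. poly_op f q v) ` P"
        by (intro image_eqI[of _ _ "Polynomial.smult c p"])
           (auto simp: poly_op_smult[OF f] P_def)
    qed
  qed
  then obtain q where q: "q \<in> P" "(f ^^ k) v = poly_op f q v" using k by blast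
  have "monom 1 k \<noteq> q"
  proof
    assume "monom 1 k = q"
    then have "degree q = k" "q \<noteq> 0" using degree_monom_eq[of "1::complex" k] by auto
    then show False using q(1) by (auto simp: P_def)
  qed
  moreover have "poly_op f (monom 1 k + Polynomial.smult (-1) q) v = 0"
    unfolding poly_op_add[OF f] poly_op_smult[OF f] poly_op_monom[OF f] q(2) by simp
  ultimately show ?thesis
    by (intro exI[of _ "monom 1 k + Polynomial.smult (-1) q"]) auto
qed

text \<open>Among the nonzero polynomials p with p(f) v in S take one of least degree. It is not
  constant, so it has a linear factor over the complex numbers; the cofactor yields a vector outside
  S that f - mu moves into S.\<close>

lemma eigenvector_modulo:
  assumes f: "lin f" and W: "fin W" "\<And>v. v \<in> W \<Longrightarrow> f v \<in> W"
    and S: "subspace S" and v: "v \<in> W" "v \<notin> S"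
  shows "\<exists>\<mu> u. u \<in> W \<and> u \<notin> S \<and> f u - \<mu> *s u \<in> S"
proof -
  let ?P = "\<lambda>p. p \<noteq> 0 \<and> poly_op f p v \<in> S"
  obtain p0 where "?P p0" using annihilating_poly[OF f W v(1)] S subspace_0 by metis
  then obtain p where p: "?P p" and min: "\<And>q. ?P q \<Longrightarrow> degree p \<le> degree q"
    using ex_has_least_nat[of ?P p0 degree] by blast
  have "degree p \<noteq> 0"
  proof
    assume "degree p = 0"
    then obtain c where c: "p = [:c:]" using degree_eq_zeroE by blast
    then have "c *s v \<in> S" "c \<noteq> 0" using p by (auto simp: poly_op_pCons[OF f] lin_zero[OF f])
    then have "(1 / c) *s (c *s v) \<in> S" using S subspace_scale by blast
    then show False using v \<open>c \<noteq> 0\<close> by simp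
  qed
  then obtain \<mu> where "poly p \<mu> = 0"
    using fundamental_theorem_of_algebra[of p] by (auto simp: constant_degree)
  then obtain q where q: "p = [:- \<mu>, 1:] * q" by (auto simp: poly_eq_0_iff_dvd dvd_def)
  then have "q \<noteq> 0" using p by auto
  then have "degree p = Suc (degree q)" unfolding q
    using degree_mult_eq[of "[:- \<mu>, 1:]" q] by (simp del: mult_pCons_left)
  then have "poly_op f q v \<notin> S" using min[of q] \<open>q \<noteq> 0\<close> by auto
  moreover have "poly_op f q v \<in> W" using poly_op_in[OF f fin_subspace[OF W(1)] W(2) v(1)] by simp
  ultimately show ?thesis using p unfolding q poly_op_linear_factor[OF f] by blast
qed

text \<open>If the generalized eigenspaces did not span W, an eigenvector modulo their span could be
  corrected by an element of the span to a true generalized eigenvector, which lies in the span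
  after all.\<close>

lemma span_geneig:
  assumes f: "lin f" and W: "fin W" "\<And>v. v \<in> W \<Longrightarrow> f v \<in> W"
  shows "W \<subseteq> span (\<Union>\<mu>. W \<inter> geneig f \<mu>)"
proof (rule ccontr)
  let ?S = "span (\<Union>\<mu>. W \<inter> geneig f \<mu>)"
  assume "\<not> W \<subseteq> ?S"
  then obtain v where "v \<in> W" "v \<notin> ?S" by auto
  then obtain \<mu> u where u: "u \<in> W" "u \<notin> ?S" "f u - \<mu> *s u \<in> ?S"
    using eigenvector_modulo[OF f W subspace_span] by metis
  have sW: "subspace W" using W(1) fin_subspace by auto
  have SW: "?S \<subseteq> W" by (rule span_minimal[OF _ sW]) auto
  \<comment> \<open>Modulo the generalized eigenspace for mu, every w in the span has the form (f -
    mu) s, because f - mu is invertible on the generalized eigenspaces for other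
    eigenvalues.\<close>
  have "\<exists>s\<in>?S. f s - \<mu> *s s - w \<in> geneig f \<mu>" if "w \<in> ?S" for w
    using that
  proof (induction rule: span_induct_alt)
    case base
    show ?case by (intro bexI[of _ 0]) (auto simp: lin_zero[OF f] geneig_zero span_zero)
  next
    case (step c x y)
    then obtain s where s: "s \<in> ?S" "f s - \<mu> *s s - y \<in> geneig f \<mu>" by auto
    obtain \<nu> where x: "x \<in> W" "x \<in> geneig f \<nu>" using step by auto
    have "\<exists>r\<in>?S. f r - \<mu> *s r - x \<in> geneig f \<mu>"
    proof (cases "\<mu> = \<nu>")
      case True
      have "- x \<in> geneig f \<mu>" using x True subspace_geneig[OF f] subspace_neg by auto
      then show ?thesis by (intro bexI[of _ 0]) (auto simp: lin_zero[OF f] span_zero)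
    next
      case False
      obtain r where r: "r\<in>W \<inter> geneig f \<nu>" "f r - \<mu> *s r = x"
        using geneig_solve[OF f sW W(2) x(2) x(1) False] by auto
      then have "r \<in> ?S" by (intro span_base) auto
      then show ?thesis using r by (intro bexI[of _ r]) (auto simp: geneig_zero)
    qed
    then obtain r where r: "r \<in> ?S" "f r - \<mu> *s r - x \<in> geneig f \<mu>" by auto
    have "c *s (f r - \<mu> *s r - x) + (f s - \<mu> *s s - y) \<in> geneig f \<mu>"
      using r s by (intro geneig_add[OF f] geneig_scale[OF f]) auto
    then show ?case using r s
      by (intro bexI[of _ "c *s r + s"])
         (auto simp: lin_add[OF f] lin_scale[OF f] algebra_simps intro!: span_add span_scale)
  qed
  from this[OF u(3)] obtain s where s: "s \<in> ?S" "f s - \<mu> *s s - (f u - \<mu> *s u) \<in> geneig f \<mu>" by auto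
  have "s - u \<in> geneig f \<mu>"
    by (rule geneig_step) (use s(2) in \<open>simp add: lin_diff[OF f] algebra_simps\<close>)
  then have "s - u \<in> ?S" using s(1) SW u(1) sW by (intro span_base) (auto intro: subspace_diff)
  then have "s - (s - u) \<in> ?S" using s(1) by (rule span_diff[rotated])
  then show False using u(2) by simp
qed

end

section \<open>Traces\<close>

context complex_vs begin

section \<open>Traces on invariant subspaces\<close>

definition basis_trace :: "'v set \<Rightarrow> ('v \<Rightarrow> 'v) \<Rightarrow> complex" where
  "basis_trace B f = (\<Sum>b\<in>B. representation B (f b) b)"

text \<open>The trace is taken on a subspace because later arguments compare traces of one operator
  on many sums of weight spaces. For operators that preserve W the chosen basis is
  immaterial.\<close>

definition trace :: "'v set \<Rightarrow> ('v \<Rightarrow> 'v) \<Rightarrow> complex" where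
  "trace W f = basis_trace (SOME B. independent B \<and> span B = W) f"

lemma rep_sum:
  assumes "finite B" "independent B" "v \<in> span B"
  shows "(\<Sum>b\<in>B. representation B v b *s b) = v"
  using sum_representation_eq[OF assms(2,3,1)] by simp

lemma rep_lin_sum:
  assumes B: "independent B" and g: "lin g" "\<And>b. b \<in> A \<Longrightarrow> g (h b) \<in> span B"
  shows "representation B (g (\<Sum>b\<in>A. c b *s h b)) x = (\<Sum>b\<in>A. c b * representation B (g (h b)) x)"
proof -
  have "g (\<Sum>b\<in>A. c b *s h b) = (\<Sum>b\<in>A. c b *s g (h b))"
    by (simp add: lin_sum[OF g(1)] lin_scale[OF g(1)])
  also have "representation B \<dots> x = (\<Sum>b\<in>A. representation B (c b *s g (h b)) x)"
    using g(2) by (subst representation_sum[OF B]) (auto intro: span_scale)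
  also have "\<dots> = (\<Sum>b\<in>A. c b * representation B (g (h b)) x)"
    using g(2) by (intro sum.cong refl) (simp add: representation_scale[OF B])
  finally show ?thesis .
qed

text \<open>Expand f b in the basis C and extract the coordinate at b; the resulting double sum,
  read in the other order, is the trace in the basis C.\<close>

lemma basis_trace_change:
  assumes B: "finite B" "independent B" "span B = W" and C: "finite C" "independent C" "span C = W"
    and f: "lin f" "\<And>v. v \<in> W \<Longrightarrow> f v \<in> W"
  shows "basis_trace B f = basis_trace C f"
proof -
  have inW: "b \<in> W" if "b \<in> B \<or> b \<in> C" for b
    using that B(3) C(3) span_base[of b B] span_base[of b C] by auto
  have "basis_trace B f = (\<Sum>b\<in>B. representation B (\<Sum>c\<in>C. representation C (f b) c *s c) b)"
    unfolding basis_trace_def using rep_sum[OF C(1,2)] C(3) f(2) inW by (intro sum.cong) auto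
  also have "\<dots> = (\<Sum>b\<in>B. \<Sum>c\<in>C. representation C (f b) c * representation B c b)"
  proof (rule sum.cong)
    fix b assume "b \<in> B"
    show "representation B (\<Sum>c\<in>C. representation C (f b) c *s c) b
        = (\<Sum>c\<in>C. representation C (f b) c * representation B c b)"
      using rep_lin_sum[OF B(2) linear_id[unfolded id_def], of C "\<lambda>c. c" "representation C (f b)" b] inW B(3) by simp
  qed simp
  also have "\<dots> = (\<Sum>c\<in>C. \<Sum>b\<in>B. representation B c b * representation C (f b) c)"
    by (subst sum.swap) (simp add: mult.commute)
  also have "\<dots> = (\<Sum>c\<in>C. representation C (f (\<Sum>b\<in>B. representation B c b *s b)) c)"
    by (intro sum.cong refl, subst rep_lin_sum[OF C(2) f(1)]) (auto simp: C(3) f(2) inW)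
  also have "\<dots> = basis_trace C f"
    unfolding basis_trace_def using rep_sum[OF B(1,2)] B(3) inW by (intro sum.cong) auto
  finally show ?thesis .
qed

lemma trace_eq:
  assumes "finite B" "independent B" "span B = W" "lin f" "\<And>v. v \<in> W \<Longrightarrow> f v \<in> W"
  shows "trace W f = basis_trace B f"
proof -
  define C where "C = (SOME B. independent B \<and> span B = W)"
  have C: "independent C" "span C = W"
    using someI[of "\<lambda>B. independent B \<and> span B = W" B] assms unfolding C_def by auto
  have "C \<subseteq> span B" using C assms span_superset by auto
  then have "finite C" using independent_span_bound[OF assms(1) C(1)] by auto
  then show ?thesis unfolding trace_def C_def[symmetric]
    using basis_trace_change[OF _ C assms(1-5)] by simp
qed

definition preserves :: "('v \<Rightarrow> 'v) \<Rightarrow> 'v set \<Rightarrow> bool" where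
  "preserves f W \<longleftrightarrow> lin f \<and> (\<forall>v\<in>W. f v \<in> W)"

lemma preserves_lin: "preserves f W \<Longrightarrow> lin f"
  and preservesD: "preserves f W \<Longrightarrow> v \<in> W \<Longrightarrow> f v \<in> W"
  by (auto simp: preserves_def)

lemma trace_basis:
  assumes "fin W"
  obtains B where "finite B" "independent B" "span B = W" "card B = dim W"
    "\<And>f. preserves f W \<Longrightarrow> trace W f = basis_trace B f"
  using fin_basis[OF assms] trace_eq unfolding preserves_def by metis

lemma lin_compose: "lin f \<Longrightarrow> lin g \<Longrightarrow> lin (\<lambda>v. f (g v))"
  by (rule linI) (auto simp: lin_add lin_scale)

lemma lin_plus: "lin f \<Longrightarrow> lin g \<Longrightarrow> lin (\<lambda>v. f v + g v)"
  by (rule linI) (auto simp: lin_add lin_scale algebra_simps)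

lemma lin_minus: "lin f \<Longrightarrow> lin g \<Longrightarrow> lin (\<lambda>v. f v - g v)"
  by (rule linI) (auto simp: lin_add lin_scale algebra_simps)

lemma lin_cmult: "lin f \<Longrightarrow> lin (\<lambda>v. c *s f v)"
  by (rule linI) (auto simp: lin_add lin_scale algebra_simps)

lemma preserves_compose: "preserves f W \<Longrightarrow> preserves g W \<Longrightarrow> preserves (\<lambda>v. f (g v)) W"
  by (auto simp: preserves_def lin_compose)

lemma preserves_plus: "subspace W \<Longrightarrow> preserves f W \<Longrightarrow> preserves g W \<Longrightarrow> preserves (\<lambda>v. f v + g v) W"
  by (auto simp: preserves_def lin_plus intro: subspace_add)

lemma preserves_minus: "subspace W \<Longrightarrow> preserves f W \<Longrightarrow> preserves g W \<Longrightarrow> preserves (\<lambda>v. f v - g v) W"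
  by (auto simp: preserves_def lin_minus intro: subspace_diff)

lemma preserves_cmult: "subspace W \<Longrightarrow> preserves f W \<Longrightarrow> preserves (\<lambda>v. c *s f v) W"
  by (auto simp: preserves_def lin_cmult intro: subspace_scale)

lemma preserves_scale: "subspace W \<Longrightarrow> preserves (\<lambda>v. c *s v) W"
  by (auto simp: preserves_def intro: subspace_scale linI simp: algebra_simps)

lemma preserves_UNIV: "lin f \<Longrightarrow> preserves f UNIV"
  by (auto simp: preserves_def)

lemma trace_plus:
  assumes W: "fin W" and "preserves f W" "preserves g W"
  shows "trace W (\<lambda>v. f v + g v) = trace W f + trace W g"
proof -
  obtain B where B: "independent B" "span B = W" "\<And>f. preserves f W \<Longrightarrow> trace W f = basis_trace B f"
    using trace_basis[OF W] by metis
  have "f b \<in> span B \<and> g b \<in> span B" if "b \<in> B" for b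
    using that assms B span_base by (metis preservesD)
  then show ?thesis
    using B assms preserves_plus[OF fin_subspace[OF W] assms(2,3)]
    by (simp add: basis_trace_def representation_add[OF B(1)] sum.distrib)
qed

lemma trace_cmult:
  assumes W: "fin W" and "preserves f W"
  shows "trace W (\<lambda>v. c *s f v) = c * trace W f"
proof -
  obtain B where B: "independent B" "span B = W" "\<And>f. preserves f W \<Longrightarrow> trace W f = basis_trace B f"
    using trace_basis[OF W] by metis
  have "f b \<in> span B" if "b \<in> B" for b
    using that assms B span_base by (metis preservesD)
  then show ?thesis
    using B assms preserves_cmult[OF fin_subspace[OF W] assms(2)]
    by (simp add: basis_trace_def representation_scale[OF B(1)] sum_distrib_left)
qed

lemma trace_minus:
  assumes W: "fin W" and "preserves f W" "preserves g W"
  shows "trace W (\<lambda>v. f v - g v) = trace W f - trace W g"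
  using trace_plus[OF W preserves_minus[OF fin_subspace[OF W] assms(2,3)] assms(3)] by simp

lemma trace_scale:
  assumes W: "fin W" shows "trace W (\<lambda>v. c *s v) = c * of_nat (dim W)"
proof -
  obtain B where B: "independent B" "span B = W" "card B = dim W"
      "\<And>f. preserves f W \<Longrightarrow> trace W f = basis_trace B f"
    using trace_basis[OF W] by metis
  have "basis_trace B (\<lambda>v. c *s v) = (\<Sum>b\<in>B. c)"
    unfolding basis_trace_def by (intro sum.cong refl) (simp add: representation_scale[OF B(1)] representation_basis[OF B(1)] span_base)
  then show ?thesis using B preserves_scale[OF fin_subspace[OF W]] by simp
qed

lemma trace_commute:
  assumes W: "fin W" and f: "preserves f W" and g: "preserves g W"
  shows "trace W (\<lambda>v. f (g v)) = trace W (\<lambda>v. g (f v))"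
proof -
  obtain B where B: "finite B" "independent B" "span B = W" "\<And>f. preserves f W \<Longrightarrow> trace W f = basis_trace B f"
    using trace_basis[OF W] by metis
  have inW: "b \<in> B \<Longrightarrow> b \<in> W" for b using B span_base by metis
  have *: "basis_trace B (\<lambda>v. f (g v)) = (\<Sum>b\<in>B. \<Sum>c\<in>B. representation B (g b) c * representation B (f c) b)"
    if f: "preserves f W" and g: "preserves g W" for f g
  proof -
    have "representation B (f (g b)) b = (\<Sum>c\<in>B. representation B (g b) c * representation B (f c) b)" if "b \<in> B" for b
    proof -
      have "g b \<in> span B" using preservesD[OF g] inW that B by auto
      then have "f (g b) = f (\<Sum>c\<in>B. representation B (g b) c *s c)"
        using rep_sum[OF B(1,2)] by simp
      then show ?thesis
        using rep_lin_sum[OF B(2) preserves_lin[OF f], of B "\<lambda>c. c"] preservesD[OF f] inW B(3) by simp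
    qed
    then show ?thesis by (simp add: basis_trace_def)
  qed
  have "basis_trace B (\<lambda>v. f (g v)) = basis_trace B (\<lambda>v. g (f v))"
    unfolding *[OF f g] *[OF g f] by (subst sum.swap) (simp add: mult.commute)
  then show ?thesis using B(4) preserves_compose f g by simp
qed

text \<open>In a basis of W that extends one of U, the added vectors contribute nothing because
  their images have coordinates in U only.\<close>

lemma trace_into:
  assumes W: "fin W" and U: "subspace U" "U \<subseteq> W" and f: "lin f" "\<And>v. v \<in> W \<Longrightarrow> f v \<in> U"
  shows "trace W f = trace U f"
proof -
  obtain A where A: "finite A" "independent A" "span A = U"
    using fin_basis[OF fin_subset[OF W U]] by metis
  have "A \<subseteq> W" using A U span_superset by blast
  then obtain C where C: "A \<subseteq> C" "finite C" "independent C" "span C = W"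
    using fin_basis_extend[OF W A(2)] by metis
  have r: "representation C (f c) = representation A (f c)" if "c \<in> C" for c
  proof -
    have "f c \<in> span A" using f(2) that C(4) A(3) span_base by blast
    then show ?thesis using representation_extend[OF C(3) _ C(1)] by simp
  qed
  have "basis_trace C f = (\<Sum>c\<in>C. representation A (f c) c)" unfolding basis_trace_def using r by simp
  also have "\<dots> = basis_trace A f" unfolding basis_trace_def
    by (rule sum.mono_neutral_right[OF C(2,1)]) (use representation_ne_zero in blast)
  finally show ?thesis
    using trace_eq[OF A f(1)] trace_eq[OF C(2,3,4) f(1)] f(2) U(2) by fastforce
qed

lemma funpow_lin: "lin f \<Longrightarrow> lin (f ^^ k)"
  by (induction k) (auto intro!: linI simp: lin_add lin_scale)

lemma uniform_nilpotent:
  assumes "fin W" "lin f" "W \<subseteq> geneig f 0"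
  shows "\<exists>k. \<forall>v\<in>W. (f ^^ k) v = 0"
proof -
  obtain B where B: "finite B" "span B = W" using fin_basis[OF assms(1)] by metis
  have "\<exists>k. \<forall>b\<in>B. (f ^^ k) b = 0"
  proof -
    have "\<forall>b\<in>B. \<exists>k. (f ^^ k) b = 0"
      using geneig_funpow_ex assms(3) B span_superset by blast
    then obtain k where k: "\<forall>b\<in>B. (f ^^ k b) b = 0" by metis
    have "(f ^^ (\<Sum>b\<in>B. k b)) b = 0" if "b \<in> B" for b
    proof -
      have "(\<Sum>b\<in>B. k b) = ((\<Sum>b\<in>B. k b) - k b) + k b" using member_le_sum[OF that, of k] B(1) by simp
      then have "(f ^^ (\<Sum>b\<in>B. k b)) b = (f ^^ ((\<Sum>b\<in>B. k b) - k b)) ((f ^^ k b) b)"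
        by (metis comp_apply funpow_add)
      then show ?thesis using k that funpow_lin[OF assms(2)] lin_zero by metis
    qed
    then show ?thesis by blast
  qed
  then obtain k where k: "\<forall>b\<in>B. (f ^^ k) b = 0" by blast
  have "(f ^^ k) v = 0" if "v \<in> span B" for v
    using that by (induction rule: span_induct_alt)
      (auto simp: lin_zero lin_add lin_scale funpow_lin[OF assms(2)] k)
  then show ?thesis using B by blast
qed

lemma lin_image_subspace:
  assumes "lin f" "subspace W" shows "subspace (f ` W)"
proof (rule subspaceI)
  show "0 \<in> f ` W" using lin_zero[OF assms(1)] subspace_0[OF assms(2)] by force
next
  fix x y assume "x \<in> f ` W" "y \<in> f ` W"
  then obtain a b where "a \<in> W" "b \<in> W" "x = f a" "y = f b" by auto
  then show "x + y \<in> f ` W"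
    using lin_add[OF assms(1), of a b] subspace_add[OF assms(2), of a b] by (metis imageI)
next
  fix c x assume "x \<in> f ` W"
  then obtain a where "a \<in> W" "x = f a" by auto
  then show "c *s x \<in> f ` W"
    using lin_scale[OF assms(1), of c a] subspace_scale[OF assms(2), of a c] by (metis imageI)
qed

text \<open>A nilpotent operator maps a nonzero space onto a smaller one, and its trace equals its
  trace on that image, so the dimension can be lowered.\<close>

lemma trace_nilpotent:
  assumes "fin W" "preserves f W" "W \<subseteq> geneig f 0"
  shows "trace W f = 0"
  using assms
proof (induction "dim W" arbitrary: W rule: less_induct)
  case less
  have f: "lin f" using less preserves_lin by auto
  show ?case
  proof (cases "W = {0}")
    case True
    have "trace W f = basis_trace {} f"
      by (rule trace_eq) (auto simp: True independent_empty f lin_zero)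
    then show ?thesis by (simp add: basis_trace_def)
  next
    case False
    let ?U = "f ` W"
    have sub: "?U \<subseteq> W" using less.prems preservesD by auto
    have "?U \<noteq> W"
    proof
      assume e: "?U = W"
      have "(f ^^ k) ` W = W" for k
      proof (induction k)
        case (Suc k)
        have "(f ^^ Suc k) ` W = f ` ((f ^^ k) ` W)" by (auto simp: image_image)
        then show ?case using Suc e by simp
      qed auto
      moreover obtain k where "\<forall>v\<in>W. (f ^^ k) v = 0" using uniform_nilpotent f less.prems by blast
      ultimately have "W \<subseteq> {0}" by (metis image_subsetI singleton_iff)
      then show False using False subspace_0[OF fin_subspace[OF less.prems(1)]] by auto
    qed
    have sU: "subspace ?U" by (rule lin_image_subspace[OF f fin_subspace[OF less.prems(1)]])
    have "trace ?U f = 0"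
    proof (rule less.hyps)
      show "dim ?U < dim W" using fin_dim_less[OF less.prems(1) sU] sub \<open>?U \<noteq> W\<close> by auto
      show "fin ?U" using fin_subset[OF less.prems(1) sU sub] .
      show "preserves f ?U" using sub f by (auto simp: preserves_def)
      show "?U \<subseteq> geneig f 0" using sub less.prems by auto
    qed
    then show ?thesis using trace_into[OF less.prems(1) sU sub f] by simp
  qed
qed

lemma geneig_translate:
  assumes "v \<in> geneig f c" shows "v \<in> geneig (\<lambda>v. f v - c *s v) 0"
  using assms by induction (auto intro: geneig_zero geneig_step)

lemma trace_geneig:
  assumes W: "fin W" and f: "preserves f W" and "W \<subseteq> geneig f c"
  shows "trace W f = c * of_nat (dim W)"
proof -
  have p: "preserves (\<lambda>v. c *s v) W" using preserves_scale[OF fin_subspace[OF W]] .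
  have "trace W (\<lambda>v. f v - c *s v) = 0"
    by (rule trace_nilpotent[OF W preserves_minus[OF fin_subspace[OF W] f p]])
       (use assms(3) geneig_translate in auto)
  then show ?thesis using trace_minus[OF W f p] trace_scale[OF W] by simp
qed

lemma independent_direct_Un:
  assumes A: "independent A" "span A = U" and B: "independent B" "span B = V"
    and UV: "U \<inter> V = {0}"
  shows "independent (A \<union> B)"
proof -
  have *: "a \<notin> span (A \<union> B - {a})"
    if A: "independent A" "span A = U" and B: "independent B" "span B = V" and UV: "U \<inter> V = {0}" and a: "a \<in> A" for A B U V a
  proof
    assume "a \<in> span (A \<union> B - {a})"
    moreover have "A \<union> B - {a} \<subseteq> (A - {a}) \<union> B" by auto
    ultimately have "a \<in> span ((A - {a}) \<union> B)" using span_mono by blast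
    then obtain u w where u: "a = u + w" "u \<in> span (A - {a})" "w \<in> span B"
      by (auto simp: span_Un)
    have "u \<in> U" using u(2) A(2) span_mono[of "A - {a}" A] by blast
    then have "a - u \<in> U" using a A span_base span_diff by metis
    then have "w \<in> U \<inter> V" using u B by (simp add: algebra_simps)
    then have "w = 0" using UV by auto
    then show False using u A(1) a by (auto simp: dependent_def)
  qed
  have "x \<notin> span (A \<union> B - {x})" if "x \<in> A \<union> B" for x
    using that *[OF A B UV, of x] *[OF B A, of x] UV by (auto simp: Un_commute Int_commute)
  then show ?thesis unfolding dependent_def by blast
qed

lemma trace_direct_Un:
  assumes U: "fin U" and V: "fin V" and UV: "U \<inter> V = {0}"
    and f: "preserves f U" "preserves f V"
  shows "trace (span (U \<union> V)) f = trace U f + trace V f"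
proof -
  have l: "lin f" using f preserves_lin by blast
  obtain A where A: "finite A" "independent A" "span A = U" using fin_basis[OF U] by metis
  obtain B where B: "finite B" "independent B" "span B = V" using fin_basis[OF V] by metis
  have i: "independent (A \<union> B)" by (rule independent_direct_Un[OF A(2,3) B(2,3) UV])
  have s: "span (A \<union> B) = span (U \<union> V)" 
    unfolding A(3)[symmetric] B(3)[symmetric] by (simp add: span_Un span_span)
  have d: "A \<inter> B = {}"
  proof (rule ccontr)
    assume "A \<inter> B \<noteq> {}"
    then obtain x where "x \<in> A" "x \<in> B" by auto
    then have "x \<in> U \<inter> V" using A B span_base by blast
    then have "x = 0" using UV by auto
    then show False using \<open>x \<in> A\<close> A(2) dependent_zero by auto
  qed
  have "f v \<in> span (U \<union> V)" if "v \<in> span (U \<union> V)" for v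
    using that
  proof (induction rule: span_induct_alt)
    case base
    show ?case by (simp add: lin_zero[OF l] span_zero)
  next
    case (step c x y)
    have "f x \<in> span (U \<union> V)" using step f preservesD by (intro span_base) blast
    then show ?case using step by (auto simp: lin_add[OF l] lin_scale[OF l] intro: span_add span_scale)
  qed
  then have "trace (span (U \<union> V)) f = basis_trace (A \<union> B) f"
    using trace_eq[OF _ i s l] A B by auto
  also have "\<dots> = (\<Sum>b\<in>A. representation (A \<union> B) (f b) b) + (\<Sum>b\<in>B. representation (A \<union> B) (f b) b)"
    unfolding basis_trace_def using A B d by (simp add: sum.union_disjoint)
  also have "(\<Sum>b\<in>A. representation (A \<union> B) (f b) b) = basis_trace A f" unfolding basis_trace_def
  proof (rule sum.cong)
    fix b assume "b \<in> A"
    then have "f b \<in> span A" using A f span_base preservesD by metis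
    then show "representation (A \<union> B) (f b) b = representation A (f b) b"
      using representation_extend[OF i, of _ A] by auto
  qed simp
  also have "(\<Sum>b\<in>B. representation (A \<union> B) (f b) b) = basis_trace B f" unfolding basis_trace_def
  proof (rule sum.cong)
    fix b assume "b \<in> B"
    then have "f b \<in> span B" using B f span_base preservesD by metis
    then show "representation (A \<union> B) (f b) b = representation B (f b) b"
      using representation_extend[OF i, of _ B] by auto
  qed simp
  finally show ?thesis
    using trace_eq[OF A l] trace_eq[OF B l] f preservesD by metis
qed

section \<open>Direct sums of subspaces and additivity of the trace\<close>

definition direct :: "'i set \<Rightarrow> ('i \<Rightarrow> 'v set) \<Rightarrow> bool" where
  "direct L W \<longleftrightarrow> (\<forall>v. (\<forall>i\<in>L. v i \<in> W i) \<and> (\<Sum>i\<in>L. v i) = 0 \<longrightarrow> (\<forall>i\<in>L. v i = 0))"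

lemma direct_insertD:
  assumes "finite L" "j \<notin> L" "direct (insert j L) W" "\<And>i. i \<in> insert j L \<Longrightarrow> subspace (W i)"
  shows "direct L W" "W j \<inter> span (\<Union>i\<in>L. W i) = {0}"
proof -
  show "direct L W" unfolding direct_def
  proof (intro allI impI)
    fix v assume v: "(\<forall>i\<in>L. v i \<in> W i) \<and> sum v L = 0"
    have "\<forall>i\<in>insert j L. (v(j := 0)) i \<in> W i" using v assms(4) subspace_0 by auto
    moreover have "sum (v(j := 0)) L = sum v L" using assms(2) by (intro sum.cong) auto
    then have "sum (v(j := 0)) (insert j L) = 0"
      using v assms(1,2) by simp
    ultimately have "\<forall>i\<in>insert j L. (v(j := 0)) i = 0" using assms(3) unfolding direct_def by blast
    then show "\<forall>i\<in>L. v i = 0" using assms(2) by (metis fun_upd_other insertCI)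
  qed
  have "x = 0" if x: "x \<in> W j" "x \<in> span (\<Union>i\<in>L. W i)" for x
  proof -
    obtain v where v: "\<forall>i\<in>L. v i \<in> W i" "x = sum v L"
      using x(2) span_UN_family[OF assms(1), of W x] assms(4) by auto
    have "\<forall>i\<in>insert j L. (v(j := - x)) i \<in> W i" using v x(1) assms(4) subspace_neg by auto
    moreover have "sum (v(j := - x)) L = sum v L" using assms(2) by (intro sum.cong) auto
    then have "sum (v(j := - x)) (insert j L) = 0"
      using v assms(1,2) by simp
    ultimately have "(v(j := - x)) j = 0" using assms(3) unfolding direct_def by blast
    then show ?thesis by simp
  qed
  then show "W j \<inter> span (\<Union>i\<in>L. W i) = {0}"
    using assms(4)[of j] subspace_0 span_zero by auto
qed

text \<open>Finite dimension and invariance of the sum are part of the conclusion because the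
  induction feeds the span of the previous summands into the case of two summands.\<close>

lemma trace_direct:
  assumes "finite L" "direct L W" "\<And>i. i \<in> L \<Longrightarrow> fin (W i)" "\<And>i. i \<in> L \<Longrightarrow> preserves f (W i)"
    "lin f"
  shows "fin (span (\<Union>i\<in>L. W i)) \<and> preserves f (span (\<Union>i\<in>L. W i)) \<and>
    trace (span (\<Union>i\<in>L. W i)) f = (\<Sum>i\<in>L. trace (W i) f)"
  using assms
proof (induction L rule: finite_induct)
  case empty
  have "trace {0} f = basis_trace {} f"
    by (rule trace_eq) (auto simp: independent_empty empty lin_zero)
  then show ?case using fin_span[of "{}"] empty.prems(4) by (simp add: basis_trace_def preserves_def lin_zero)
next
  case (insert j L)
  note d = direct_insertD[OF insert.hyps insert.prems(1) fin_subspace[OF insert.prems(2)]]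
  let ?V = "span (\<Union>i\<in>L. W i)"
  have IH: "fin ?V" "preserves f ?V" "trace ?V f = (\<Sum>i\<in>L. trace (W i) f)"
    using insert.IH[OF d(1)] insert.prems by auto
  have sj: "span (W j) = W j" using insert.prems(2)[of j] fin_subspace by (simp add: span_eq_iff)
  have e: "span (\<Union>i\<in>insert j L. W i) = span (W j \<union> ?V)"
    by (simp add: span_Un span_span sj)
  obtain A where A: "finite A" "independent A" "span A = W j" "card A = dim (W j)"
    by (rule fin_basis[OF insert.prems(2)[OF insertI1]])
  obtain B where B: "finite B" "independent B" "span B = ?V" "card B = dim ?V" by (rule fin_basis[OF IH(1)])
  have "span (A \<union> B) = span (W j \<union> ?V)" unfolding A(3)[symmetric] B(3)[symmetric] by (simp add: span_Un span_span)
  then have "fin (span (W j \<union> ?V))" using fin_span[of "A \<union> B"] A B by simp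
  moreover have "preserves f (span (W j \<union> ?V))"
    unfolding preserves_def
  proof (intro conjI ballI)
    fix v assume "v \<in> span (W j \<union> ?V)"
    then obtain a b where ab: "v = a + b" "a \<in> W j" "b \<in> ?V" by (auto simp: span_Un sj span_span)
    then have "f a \<in> W j" "f b \<in> ?V"
      using preservesD[OF insert.prems(3)[of j]] preservesD[OF IH(2)] by auto
    then have "f a \<in> span (W j \<union> ?V)" "f b \<in> span (W j \<union> ?V)"
      by (auto intro: span_base)
    then show "f v \<in> span (W j \<union> ?V)"
      unfolding ab(1) lin_add[OF insert.prems(4)] by (rule span_add)
  qed (rule insert.prems)
  moreover have "trace (span (W j \<union> ?V)) f = trace (W j) f + trace ?V f"
    using trace_direct_Un[OF insert.prems(2) IH(1) d(2) insert.prems(3) IH(2)] by auto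
  ultimately show ?case using IH(3) insert.hyps e by simp
qed

end

section \<open>Weight spaces and Engel's theorem\<close>

text \<open>The operators need not commute. That each of them preserves the generalized eigenspaces
  of the others is what the nilpotency of a Lie algebra provides, and it suffices for weight spaces.
  It is instantiated with the adjoint action of \<open>H\<close>, with a single operator, and with
  \<open>H\<close> acting in a representation.\<close>

locale operator_family = complex_vs scale
  for scale :: "complex \<Rightarrow> 'v::ab_group_add \<Rightarrow> 'v" (infixr "*s" 75) +
  fixes H :: "'t set" and R :: "'t \<Rightarrow> 'v \<Rightarrow> 'v"
  assumes lin_R: "t \<in> H \<Longrightarrow> lin (R t)"
    and geneig_R: "s \<in> H \<Longrightarrow> t \<in> H \<Longrightarrow> v \<in> geneig (R t) \<mu> \<Longrightarrow> R s v \<in> geneig (R t) \<mu>"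
begin

definition wt :: "('t \<Rightarrow> complex) \<Rightarrow> 'v set" where
  "wt l = {v. \<forall>t\<in>H. v \<in> geneig (R t) (l t)}"

text \<open>Only the values on \<open>H\<close> matter for a weight; vanishing elsewhere selects one
  function per weight, as in \<open>h_functional\<close>.\<close>

definition canon :: "('t \<Rightarrow> complex) set" where
  "canon = {l. \<forall>t. t \<notin> H \<longrightarrow> l t = 0}"

lemma canon_eqI:
  assumes "l \<in> canon" "m \<in> canon" "\<And>t. t \<in> H \<Longrightarrow> l t = m t" shows "l = m"
proof
  fix t show "l t = m t" using assms by (cases "t \<in> H") (auto simp: canon_def)
qed

lemma wt_cong: "(\<And>t. t \<in> H \<Longrightarrow> l t = m t) \<Longrightarrow> wt l = wt m"
  by (auto simp: wt_def)

lemma subspace_wt: "subspace (wt l)"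
  unfolding subspace_def wt_def
  by (auto intro: geneig_add geneig_scale geneig_zero lin_R)

lemma R_wt: "s \<in> H \<Longrightarrow> v \<in> wt l \<Longrightarrow> R s v \<in> wt l"
  by (auto simp: wt_def intro: geneig_R)

lemma preserves_wt: "s \<in> H \<Longrightarrow> preserves (R s) (wt l)"
  by (auto simp: preserves_def lin_R R_wt)

text \<open>Either every operator has a single generalized eigenvalue on W, and W lies in one weight
  space, or some operator breaks W into generalized eigenspaces of smaller dimension, to which the
  induction applies.\<close>

lemma wt_span:
  assumes "fin W" "\<And>t v. t \<in> H \<Longrightarrow> v \<in> W \<Longrightarrow> R t v \<in> W"
  shows "W \<subseteq> span (\<Union>l\<in>canon. W \<inter> wt l)"
  using assms
proof (induction "dim W" arbitrary: W rule: less_induct)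
  case less
  have sW: "subspace W" using less.prems fin_subspace by auto
  show ?case
  proof (cases "\<forall>t\<in>H. \<exists>\<mu>. W \<subseteq> geneig (R t) \<mu>")
    case True
    then obtain m where m: "\<forall>t\<in>H. W \<subseteq> geneig (R t) (m t)" by metis
    let ?l = "\<lambda>t. if t \<in> H then m t else 0"
    have "W \<subseteq> W \<inter> wt ?l" "?l \<in> canon" using m by (auto simp: wt_def canon_def)
    then have "W \<subseteq> (\<Union>l\<in>canon. W \<inter> wt l)" by blast
    then show ?thesis using span_superset by (rule subset_trans)
  next
    case False
    then obtain t where t: "t \<in> H" "\<And>\<mu>. \<not> W \<subseteq> geneig (R t) \<mu>" by blast
    have "W \<inter> geneig (R t) \<mu> \<subseteq> span (\<Union>l\<in>canon. W \<inter> wt l)" for \<mu>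
    proof -
      let ?U = "W \<inter> geneig (R t) \<mu>"
      have sU: "subspace ?U"
        using sW subspace_geneig[OF lin_R[OF t(1)]] by (rule subspace_inter)
      have "?U \<subseteq> span (\<Union>l\<in>canon. ?U \<inter> wt l)"
      proof (rule less.hyps)
        show "dim ?U < dim W" using fin_dim_less[OF less.prems(1) sU] t(2)[of \<mu>] by auto
        show "fin ?U" using fin_subset[OF less.prems(1) sU] by auto
        show "R s v \<in> ?U" if "s \<in> H" "v \<in> ?U" for s v
          using that less.prems(2) geneig_R t(1) by auto
      qed
      also have "\<dots> \<subseteq> span (\<Union>l\<in>canon. W \<inter> wt l)" by (rule span_mono) auto
      finally show ?thesis .
    qed
    then have "span (\<Union>\<mu>. W \<inter> geneig (R t) \<mu>) \<subseteq> span (\<Union>l\<in>canon. W \<inter> wt l)"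
      by (intro span_minimal) auto
    then show ?thesis using span_geneig[OF lin_R[OF t(1)] less.prems(1) less.prems(2)[OF t(1)]] by blast
  qed
qed

text \<open>Applying R t - c to the relation shortens the nilpotent part x and keeps the form of the
  relation, while it kills no nonzero vector in a weight space whose eigenvalue at t differs from
  c.\<close>

lemma wt_separate:
  assumes L: "direct L wt" and t: "t \<in> H" and x: "x \<in> geneig (R t) c"
    and v: "\<forall>i\<in>L. v i \<in> wt i" "x + (\<Sum>i\<in>L. v i) = 0"
  shows "\<forall>i\<in>L. i t \<noteq> c \<longrightarrow> v i = 0"
  using x v
proof (induction arbitrary: v)
  case geneig_zero
  then show ?case using L unfolding direct_def by auto
next
  case (geneig_step x)
  note l = lin_R[OF t]
  let ?A = "\<lambda>y. R t y - c *s y"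
  have "\<forall>i\<in>L. i t \<noteq> c \<longrightarrow> ?A (v i) = 0"
  proof (rule geneig_step.IH)
    show "\<forall>i\<in>L. ?A (v i) \<in> wt i"
      using geneig_step.prems(1) R_wt[OF t] by (auto intro!: subspace_diff subspace_wt subspace_scale)
    have "?A x + (\<Sum>i\<in>L. ?A (v i)) = ?A (x + (\<Sum>i\<in>L. v i))"
      by (simp add: lin_add[OF l] lin_sum[OF l] sum_subtractf scale_right_distrib scale_sum_right)
    then show "?A x + (\<Sum>i\<in>L. ?A (v i)) = 0"
      unfolding geneig_step.prems(2) by (simp add: lin_zero[OF l])
  qed
  moreover have "v i \<in> geneig (R t) (i t)" if "i \<in> L" for i
    using that geneig_step.prems(1) t by (auto simp: wt_def)
  ultimately show ?case using geneig_eigenvector[OF l] by (metis eq_iff_diff_eq_0)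
qed

lemma wt_direct:
  assumes "finite L" "L \<subseteq> canon" shows "direct L wt"
  using assms
proof (induction L rule: finite_induct)
  case empty
  then show ?case by (simp add: direct_def)
next
  case (insert l L)
  have d: "direct L wt" using insert by auto
  show ?case unfolding direct_def
  proof (intro allI impI)
    fix v assume v: "(\<forall>i\<in>insert l L. v i \<in> wt i) \<and> sum v (insert l L) = 0"
    have z: "v i = 0" if "i \<in> L" for i
    proof -
      have "i \<noteq> l" using that insert.hyps by auto
      moreover have "i \<in> canon" "l \<in> canon" using that insert.prems by auto
      ultimately obtain t where t: "t \<in> H" "i t \<noteq> l t"
        using canon_eqI by metis
      have "v l \<in> geneig (R t) (l t)" using v t(1) by (auto simp: wt_def)
      then have "\<forall>i\<in>L. i t \<noteq> l t \<longrightarrow> v i = 0"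
        by (rule wt_separate[OF d t(1)]) (use v insert.hyps in auto)
      then show ?thesis using that t by auto
    qed
    then have "v l = 0" using v insert.hyps by simp
    then show "\<forall>i\<in>insert l L. v i = 0" using z by auto
  qed
qed

lemma direct_subspaces: "direct L W \<Longrightarrow> (\<And>i. i \<in> L \<Longrightarrow> V i \<subseteq> W i) \<Longrightarrow> direct L V"
  unfolding direct_def by (meson subsetD)

lemma wt_direct_sub:
  "finite L \<Longrightarrow> L \<subseteq> canon \<Longrightarrow> (\<And>i. i \<in> L \<Longrightarrow> V i \<subseteq> wt i) \<Longrightarrow> direct L V"
  using wt_direct direct_subspaces by blast

text \<open>The trace of the identity is the dimension, so additivity of traces over direct sums
  gives additivity of dimensions. More than \<open>dim W\<close> weights would produce a subspace of
  W that is too large.\<close>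

lemma finite_wts:
  assumes W: "fin W"
  shows "finite {l \<in> canon. W \<inter> wt l \<noteq> {0}}"
proof (rule ccontr)
  assume "infinite {l \<in> canon. W \<inter> wt l \<noteq> {0}}"
  then obtain L where L: "L \<subseteq> {l \<in> canon. W \<inter> wt l \<noteq> {0}}" "finite L" "card L = Suc (dim W)"
    using infinite_arbitrarily_large by blast
  let ?V = "\<lambda>l. W \<inter> wt l"
  have sW: "subspace W" using W fin_subspace by auto
  have f: "fin (?V l)" for l
    using fin_subset[OF W subspace_inter[OF sW subspace_wt]] by auto
  have p: "preserves (\<lambda>v. 1 *s v) (?V l)" for l using preserves_scale[OF fin_subspace[OF f]] .
  have d: "direct L ?V" using L by (intro wt_direct_sub) auto
  let ?S = "span (\<Union>l\<in>L. ?V l)"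
  have S: "fin ?S" "trace ?S (\<lambda>v. 1 *s v) = (\<Sum>l\<in>L. trace (?V l) (\<lambda>v. 1 *s v))"
    using trace_direct[OF L(2) d f p] p preserves_lin by blast+
  have "(of_nat (dim ?S) :: complex) = of_nat (\<Sum>l\<in>L. dim (?V l))"
    using S(2) unfolding trace_scale[OF S(1)] trace_scale[OF f] by simp
  then have "dim ?S = (\<Sum>l\<in>L. dim (?V l))" by (simp only: of_nat_eq_iff)
  moreover have "1 \<le> dim (?V l)" if "l \<in> L" for l
    using L that fin_dim_eq_0[OF f[of l]] by (cases "dim (?V l)") auto
  then have "card L \<le> (\<Sum>l\<in>L. dim (?V l))"
    using sum_mono[of L "\<lambda>_. 1" "\<lambda>l. dim (?V l)"] by simp
  moreover have "?S \<subseteq> W" by (rule span_minimal[OF _ sW]) auto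
  then have "dim ?S \<le> dim W" using fin_dim_less[OF W subspace_span] by (cases "?S = W") (auto simp: less_imp_le)
  ultimately show False using L(3) by simp
qed

end

section \<open>Lie algebras, nilpotent subalgebras and Engel's theorem\<close>

locale lie_alg = complex_vs scale
  for scale :: "complex \<Rightarrow> 'g::ab_group_add \<Rightarrow> 'g" (infixr "*s" 75) +
  fixes br :: "'g \<Rightarrow> 'g \<Rightarrow> 'g"
  assumes lie: "lie_algebra scale br"
begin

lemma br_add_left: "br (x + y) z = br x z + br y z"
  and br_add_right: "br x (y + z) = br x y + br x z"
  and br_scale_left: "br (c *s x) y = c *s br x y"
  and br_scale_right: "br x (c *s y) = c *s br x y"
  and br_self: "br x x = 0"
  and jacobi0: "br x (br y z) + br y (br z x) + br z (br x y) = 0"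
  using lie by (auto simp: lie_algebra_def)

lemma lin_br: "lin (br x)"
  by (rule linI) (simp_all add: br_add_right br_scale_right)

lemma lin_br_left: "lin (\<lambda>x. br x y)"
  by (rule linI) (simp_all add: br_add_left br_scale_left)

lemma br_zero [simp]: "br x 0 = 0" "br 0 x = 0"
  using lin_zero[OF lin_br] lin_zero[OF lin_br_left] by auto

lemma br_anti: "br y x = - br x y"
proof -
  have "br (x + y) (x + y) = (br x x + br y x) + (br x y + br y y)"
    by (simp only: br_add_left br_add_right)
  then have "br y x + br x y = 0" by (simp add: br_self)
  then show ?thesis by (simp only: eq_neg_iff_add_eq_0)
qed

lemma br_minus_right: "br x (- y) = - br x y"
  using lin_diff[OF lin_br, of x 0 y] by simp

lemma br_diff_right: "br x (y - z) = br x y - br x z"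
  using lin_diff[OF lin_br] .

lemma br_diff_left: "br (x - y) z = br x z - br y z"
  using lin_diff[OF lin_br_left] .

lemma jacobi: "br x (br y z) = br (br x y) z + br y (br x z)"
proof -
  have "br z (br x y) = - br (br x y) z" "br y (br z x) = - br y (br x z)"
    using br_anti br_minus_right by metis+
  then show ?thesis using jacobi0[of x y z] by (simp add: algebra_simps)
qed

text \<open>Since ad t is a derivation, (ad t - a - b)[x, y] = [(ad t - a) x, y] +
  [x, (ad t - b) y]. The nested rule induction on x and y stands in for the binomial
  formula.\<close>

lemma geneig_br:
  assumes "x \<in> geneig (br t) a" "y \<in> geneig (br t) b"
  shows "br x y \<in> geneig (br t) (a + b)"
  using assms
proof (induction arbitrary: y)
  case geneig_zero
  then show ?case by (simp add: geneig.geneig_zero)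
next
  case (geneig_step x)
  note IHx = geneig_step.IH
  show ?case using geneig_step.prems
  proof (induction)
    case geneig_zero
    then show ?case by (simp add: geneig.geneig_zero)
  next
    case (geneig_step y)
    have y: "y \<in> geneig (br t) b" using geneig_step.hyps by (rule geneig.geneig_step)
    have "br t (br x y) - (a + b) *s br x y = br (br t x - a *s x) y + br x (br t y - b *s y)"
      by (simp add: jacobi[of t] br_diff_left br_diff_right br_scale_left br_scale_right scale_left_distrib)
    then show ?case
      using geneig_add[OF lin_br IHx[OF y] geneig_step.IH] by (metis geneig.geneig_step)
  qed
qed

end

locale nilpotent_sub = lie_alg scale br
  for scale :: "complex \<Rightarrow> 'g::ab_group_add \<Rightarrow> 'g" (infixr "*s" 75) and br +
  fixes H :: "'g set"
  assumes fin_UNIV: "fin UNIV"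
    and subalgebra: "lie_subalgebra scale br H"
    and nilpotent: "nilpotent_subalgebra scale br H"
begin

lemma fin_all: "subspace W \<Longrightarrow> fin W"
  using fin_subset[OF fin_UNIV] by auto

lemma subspace_H: "subspace H"
  and br_H: "x \<in> H \<Longrightarrow> y \<in> H \<Longrightarrow> br x y \<in> H"
  using subalgebra by (auto simp: lie_subalgebra_def)

abbreviation "lc \<equiv> lower_central scale br H"

lemma subspace_lc: "subspace (lc j)"
  by (cases j) (auto simp: subspace_H)

lemma br_lc: "s \<in> H \<Longrightarrow> t \<in> lc j \<Longrightarrow> br s t \<in> lc (Suc j)"
  by (auto intro: span_base)

lemma lc_Suc: "lc (Suc j) \<subseteq> lc j"
proof (induction j)
  case 0
  have "{br x y |x y. x \<in> H \<and> y \<in> H} \<subseteq> H" using br_H by blast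
  then show ?case using span_minimal[OF _ subspace_H] by simp
next
  case (Suc j)
  have "{br x y |x y. x \<in> H \<and> y \<in> lc (Suc j)} \<subseteq> lc (Suc j)"
    using Suc br_lc by blast
  then show ?case using span_minimal[OF _ subspace_lc[of "Suc j"]] by simp
qed

lemma lc_H: "lc j \<subseteq> H"
  using lc_Suc by (induction j) (auto simp del: lower_central.simps(2))

lemma ad_nilpotent: "s \<in> H \<Longrightarrow> t \<in> H \<Longrightarrow> s \<in> geneig (br t) 0"
proof -
  assume s: "s \<in> H" and t: "t \<in> H"
  have "(br t ^^ j) s \<in> lc j" for j
    by (induction j) (use s br_lc[OF t] in auto)
  moreover obtain k where "lc k = {0}" using nilpotent by (auto simp: nilpotent_subalgebra_def)
  ultimately show ?thesis using geneig_funpow[of k "br t" s] by blast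
qed

sublocale operator_family scale H br
proof
  show "br s v \<in> geneig (br t) \<mu>" if "s \<in> H" "t \<in> H" "v \<in> geneig (br t) \<mu>" for s t v \<mu>
    using geneig_br[OF ad_nilpotent[OF that(1,2)] that(3)] by simp
qed (simp_all add: br_add_right br_scale_right)

text \<open>Engel's theorem for \<open>H\<close> acting on B modulo A, by descent along the lower
  central series: at its end any element outside A qualifies, and each step treats a spanning set of
  the next larger term one element at a time. It is used with A = \<open>H\<close>, to meet the
  normalizer, and with A = {0}, to find eigenvectors.\<close>

lemma engel_relative:
  assumes R: "\<And>t. t \<in> H \<Longrightarrow> lin (R t)" "\<And>s t v. s \<in> H \<Longrightarrow> t \<in> H \<Longrightarrow> R (s + t) v = R s v + R t v"
      "\<And>c t v. t \<in> H \<Longrightarrow> R (c *s t) v = c *s R t v"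
      "\<And>s t v. s \<in> H \<Longrightarrow> t \<in> H \<Longrightarrow> R (br s t) v = R s (R t v) - R t (R s v)"
    and A: "subspace A" "\<And>t v. t \<in> H \<Longrightarrow> v \<in> A \<Longrightarrow> R t v \<in> A"
    and B: "\<And>t v. t \<in> H \<Longrightarrow> v \<in> B \<Longrightarrow> R t v \<in> B"
    and nil: "\<And>t v. t \<in> H \<Longrightarrow> v \<in> B \<Longrightarrow> \<exists>k. (R t ^^ k) v \<in> A"
    and x: "x \<in> B" "x \<notin> A"
  shows "\<exists>v\<in>B. v \<notin> A \<and> (\<forall>t\<in>H. R t v \<in> A)"
proof -
  have R0: "R 0 v = 0" for v
    using R(3)[of 0 0 v] subspace_0[OF subspace_H] by simp
  let ?P = "\<lambda>j. \<exists>v\<in>B. v \<notin> A \<and> (\<forall>t\<in>lc j. R t v \<in> A)"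
  have step: "?P j" if "?P (Suc j)" for j
  proof -
    obtain T where T: "finite T" "span T = lc j" using fin_basis[OF fin_all[OF subspace_lc]] by metis
    have "\<exists>v\<in>B. v \<notin> A \<and> (\<forall>t\<in>lc (Suc j). R t v \<in> A) \<and> (\<forall>t\<in>T'. R t v \<in> A)"
      if "finite T'" "T' \<subseteq> lc j" for T'
      using that
    proof (induction T' rule: finite_induct)
      case empty
      then show ?case using \<open>?P (Suc j)\<close> by (simp del: lower_central.simps)
    next
      case (insert t0 T')
      then obtain v where v: "v \<in> B" "v \<notin> A" "\<forall>t\<in>lc (Suc j). R t v \<in> A" "\<forall>t\<in>T'. R t v \<in> A"
        by (auto simp del: lower_central.simps)
      have t0: "t0 \<in> lc j" "t0 \<in> H" using insert.prems lc_H by (auto simp del: lower_central.simps)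
      \<comment> \<open>This property survives the application of \<open>R t0\<close>: exchanging
        \<open>R t0\<close> with \<open>R t\<close> costs the bracket of t and t0, which lies in
        \<open>lc (Suc j)\<close> and is already controlled.\<close>
      let ?Q = "\<lambda>v. v \<in> B \<and> (\<forall>t\<in>lc (Suc j). R t v \<in> A) \<and> (\<forall>t\<in>T'. R t v \<in> A)"
      have sw: "R t (R t0 v) \<in> A" if "R t v \<in> A" "R (br t t0) v \<in> A" "t \<in> H" for t v
      proof -
        have "R t (R t0 v) = R t0 (R t v) + R (br t t0) v"
          unfolding R(4)[OF that(3) t0(2)] by simp
        then show ?thesis using A(2)[OF t0(2) that(1)] that(2) subspace_add[OF A(1)] by metis
      qed
      have Q: "?Q (R t0 v)" if "?Q v" for v
      proof (intro conjI ballI)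
        show "R t0 v \<in> B" using B t0 that by auto
        fix t assume t: "t \<in> lc (Suc j)"
        have "br t0 t \<in> lc (Suc j)" using br_lc[OF t0(2) t] lc_Suc by blast
        then have "br t t0 \<in> lc (Suc j)"
          unfolding br_anti[of t t0] by (rule subspace_neg[OF subspace_lc])
        then show "R t (R t0 v) \<in> A" using sw that t lc_H by blast
      next
        fix t assume t: "t \<in> T'"
        then have "t \<in> H" using insert.prems lc_H by blast
        then have "br t t0 \<in> lc (Suc j)" using br_lc t0 by blast
        then show "R t (R t0 v) \<in> A" using sw that t \<open>t \<in> H\<close> by blast
      qed
      have Qk: "?Q ((R t0 ^^ k) v)" for k
      proof (induction k)
        case 0 then show ?case using v by simp
      next
        case (Suc k) then show ?case using Q[OF Suc] by simp
      qed
      obtain k0 where "(R t0 ^^ k0) v \<in> A" using nil[OF t0(2) v(1)] by blast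
      \<comment> \<open>The vector just before the first power that falls into A is still outside A,
        and \<open>t0\<close> moves it into A.\<close>
      then obtain k where k: "(R t0 ^^ k) v \<in> A" "\<And>i. i < k \<Longrightarrow> (R t0 ^^ i) v \<notin> A"
        using ex_least_nat_le[of "\<lambda>k. (R t0 ^^ k) v \<in> A" k0] v(2) by auto
      have "k \<noteq> 0" using k(1) v(2) by (cases k) auto
      then obtain i where i: "k = Suc i" by (cases k) auto
      have "?Q ((R t0 ^^ i) v)" "(R t0 ^^ i) v \<notin> A" "R t0 ((R t0 ^^ i) v) \<in> A"
        using Qk k i by auto
      then show ?case by blast
    qed
    from this[OF T(1)] obtain v where v: "v \<in> B" "v \<notin> A" "\<forall>t\<in>T. R t v \<in> A"
      using T(2) span_superset by blast
    have "R t v \<in> A \<and> t \<in> H" if "t \<in> span T" for t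
      using that
    proof (induction rule: span_induct_alt)
      case base
      show ?case using R0 subspace_0 A(1) subspace_H by auto
    next
      case (step c s t)
      have "s \<in> H" using step T(2) lc_H span_base by blast
      then have cs: "c *s s \<in> H" by (rule subspace_scale[OF subspace_H])
      have "R (c *s s + t) v = c *s R s v + R t v"
        using R(2)[OF cs] R(3)[OF \<open>s \<in> H\<close>] step by simp
      then show ?case using v(3) step cs A(1) subspace_H by (auto intro!: subspace_add subspace_scale)
    qed
    then show "?P j" using v T(2) by blast
  qed
  obtain k where k: "lc k = {0}" using nilpotent by (auto simp: nilpotent_subalgebra_def)
  have "?P k" using x R0 subspace_0[OF A(1)] by (auto simp: k)
  then have "?P 0" by (induction k) (use step in blast)+
  then show ?thesis by simp
qed

end

section \<open>The Killing form\<close>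

context complex_vs begin

lemma geneig_commuting:
  assumes "lin g" "\<And>v. g (f v) = f (g v)" "v \<in> geneig f c"
  shows "g v \<in> geneig f c"
  using assms(3)
proof induction
  case geneig_zero
  then show ?case by (simp add: lin_zero[OF assms(1)] geneig.geneig_zero)
next
  case (geneig_step v)
  have "f (g v) - c *s g v = g (f v - c *s v)"
    by (simp add: lin_diff[OF assms(1)] lin_scale[OF assms(1)] assms(2))
  then show ?case using geneig_step.IH by (metis geneig.geneig_step)
qed

text \<open>f^2 - c^2 = (f + c)(f - c), and f + c preserves the generalized eigenspaces of f^2
  because it commutes with f^2.\<close>

lemma geneig_square:
  assumes f: "lin f" and "v \<in> geneig f c"
  shows "v \<in> geneig (\<lambda>v. f (f v)) (c * c)"
  using assms(2)
proof induction
  case geneig_zero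
  then show ?case by (simp add: geneig.geneig_zero)
next
  case (geneig_step v)
  let ?u = "f v - c *s v"
  have "f ?u \<in> geneig (\<lambda>v. f (f v)) (c * c)"
    by (rule geneig_commuting[OF f _ geneig_step.IH]) simp
  then have "f ?u + c *s ?u \<in> geneig (\<lambda>v. f (f v)) (c * c)"
    using geneig_step.IH lin_compose[OF f f] by (intro geneig_add geneig_scale) auto
  moreover have "f ?u + c *s ?u = f (f v) - (c * c) *s v"
    by (simp add: lin_diff[OF f] lin_scale[OF f] scale_right_diff_distrib)
  ultimately show ?case by (metis geneig.geneig_step)
qed

lemma preserves_span:
  assumes f: "lin f" and S: "\<And>v. v \<in> S \<Longrightarrow> f v \<in> span S"
  shows "preserves f (span S)"
  unfolding preserves_def
proof (intro conjI ballI f)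
  fix v assume "v \<in> span S"
  then show "f v \<in> span S"
  proof (induction rule: span_induct_alt)
    case (step c x y)
    then show ?case by (simp add: lin_add[OF f] lin_scale[OF f] span_add span_scale S)
  qed (simp add: lin_zero[OF f] span_zero)
qed

end

locale cartan_simple = nilpotent_sub scale br H
  for scale :: "complex \<Rightarrow> 'g::ab_group_add \<Rightarrow> 'g" (infixr "*s" 75) and br and H +
  assumes simple: "simple_lie_algebra scale br" and cartan: "cartan_subalgebra scale br H"
begin

lemma br_span:
  assumes M: "subspace M" "\<And>x y. x \<in> S \<Longrightarrow> y \<in> T \<Longrightarrow> br x y \<in> M"
    and "x \<in> span S" "y \<in> span T"
  shows "br x y \<in> M"
  using assms(3)
proof (induction rule: span_induct_alt)
  case base
  then show ?case using M(1) subspace_0 by simp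
next
  case (step c s z)
  have "br s y \<in> M" using assms(4)
  proof (induction rule: span_induct_alt)
    case base
    then show ?case using M(1) subspace_0 by simp
  next
    case (step c y z)
    then show ?case using M \<open>s \<in> S\<close>
      by (auto simp: br_add_right br_scale_right intro: subspace_add subspace_scale)
  qed
  then show ?case using step M(1) by (auto simp: br_add_left br_scale_left intro: subspace_add subspace_scale)
qed

lemma br_wt: "x \<in> wt a \<Longrightarrow> y \<in> wt b \<Longrightarrow> br x y \<in> wt (\<lambda>t. a t + b t)"
  by (auto simp: wt_def intro: geneig_br)

lemma br_eq_commutator: "br (br x y) v = br x (br y v) - br y (br x v)"
  using jacobi[of x y v] by simp

text \<open>Self-normalization enters here: if the zero weight space were larger than
  \<open>H\<close>, Engel's theorem modulo \<open>H\<close> would give an element outside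
  \<open>H\<close> that normalizes \<open>H\<close>.\<close>

lemma wt_0: "wt (\<lambda>t. 0) = H"
proof
  show "H \<subseteq> wt (\<lambda>t. 0)" using ad_nilpotent by (auto simp: wt_def)
  show "wt (\<lambda>t. 0) \<subseteq> H"
  proof (rule ccontr)
    assume "\<not> wt (\<lambda>t. 0) \<subseteq> H"
    then obtain x where x: "x \<in> wt (\<lambda>t. 0)" "x \<notin> H" by auto
    have "\<exists>v\<in>wt (\<lambda>t. 0). v \<notin> H \<and> (\<forall>t\<in>H. br t v \<in> H)"
    proof (rule engel_relative[OF _ _ _ _ _ _ _ _ x])
      show "\<exists>k. (br t ^^ k) v \<in> H" if "t \<in> H" "v \<in> wt (\<lambda>t. 0)" for t v
      proof -
        have "v \<in> geneig (br t) 0" using that by (auto simp: wt_def)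
        then obtain k where "(br t ^^ k) v = 0" using geneig_funpow_ex by blast
        then show ?thesis using subspace_0[OF subspace_H] by metis
      qed
    qed (simp_all add: lin_br br_add_left br_scale_left br_eq_commutator subspace_H br_H R_wt)
    then obtain v where v: "v \<notin> H" "\<forall>t\<in>H. br t v \<in> H" by blast
    have "\<forall>t\<in>H. br v t \<in> H"
    proof
      fix t assume "t \<in> H"
      then have "- br t v \<in> H" using v subspace_neg[OF subspace_H] by blast
      then show "br v t \<in> H" using br_anti[of v t] by simp
    qed
    then have "v \<in> normalizer br H" by (simp add: normalizer_def)
    then show False using v cartan by (simp add: cartan_subalgebra_def)
  qed
qed

section \<open>Weights of the adjoint action\<close>

definition wts :: "('g \<Rightarrow> complex) set" where
  "wts = {l \<in> canon. wt l \<noteq> {0}}"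

lemma finite_wts_UNIV: "finite wts"
  using finite_wts[OF fin_UNIV] by (simp add: wts_def)

lemma wts_canon: "wts \<subseteq> canon"
  by (auto simp: wts_def)

lemma wt_not_wts: "l \<in> canon \<Longrightarrow> l \<notin> wts \<Longrightarrow> wt l = {0}"
  by (auto simp: wts_def)

lemma fin_wt: "fin (wt l)"
  by (rule fin_all[OF subspace_wt])

lemma span_wts: "span (\<Union>l\<in>wts. wt l) = UNIV"
proof -
  have "UNIV \<subseteq> span (\<Union>l\<in>canon. UNIV \<inter> wt l)"
    by (rule wt_span[OF fin_UNIV]) auto
  also have "\<dots> \<subseteq> span (\<Union>l\<in>wts. wt l)"
  proof (rule span_minimal[OF _ subspace_span], rule subsetI)
    fix x assume "x \<in> (\<Union>l\<in>canon. UNIV \<inter> wt l)"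
    then obtain l where "l \<in> canon" "x \<in> wt l" by auto
    then show "x \<in> span (\<Union>l\<in>wts. wt l)"
      by (cases "l \<in> wts") (auto intro: span_base span_zero simp: wt_not_wts)
  qed
  finally show ?thesis by auto
qed

lemma wts_decompose:
  obtains v where "\<And>l. l \<in> wts \<Longrightarrow> v l \<in> wt l" "x = (\<Sum>l\<in>wts. v l)"
  using span_UN_family[of wts wt x] finite_wts_UNIV subspace_wt span_wts by auto

lemma trace_wts:
  assumes "lin f" "\<And>l. l \<in> wts \<Longrightarrow> preserves f (wt l)"
  shows "trace UNIV f = (\<Sum>l\<in>wts. trace (wt l) f)"
  using trace_direct[OF finite_wts_UNIV wt_direct[OF finite_wts_UNIV wts_canon] fin_wt assms(2,1)]
  unfolding span_wts by simp

lemma trace_wt: "s \<in> H \<Longrightarrow> trace (wt l) (br s) = l s * of_nat (dim (wt l))"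
  by (rule trace_geneig[OF fin_wt preserves_wt]) (auto simp: wt_def)

lemma dim_wts: "l \<in> wts \<Longrightarrow> dim (wt l) > 0"
  using fin_dim_eq_0[OF fin_wt[of l]] by (auto simp: wts_def)

text \<open>A weight is a priori just a function recording eigenvalues. On its weight space the
  trace of ad s is l s times the dimension, and the trace is additive in s; homogeneity and
  vanishing on brackets follow in the same way.\<close>

lemma wts_add: "l \<in> wts \<Longrightarrow> s \<in> H \<Longrightarrow> t \<in> H \<Longrightarrow> l (s + t) = l s + l t"
proof -
  assume l: "l \<in> wts" and s: "s \<in> H" and t: "t \<in> H"
  have "trace (wt l) (br (s + t)) = trace (wt l) (br s) + trace (wt l) (br t)"
    using trace_plus[OF fin_wt preserves_wt[OF s] preserves_wt[OF t], of l]
    by (simp flip: br_add_left)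
  then have "l (s + t) * of_nat (dim (wt l)) = (l s + l t) * of_nat (dim (wt l))"
    using trace_wt s t subspace_add[OF subspace_H s t] by (simp add: algebra_simps)
  then show ?thesis using dim_wts[OF l] by simp
qed

lemma wts_scale: "l \<in> wts \<Longrightarrow> s \<in> H \<Longrightarrow> l (c *s s) = c * l s"
proof -
  assume l: "l \<in> wts" and s: "s \<in> H"
  have "trace (wt l) (br (c *s s)) = c * trace (wt l) (br s)"
    using trace_cmult[OF fin_wt preserves_wt[OF s], of l c]
    by (simp flip: br_scale_left)
  then have "l (c *s s) * of_nat (dim (wt l)) = (c * l s) * of_nat (dim (wt l))"
    using trace_wt s subspace_scale[OF subspace_H s] by (simp add: algebra_simps)
  then show ?thesis using dim_wts[OF l] by simp
qed

lemma trace_commutator: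
  assumes "fin W" "preserves (br x) W" "preserves (br y) W"
  shows "trace W (br (br x y)) = 0"
proof -
  have "br (br x y) = (\<lambda>v. br x (br y v) - br y (br x v))"
    by (rule ext) (rule br_eq_commutator)
  then show ?thesis
    using trace_minus[OF assms(1) preserves_compose[OF assms(2,3)] preserves_compose[OF assms(3,2)]]
      trace_commute[OF assms] by simp
qed

lemma wts_br: "l \<in> wts \<Longrightarrow> s \<in> H \<Longrightarrow> t \<in> H \<Longrightarrow> l (br s t) = 0"
  using trace_commutator[OF fin_wt preserves_wt preserves_wt, of s t l] trace_wt[OF br_H, of s t l] dim_wts[of l]
  by simp

lemma br_UNIV: "span {br x y |x y. True} = UNIV"
proof -
  have i: "lie_ideal scale br (span {br x y |x y. True})"
    unfolding lie_ideal_def by (auto intro: span_base)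
  obtain x y where "br x y \<noteq> 0" using simple by (auto simp: simple_lie_algebra_def)
  moreover have "br x y \<in> span {br x y |x y. True}" for x y by (rule span_base) blast
  ultimately have "span {br x y |x y. True} \<noteq> {0}" by (metis singletonD)
  then show ?thesis using i simple by (auto simp: simple_lie_algebra_def)
qed

lemma uminus_canon: "a \<in> canon \<Longrightarrow> (\<lambda>t. - a t) \<in> canon"
  and plus_canon: "a \<in> canon \<Longrightarrow> b \<in> canon \<Longrightarrow> (\<lambda>t. a t + b t) \<in> canon"
  by (auto simp: canon_def)

text \<open>Simplicity gives g = [g, g], so g is spanned by brackets of weight vectors. Those of
  total weight zero are covered by Z, the others lie in nonzero weight spaces, and directness of the
  weight decomposition leaves only Z for the elements of \<open>H\<close>.\<close>

lemma H_generated: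
  assumes M: "subspace M" "\<And>a x y. a \<in> wts \<Longrightarrow> x \<in> wt a \<Longrightarrow> y \<in> wt (\<lambda>t. - a t) \<Longrightarrow> br x y \<in> M"
  shows "H \<subseteq> M"
proof
  fix h assume h: "h \<in> H"
  define Z where "Z = {br x y | a x y. a \<in> wts \<and> x \<in> wt a \<and> y \<in> wt (\<lambda>t. - a t)}"
  let ?z = "\<lambda>t::'g. 0::complex"
  define N where "N = span (\<Union>l\<in>wts - {?z}. wt l)"
  have ZH: "span Z \<subseteq> H"
  proof (rule span_minimal[OF _ subspace_H])
    show "Z \<subseteq> H"
    proof
      fix z assume "z \<in> Z"
      then obtain a x y where z: "z = br x y" "x \<in> wt a" "y \<in> wt (\<lambda>t. - a t)"
        by (auto simp: Z_def)
      show "z \<in> H" using br_wt[OF z(2,3)] z(1) wt_0 by simp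
    qed
  qed
  have "br x y \<in> span (Z \<union> N)" for x y
  proof (rule br_span[OF subspace_span, of "\<Union>l\<in>wts. wt l" "\<Union>l\<in>wts. wt l"])
    fix x y assume "x \<in> (\<Union>l\<in>wts. wt l)" "y \<in> (\<Union>l\<in>wts. wt l)"
    then obtain a b where ab: "a \<in> wts" "x \<in> wt a" "b \<in> wts" "y \<in> wt b" by auto
    let ?c = "\<lambda>t. a t + b t"
    have c: "?c \<in> canon" using ab plus_canon wts_canon by blast
    have xy: "br x y \<in> wt ?c" using ab br_wt by blast
    show "br x y \<in> span (Z \<union> N)"
    proof (cases "\<forall>t\<in>H. a t + b t = 0")
      case True
      then have "wt b = wt (\<lambda>t. - a t)" by (intro wt_cong) (simp add: add_eq_0_iff)
      then have "br x y \<in> Z" using ab unfolding Z_def by blast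
      then show ?thesis by (auto intro: span_base)
    next
      case False
      then have nz: "?c \<noteq> ?z" by metis
      show ?thesis
      proof (cases "?c \<in> wts")
        case True
        then have "br x y \<in> N" using xy nz unfolding N_def by (intro span_base) blast
        then show ?thesis by (auto intro: span_base)
      next
        case False
        then show ?thesis using xy wt_not_wts[OF c] span_zero by auto
      qed
    qed
  qed (simp_all add: span_wts)
  then have "span {br x y |x y. True} \<subseteq> span (Z \<union> N)"
    by (intro span_minimal) auto
  then have "h \<in> span (Z \<union> N)" using br_UNIV by auto
  then obtain z n where zn: "h = z + n" "z \<in> span Z" "n \<in> N"
    by (auto simp: span_Un N_def span_span)
  have "n = h - z" using zn by simp
  then have "n \<in> wt ?z" using h zn(2) ZH subspace_diff[OF subspace_H] wt_0 by auto
  moreover have "direct (insert ?z wts) wt"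
    by (rule wt_direct) (use finite_wts_UNIV wts_canon in \<open>auto simp: canon_def\<close>)
  then have "wt ?z \<inter> span (\<Union>l\<in>wts - {?z}. wt l) = {0}"
    using direct_insertD(2)[of "wts - {?z}" ?z wt] finite_wts_UNIV subspace_wt
    by (simp add: insert_absorb2)
  ultimately have "n = 0" using zn(3) unfolding N_def by blast
  then have "h \<in> span Z" using zn by simp
  moreover have "span Z \<subseteq> M" by (rule span_minimal[OF _ M(1)]) (use M(2) in \<open>auto simp: Z_def\<close>)
  ultimately show "h \<in> M" by blast
qed

lemma wt_shift_finite:
  assumes l: "l \<in> canon" and a: "a \<in> canon" "t \<in> H" "a t \<noteq> 0"
  shows "finite {k::int. wt (\<lambda>t. l t + of_int k * a t) \<noteq> {0}}"
proof -
  let ?g = "\<lambda>k::int. \<lambda>t. l t + of_int k * a t"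
  have "inj ?g"
  proof (rule injI)
    fix j k assume "?g j = ?g k"
    then have "?g j t = ?g k t" by metis
    then show "j = k" using a by simp
  qed
  moreover have "?g ` {k. wt (?g k) \<noteq> {0}} \<subseteq> wts"
    using l a(1) by (auto simp: wts_def canon_def)
  ultimately show ?thesis
    using finite_wts_UNIV finite_imageD[of ?g] by (meson finite_subset inj_on_subset subset_UNIV)
qed

text \<open>On the sum of the weight spaces of l + k a, k an integer, [x, y] acts as a commutator
  and has trace zero. That trace is the sum of (l + k a)([x, y]) times dimensions, which can be
  solved for l([x, y]). The quotient is stated as a real number because later its square must be
  nonnegative.\<close>

lemma wt_string:
  assumes l: "l \<in> wts" and a: "a \<in> canon" "t \<in> H" "a t \<noteq> 0"
    and x: "x \<in> wt a" and y: "y \<in> wt (\<lambda>t. - a t)"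
  shows "\<exists>q::real. l (br x y) = of_real q * a (br x y)"
proof -
  let ?g = "\<lambda>k::int. \<lambda>t. l t + of_int k * a t"
  define S where "S = {k. wt (?g k) \<noteq> {0}}"
  have fS: "finite S" unfolding S_def using wt_shift_finite a l wts_canon by blast
  have inj: "inj ?g"
  proof (rule injI)
    fix j k assume "?g j = ?g k"
    then have "?g j t = ?g k t" by metis
    then show "j = k" using a by simp
  qed
  define L where "L = ?g ` S"
  have L: "finite L" "L \<subseteq> canon"
    using fS l a(1) by (auto simp: L_def wts_def canon_def)
  let ?W = "span (\<Union>i\<in>L. wt i)"
  have inW: "v \<in> ?W" if "v \<in> wt (?g k)" for v k
  proof (cases "k \<in> S")
    case True then show ?thesis using that by (intro span_base) (auto simp: L_def)
  next
    case False then show ?thesis using that span_zero by (auto simp: S_def)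
  qed
  have h: "br x y \<in> H" using br_wt[OF x y] wt_0 by simp
  have px: "preserves (br x) ?W"
  proof (rule preserves_span[OF lin_br])
    fix v assume "v \<in> (\<Union>i\<in>L. wt i)"
    then obtain k where "v \<in> wt (?g k)" by (auto simp: L_def)
    then have "br x v \<in> wt (\<lambda>t. a t + ?g k t)" using br_wt[OF x] by blast
    moreover have "(\<lambda>t. a t + ?g k t) = ?g (k + 1)" by (auto simp: algebra_simps)
    ultimately show "br x v \<in> ?W" using inW by metis
  qed
  have py: "preserves (br y) ?W"
  proof (rule preserves_span[OF lin_br])
    fix v assume "v \<in> (\<Union>i\<in>L. wt i)"
    then obtain k where "v \<in> wt (?g k)" by (auto simp: L_def)
    then have "br y v \<in> wt (\<lambda>t. - a t + ?g k t)" using br_wt[OF y] by blast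
    moreover have "(\<lambda>t. - a t + ?g k t) = ?g (k - 1)" by (auto simp: algebra_simps)
    ultimately show "br y v \<in> ?W" using inW by metis
  qed
  let ?d = "\<lambda>k. real (dim (wt (?g k)))"
  have "0 = trace ?W (br (br x y))" using trace_commutator[OF fin_all[OF subspace_span] px py] by simp
  also have "\<dots> = (\<Sum>i\<in>L. trace (wt i) (br (br x y)))"
    using trace_direct[OF L(1) wt_direct[OF L] fin_wt preserves_wt[OF h] lin_br] by simp
  also have "\<dots> = (\<Sum>k\<in>S. trace (wt (?g k)) (br (br x y)))"
    unfolding L_def by (rule sum.reindex_cong[OF inj_on_subset[OF inj]]) auto
  also have "\<dots> = (\<Sum>k\<in>S. l (br x y) * of_real (?d k) + a (br x y) * of_real (of_int k * ?d k))"
    by (intro sum.cong refl) (simp add: trace_wt[OF h] algebra_simps)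
  also have "\<dots> = l (br x y) * of_real (\<Sum>k\<in>S. ?d k) + a (br x y) * of_real (\<Sum>k\<in>S. of_int k * ?d k)"
    by (simp add: sum.distrib sum_distrib_left)
  finally have e: "l (br x y) * of_real (\<Sum>k\<in>S. ?d k) + a (br x y) * of_real (\<Sum>k\<in>S. of_int k * ?d k) = 0"
    by simp
  \<comment> \<open>The string contains l itself, so the total dimension by which the relation is
    divided is positive.\<close>
  have "0 \<in> S" using l by (auto simp: S_def wts_def)
  moreover have "?d 0 > 0" using dim_wts[OF l] by simp
  ultimately have pos: "(\<Sum>k\<in>S. ?d k) > 0" using fS by (intro sum_pos2[of _ 0]) auto
  have "l (br x y) = of_real (- (\<Sum>k\<in>S. of_int k * ?d k) / (\<Sum>k\<in>S. ?d k)) * a (br x y)"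
    using e pos by (simp add: field_simps add_eq_0_iff del: of_real_sum)
  then show ?thesis by blast
qed

section \<open>Killing form and Cartan's criterion\<close>

definition K :: "'g \<Rightarrow> 'g \<Rightarrow> complex" where
  "K x y = trace UNIV (\<lambda>v. br x (br y v))"

lemma preserves_br2: "preserves (\<lambda>v. br x (br y v)) UNIV"
  by (rule preserves_UNIV[OF lin_compose[OF lin_br lin_br]])

lemma K_commute: "K x y = K y x"
  unfolding K_def by (rule trace_commute[OF fin_UNIV preserves_UNIV[OF lin_br] preserves_UNIV[OF lin_br]])

lemma K_add_left: "K (x + y) z = K x z + K y z"
  unfolding K_def br_add_left by (rule trace_plus[OF fin_UNIV preserves_br2 preserves_br2])

lemma K_scale_left: "K (c *s x) z = c * K x z"
  unfolding K_def br_scale_left by (rule trace_cmult[OF fin_UNIV preserves_br2])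

lemma K_add_right: "K z (x + y) = K z x + K z y"
  using K_add_left K_commute by metis

lemma K_scale_right: "K z (c *s x) = c * K z x"
  using K_scale_left K_commute by metis

lemma K_zero: "K 0 z = 0" "K z 0 = 0"
  using K_scale_left[of 0 0 z] K_scale_right[of z 0 0] by auto

lemma K_sum_right: "K z (sum f A) = (\<Sum>a\<in>A. K z (f a))"
  by (induction A rule: infinite_finite_induct) (auto simp: K_zero K_add_right)

lemma K_invariant: "K (br x y) z = K x (br y z)"
proof -
  have b: "preserves (br x) UNIV" for x by (rule preserves_UNIV[OF lin_br])
  note c = preserves_compose[OF b preserves_br2]
  have "K (br x y) z = trace UNIV (\<lambda>v. br x (br y (br z v)) - br y (br x (br z v)))"
    unfolding K_def br_eq_commutator ..
  also have "\<dots> = trace UNIV (\<lambda>v. br x (br y (br z v))) - trace UNIV (\<lambda>v. br y (br x (br z v)))"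
    by (rule trace_minus[OF fin_UNIV c c])
  also have "trace UNIV (\<lambda>v. br y (br x (br z v))) = trace UNIV (\<lambda>v. br x (br z (br y v)))"
    by (rule trace_commute[OF fin_UNIV b preserves_br2])
  also have "trace UNIV (\<lambda>v. br x (br y (br z v))) - trace UNIV (\<lambda>v. br x (br z (br y v)))
      = trace UNIV (\<lambda>v. br x (br y (br z v)) - br x (br z (br y v)))"
    by (rule trace_minus[OF fin_UNIV c c, symmetric])
  also have "\<dots> = K x (br y z)"
    unfolding K_def br_eq_commutator br_diff_right ..
  finally show ?thesis .
qed

text \<open>The operator ad x ad y shifts every weight by the nonzero functional a + b. Only
  finitely many weights occur, so it is nilpotent.\<close>

lemma K_wt:
  assumes x: "x \<in> wt a" and y: "y \<in> wt b" and ab: "a \<in> canon" "b \<in> canon" "t \<in> H" "a t + b t \<noteq> 0"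
  shows "K x y = 0"
  unfolding K_def
proof (rule trace_nilpotent[OF fin_UNIV preserves_br2])
  let ?f = "\<lambda>v. br x (br y v)"
  have l: "lin ?f" by (rule lin_compose[OF lin_br lin_br])
  have "v \<in> geneig ?f 0" if c: "c \<in> wts" "v \<in> wt c" for c v
  proof -
    let ?g = "\<lambda>k::int. \<lambda>t. c t + of_int k * (a t + b t)"
    have k: "(?f ^^ k) v \<in> wt (?g (int k))" for k
    proof (induction k)
      case 0 then show ?case using c by simp
    next
      case (Suc k)
      have "?f ((?f ^^ k) v) \<in> wt (\<lambda>t. a t + (b t + ?g (int k) t))"
        using br_wt[OF x br_wt[OF y Suc]] .
      moreover have "(\<lambda>t. a t + (b t + ?g (int k) t)) = ?g (int (Suc k))"
        by (auto simp: algebra_simps)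
      ultimately show ?case by simp
    qed
    have "finite {k::int. wt (?g k) \<noteq> {0}}"
      by (rule wt_shift_finite[of c "\<lambda>t. a t + b t" t]) (use c wts_canon ab plus_canon in auto)
    then have "finite (int -` {k::int. wt (?g k) \<noteq> {0}})"
      by (rule finite_vimageI) (simp add: inj_on_def)
    then obtain k :: nat where "k \<notin> int -` {k::int. wt (?g k) \<noteq> {0}}"
      using ex_new_if_finite infinite_UNIV_nat by blast
    then have "(?f ^^ k) v = 0" using k[of k] by auto
    then show ?thesis by (rule geneig_funpow)
  qed
  then have "span (\<Union>l\<in>wts. wt l) \<subseteq> geneig ?f 0"
    by (intro span_minimal subspace_geneig l) auto
  then show "UNIV \<subseteq> geneig ?f 0" using span_wts by simp
qed

lemma K_H: "h \<in> H \<Longrightarrow> K h h = (\<Sum>l\<in>wts. of_nat (dim (wt l)) * (l h)\<^sup>2)"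
proof -
  assume h: "h \<in> H"
  have p: "preserves (\<lambda>v. br h (br h v)) (wt l)" for l
    by (rule preserves_compose[OF preserves_wt[OF h] preserves_wt[OF h]])
  have "K h h = (\<Sum>l\<in>wts. trace (wt l) (\<lambda>v. br h (br h v)))"
    unfolding K_def by (rule trace_wts[OF lin_compose[OF lin_br lin_br] p])
  also have "\<dots> = (\<Sum>l\<in>wts. (l h * l h) * of_nat (dim (wt l)))"
  proof (rule sum.cong)
    fix l
    show "trace (wt l) (\<lambda>v. br h (br h v)) = (l h * l h) * of_nat (dim (wt l))"
      by (rule trace_geneig[OF fin_wt p]) (use h geneig_square[OF lin_br] in \<open>auto simp: wt_def\<close>)
  qed simp
  finally show ?thesis by (simp add: power2_eq_square algebra_simps)
qed

text \<open>Cartan's criterion: if the Killing form vanished, then every root would vanish on all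
  brackets of opposite root spaces (it is a real multiple of \<open>a\<close> there, and a vanishing sum of real
  squares forces the multiples to be zero), hence on \<open>H\<close>.\<close>

lemma K_nonzero: "\<exists>x y. K x y \<noteq> 0"
proof (rule ccontr)
  assume "\<not> ?thesis"
  then have K0: "K x y = 0" for x y by blast
  have "H \<subseteq> {h \<in> H. \<forall>l\<in>wts. l h = 0}"
  proof (rule H_generated)
    have w0: "l \<in> wts \<Longrightarrow> l 0 = 0" for l using wts_scale[of l 0 0] subspace_0[OF subspace_H] by simp
    show "subspace {h \<in> H. \<forall>l\<in>wts. l h = 0}"
      using subspace_H by (auto simp: subspace_def wts_add wts_scale w0)
    fix a x y assume a: "a \<in> wts" and x: "x \<in> wt a" and y: "y \<in> wt (\<lambda>t. - a t)"
    let ?h = "br x y"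
    have h: "?h \<in> H" using br_wt[OF x y] wt_0 by simp
    have "l ?h = 0" if l: "l \<in> wts" for l
    proof (cases "\<exists>t\<in>H. a t \<noteq> 0")
      case False
      then have "wt a = H" "wt (\<lambda>t. - a t) = H" using wt_cong[of a "\<lambda>t. 0"] wt_cong[of "\<lambda>t. - a t" "\<lambda>t. 0"] wt_0 by auto
      then show ?thesis using x y wts_br[OF l] by simp
    next
      case True
      then obtain t where t: "t \<in> H" "a t \<noteq> 0" by blast
      have "\<forall>l\<in>wts. \<exists>q::real. l ?h = of_real q * a ?h"
        using wt_string[OF _ _ t x y] a wts_canon by blast
      then obtain q :: "('g \<Rightarrow> complex) \<Rightarrow> real" where q: "\<And>l. l \<in> wts \<Longrightarrow> l ?h = of_real (q l) * a ?h" by metis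
      have "0 = (\<Sum>l\<in>wts. of_nat (dim (wt l)) * (l ?h)\<^sup>2)" using K_H[OF h] K0 by simp
      also have "\<dots> = (\<Sum>l\<in>wts. of_real (real (dim (wt l)) * (q l)\<^sup>2) * (a ?h)\<^sup>2)"
        by (intro sum.cong refl) (simp add: q power_mult_distrib)
      also have "\<dots> = of_real (\<Sum>l\<in>wts. real (dim (wt l)) * (q l)\<^sup>2) * (a ?h)\<^sup>2"
        by (simp add: sum_distrib_right)
      finally have "complex_of_real (\<Sum>l\<in>wts. real (dim (wt l)) * (q l)\<^sup>2) * (a ?h)\<^sup>2 = 0" by (rule sym)
      then have "a ?h = 0 \<or> (\<Sum>l\<in>wts. real (dim (wt l)) * (q l)\<^sup>2) = 0"
        unfolding mult_eq_0_iff of_real_eq_0_iff power_eq_0_iff by blast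
      moreover have "q a = 0" if "(\<Sum>l\<in>wts. real (dim (wt l)) * (q l)\<^sup>2) = 0"
        using that a dim_wts[OF a] finite_wts_UNIV by (subst (asm) sum_nonneg_eq_0_iff) auto
      ultimately have "a ?h = 0" using q[OF a] by auto
      then show ?thesis using q[OF l] by simp
    qed
    then show "?h \<in> {h \<in> H. \<forall>l\<in>wts. l h = 0}" using h by blast
  qed
  then have z: "\<And>l h. l \<in> wts \<Longrightarrow> h \<in> H \<Longrightarrow> l h = 0" by auto
  \<comment> \<open>All weight spaces now coincide with \<open>H\<close>, so g equals the nilpotent
    \<open>H\<close>, although [g, g] = g is not zero.\<close>
  have "wt l = H" if "l \<in> wts" for l
    using wt_cong[of l "\<lambda>t. 0", OF z[OF that]] wt_0 by simp
  then have "(\<Union>l\<in>wts. wt l) \<subseteq> H" by blast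
  then have "span H = UNIV" using span_wts span_mono[of "\<Union>l\<in>wts. wt l" H] by blast
  then have HU: "H = UNIV" using subspace_H by (metis span_eq_iff)
  have "lc k = UNIV" for k
  proof (induction k)
    case (Suc k)
    then show ?case using br_UNIV HU by simp
  qed (simp add: HU)
  moreover obtain k where "lc k = {0}" using nilpotent by (auto simp: nilpotent_subalgebra_def)
  ultimately have U: "(UNIV :: 'g set) = {0}" by metis
  obtain x y where "br x y \<noteq> 0" using simple by (auto simp: simple_lie_algebra_def)
  moreover have "br x y \<in> {0}" unfolding U[symmetric] by simp
  ultimately show False by simp
qed

lemma K_nondegenerate:
  assumes "\<And>y. K x y = 0" shows "x = 0"
proof -
  let ?N = "{x. \<forall>y. K x y = 0}"
  have "lie_ideal scale br ?N"
    unfolding lie_ideal_def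
  proof (intro conjI allI impI)
    show "subspace ?N" by (auto simp: subspace_def K_zero K_add_left K_scale_left)
    fix u v assume v: "v \<in> ?N"
    have "K (br u v) y = - K v (br u y)" for y
    proof -
      have "K (br u v) y = K ((-1) *s br v u) y" using br_anti[of u v] by simp
      then show ?thesis using K_scale_left[of "-1" "br v u" y] K_invariant[of v u y] by simp
    qed
    then show "br u v \<in> ?N" using v by simp
  qed
  then have "?N = {0} \<or> ?N = UNIV" using simple by (auto simp: simple_lie_algebra_def)
  moreover have "?N \<noteq> UNIV" using K_nonzero by auto
  ultimately show ?thesis using assms by blast
qed

text \<open>Such an h is orthogonal to the nonzero weight spaces by weight, and to \<open>H\<close>
  by polarization: K(s, s) depends only on the values of the weights at s, and adding h to s changes
  none of them.\<close>

lemma H_faithful: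
  assumes h: "h \<in> H" "\<And>l. l \<in> wts \<Longrightarrow> l h = 0"
  shows "h = 0"
proof (rule K_nondegenerate)
  fix y
  obtain v where v: "\<And>l. l \<in> wts \<Longrightarrow> v l \<in> wt l" "y = (\<Sum>l\<in>wts. v l)" using wts_decompose by metis
  have "K h (v l) = 0" if l: "l \<in> wts" for l
  proof (cases "\<exists>t\<in>H. l t \<noteq> 0")
    case True
    then obtain t where "t \<in> H" "0 + l t \<noteq> 0" by auto
    then show ?thesis
      using K_wt[of h "\<lambda>t. 0" "v l" l t] v(1)[OF l] h wt_0 l wts_canon by (auto simp: canon_def)
  next
    case False
    then have "wt l = H" using wt_cong[of l "\<lambda>t. 0"] wt_0 by auto
    then have t: "v l \<in> H" using v(1)[OF l] by simp
    have "K (h + v l) (h + v l) = K (v l) (v l)"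
      unfolding K_H[OF t] K_H[OF subspace_add[OF subspace_H h(1) t]]
      by (intro sum.cong refl) (simp add: wts_add[OF _ h(1) t] h(2))
    moreover have "K h h = 0" using K_H[OF h(1)] h by simp
    ultimately show ?thesis using K_commute[of h "v l"] by (simp add: K_add_left K_add_right)
  qed
  then show "K h y = 0" unfolding v(2) K_sum_right by simp
qed

lemma H_abelian: "s \<in> H \<Longrightarrow> t \<in> H \<Longrightarrow> br s t = 0"
  by (rule H_faithful) (auto simp: br_H wts_br)

end

section \<open>Roots and coroots\<close>

context cartan_simple begin

definition Phi :: "('g \<Rightarrow> complex) set" where
  "Phi = {a \<in> wts. \<exists>t\<in>H. a t \<noteq> 0}"

lemma Phi_wts: "a \<in> Phi \<Longrightarrow> a \<in> wts"
  and Phi_canon: "a \<in> Phi \<Longrightarrow> a \<in> canon"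
  using wts_canon by (auto simp: Phi_def)

lemma wt_not_Phi: "l \<in> wts \<Longrightarrow> l \<notin> Phi \<Longrightarrow> t \<in> H \<Longrightarrow> l t = 0"
  by (auto simp: Phi_def)

lemma K_separates:
  assumes "x \<noteq> 0" shows "\<exists>l\<in>wts. \<exists>y\<in>wt l. K x y \<noteq> 0"
proof (rule ccontr)
  assume n: "\<not> ?thesis"
  have "K x y = 0" for y
  proof -
    obtain v where v: "\<And>l. l \<in> wts \<Longrightarrow> v l \<in> wt l" "y = (\<Sum>l\<in>wts. v l)" using wts_decompose by metis
    show ?thesis unfolding v(2) K_sum_right using n v(1) by (intro sum.neutral) blast
  qed
  then show False using K_nondegenerate assms by blast
qed

text \<open>\<open>wt a\<close> contains generalized eigenvectors only. Because a is linear and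
  kills brackets of \<open>H\<close>, subtracting the scalar a t from ad t leaves a representation
  of \<open>H\<close>, now by nilpotent operators, and Engel's theorem supplies a common null
  vector.\<close>

lemma root_eigenvector:
  assumes a: "a \<in> Phi"
  shows "\<exists>x\<in>wt a. x \<noteq> 0 \<and> (\<forall>t\<in>H. br t x = a t *s x)"
proof -
  have w: "a \<in> wts" using a Phi_wts by auto
  obtain x where x: "x \<in> wt a" "x \<noteq> 0"
    using w subspace_0[OF subspace_wt] by (auto simp: wts_def)
  let ?R = "\<lambda>t v. br t v - a t *s v"
  have "\<exists>v\<in>wt a. v \<notin> {0} \<and> (\<forall>t\<in>H. ?R t v \<in> {0})"
  proof (rule engel_relative[where R = ?R])
    show "lin (?R t)" for t by (rule lin_shift[OF lin_br])
    show "?R (s + t) v = ?R s v + ?R t v" if "s \<in> H" "t \<in> H" for s t v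
      by (simp add: br_add_left wts_add[OF w that] scale_left_distrib)
    show "?R (c *s t) v = c *s ?R t v" if "t \<in> H" for c t v
      by (simp add: br_scale_left wts_scale[OF w that] scale_right_diff_distrib)
    show "?R (br s t) v = ?R s (?R t v) - ?R t (?R s v)" if "s \<in> H" "t \<in> H" for s t v
      by (simp add: br_eq_commutator wts_br[OF w that] br_diff_right br_scale_right
          scale_right_diff_distrib mult.commute)
    show "?R t v \<in> wt a" if "t \<in> H" "v \<in> wt a" for t v
      using that by (intro subspace_diff[OF subspace_wt] subspace_scale[OF subspace_wt] R_wt)
    show "\<exists>k. (?R t ^^ k) v \<in> {0}" if "t \<in> H" "v \<in> wt a" for t v
    proof -
      have "v \<in> geneig (br t) (a t)" using that by (auto simp: wt_def)
      then show ?thesis using geneig_funpow_ex[OF geneig_translate] by simp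
    qed
    show "?R t v \<in> {0}" if "v \<in> {0}" for t v using that by simp
  qed (use x subspace_single_0 in auto)
  then show ?thesis by auto
qed

text \<open>Nondegeneracy of K provides a partner y for x, necessarily of weight -a. Invariance
  gives K([x, y], t) = a t K(x, y), so [x, y] is not zero. If a vanished at [x, y], all weights
  would vanish there by the string relation, contradicting faithfulness; hence y can be rescaled to
  reach the value 2.\<close>

lemma root_pair:
  assumes a: "a \<in> Phi"
  shows "\<exists>x y. x \<in> wt a \<and> x \<noteq> 0 \<and> (\<forall>t\<in>H. br t x = a t *s x) \<and> y \<in> wt (\<lambda>t. - a t) \<and>
    K x y \<noteq> 0 \<and> br x y \<in> H \<and> a (br x y) = 2"
proof -
  have w: "a \<in> wts" using a Phi_wts by auto
  obtain x where x: "x \<in> wt a" "x \<noteq> 0" "\<forall>t\<in>H. br t x = a t *s x"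
    using root_eigenvector[OF a] by blast
  obtain l y where y: "l \<in> wts" "y \<in> wt l" "K x y \<noteq> 0" using K_separates[OF x(2)] by blast
  have "l t = - a t" if "t \<in> H" for t
  proof (rule ccontr)
    assume "l t \<noteq> - a t"
    then have "a t + l t \<noteq> 0" by (metis add_eq_0_iff)
    then have "K x y = 0" using K_wt[OF x(1) y(2) _ _ that] w y(1) wts_canon by blast
    then show False using y by simp
  qed
  then have "wt l = wt (\<lambda>t. - a t)" by (rule wt_cong)
  then have y': "y \<in> wt (\<lambda>t. - a t)" using y by simp
  let ?h = "br x y"
  have h: "?h \<in> H" using br_wt[OF x(1) y'] wt_0 by simp
  have Kh: "K ?h t = a t * K x y" if "t \<in> H" for t
  proof -
    have "K (br t x) y = K t ?h" by (rule K_invariant)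
    then show ?thesis using x(3) that K_commute[of t ?h] by (simp add: K_scale_left)
  qed
  obtain t where t: "t \<in> H" "a t \<noteq> 0" using a by (auto simp: Phi_def)
  have ah: "a ?h \<noteq> 0"
  proof
    assume 0: "a ?h = 0"
    have "l ?h = 0" if "l \<in> wts" for l
      using wt_string[OF that _ t x(1) y'] w wts_canon 0 by auto
    then have "?h = 0" by (rule H_faithful[OF h])
    then have "a t * K x y = 0" using Kh[OF t(1)] K_zero by simp
    then show False using t y by simp
  qed
  let ?c = "2 / a ?h"
  have "br x (?c *s y) \<in> H" "a (br x (?c *s y)) = 2" "K x (?c *s y) \<noteq> 0"
    "?c *s y \<in> wt (\<lambda>t. - a t)"
    using ah h y y' subspace_scale[OF subspace_wt] subspace_scale[OF subspace_H]
    by (simp_all add: br_scale_right wts_scale[OF w h] K_scale_right)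
  then show ?thesis using x by blast
qed

lemma dim_span_single: "x \<noteq> 0 \<Longrightarrow> dim (span {x}) = 1"
  using dim_span_eq_card_independent[of "{x}"] by simp

text \<open>The trace of \<open>br x y\<close> on the span of \<open>x\<close>, of \<open>H\<close> and of all root spaces for negative
  multiples of \<open>a\<close> vanishes, which bounds the dimension of the root space of \<open>- a\<close>.\<close>

lemma dim_wt_uminus:
  assumes a: "a \<in> Phi"
  shows "dim (wt (\<lambda>t. - a t)) = 1 \<and> (\<lambda>t. - a t) \<in> Phi"
proof -
  have c: "a \<in> canon" using a Phi_canon by auto
  obtain x y where x: "x \<in> wt a" "x \<noteq> 0" "\<forall>t\<in>H. br t x = a t *s x"
    and y: "y \<in> wt (\<lambda>t. - a t)" "K x y \<noteq> 0" and h: "br x y \<in> H" "a (br x y) = 2"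
    using root_pair[OF a] by blast
  obtain t where t: "t \<in> H" "a t \<noteq> 0" using a by (auto simp: Phi_def)
  let ?h = "br x y"
  define g where "g = (\<lambda>k::int. \<lambda>t. of_int k * a t)"
  have inj: "inj g"
  proof (rule injI)
    fix j k assume "g j = g k"
    then have "g j t = g k t" by simp
    then show "j = k" using t by (simp add: g_def)
  qed
  have g1: "g 1 = a" by (simp add: g_def)
  have gm1: "g (-1) = (\<lambda>t. - a t)" by (simp add: g_def)
  have g0: "wt (g 0) = H" using wt_0 by (simp add: g_def)
  have gc: "g k \<in> canon" for k using c by (auto simp: g_def canon_def)
  have "finite {k. wt (g k) \<noteq> {0}}"
    using wt_shift_finite[of "\<lambda>t. 0" a t] c t by (simp add: g_def canon_def)
  then have fS: "finite {k. k \<le> 0 \<and> (k = 0 \<or> wt (g k) \<noteq> {0})}" (is "finite ?S")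
    by (rule finite_subset[rotated, OF finite_insert[THEN iffD2, of _ 0]]) auto
  \<comment> \<open>At the top end only the line through x is taken, not the whole root space:
    [x, x] = 0 keeps the sum stable under ad x, and the contribution of this end to the trace is
    known.\<close>
  define V where "V = (\<lambda>i. if i = a then span {x} else wt i)"
  have V1: "V (g 1) = span {x}" by (simp add: V_def g1)
  have V2: "V (g k) = wt (g k)" if "k \<le> 0" for k
    using that inj g1 unfolding V_def inj_def by (metis not_one_le_zero)
  let ?L = "g ` insert 1 ?S"
  let ?W = "span (\<Union>i\<in>?L. V i)"
  have L: "finite ?L" "?L \<subseteq> canon" using fS gc by auto
  have Vs: "V i \<subseteq> wt i" for i using x(1) span_minimal[OF _ subspace_wt] by (auto simp: V_def)
  have sV: "subspace (V i)" for i by (simp add: V_def subspace_wt)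
  have inW: "v \<in> ?W" if "v \<in> wt (g k)" "k \<le> 0" for v k
  proof (cases "k \<in> ?S")
    case True
    then have "v \<in> V (g k)" using that V2 by simp
    then show ?thesis using True by (intro span_base) blast
  next
    case False
    then show ?thesis using that span_zero by auto
  qed
  have xW: "c *s x \<in> ?W" for c
  proof -
    have "c *s x \<in> V (g 1)" unfolding V1 by (intro span_scale span_base) simp
    then show ?thesis by (intro span_base) blast
  qed
  have Vcases: "(\<exists>c. v = c *s x) \<or> (\<exists>k\<le>0. v \<in> wt (g k))" if v: "v \<in> (\<Union>i\<in>?L. V i)" for v
  proof -
    obtain k where k: "k = 1 \<or> k \<le> 0" "v \<in> V (g k)" using v by blast
    show ?thesis
    proof (cases "k = 1")
      case True
      then have "v \<in> span {x}" using k V1 by simp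
      then show ?thesis by (auto simp: span_singleton)
    qed (use k V2 in auto)
  qed
  have px: "preserves (br x) ?W"
  proof (rule preserves_span[OF lin_br])
    fix v assume "v \<in> (\<Union>i\<in>?L. V i)"
    then consider c where "v = c *s x" | k where "k \<le> 0" "v \<in> wt (g k)" using Vcases by blast
    then show "br x v \<in> ?W"
    proof cases
      case 1
      then show ?thesis by (simp add: br_scale_right br_self span_zero)
    next
      case 2
      show ?thesis
      proof (cases "k = 0")
        case True
        then have "v \<in> H" using 2 g0 by simp
        \<comment> \<open>Here x has to be a genuine eigenvector of \<open>H\<close>, since
          otherwise the bracket could leave its line.\<close>
        then have "br x v = (- a v) *s x" using x(3) br_anti[of x v] by simp
        then show ?thesis using xW[of "- a v"] by (simp only:)
      next
        case False
        have "br x v \<in> wt (\<lambda>t. a t + g k t)" by (rule br_wt[OF x(1) 2(2)])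
        moreover have "(\<lambda>t. a t + g k t) = g (k + 1)" by (auto simp: g_def algebra_simps)
        ultimately show ?thesis using inW[of _ "k + 1"] 2(1) False by simp
      qed
    qed
  qed
  have py: "preserves (br y) ?W"
  proof (rule preserves_span[OF lin_br])
    fix v assume "v \<in> (\<Union>i\<in>?L. V i)"
    then consider c where "v = c *s x" | k where "k \<le> 0" "v \<in> wt (g k)" using Vcases by blast
    then show "br y v \<in> ?W"
    proof cases
      case 1
      have "br y v = (- c) *s ?h" unfolding 1 br_scale_right br_anti[of y x] by simp
      then have "br y v \<in> wt (g 0)" using subspace_scale[OF subspace_H h(1)] g0 by (simp only:)
      then show ?thesis using inW[of _ 0] by simp
    next
      case 2
      have "br y v \<in> wt (\<lambda>t. - a t + g k t)" by (rule br_wt[OF y(1) 2(2)])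
      moreover have "(\<lambda>t. - a t + g k t) = g (k - 1)" by (auto simp: g_def algebra_simps)
      ultimately show ?thesis using inW[of _ "k - 1"] 2(1) by simp
    qed
  qed
  have ph: "preserves (br ?h) (V i)" for i
  proof (cases "i = a")
    case True
    have "br ?h v \<in> span {x}" if vx: "v \<in> span {x}" for v
    proof -
      obtain c where v: "v = c *s x" using vx by (auto simp: span_singleton)
      have "br ?h v = (c * a ?h) *s x" unfolding v br_scale_right using x(3) h(1) by simp
      then show ?thesis by (auto simp: span_singleton)
    qed
    then show ?thesis using True by (simp add: V_def preserves_def lin_br)
  qed (simp add: V_def preserves_wt[OF h(1)])
  have tr: "trace (V (g k)) (br ?h) = of_int k * 2 * of_nat (dim (V (g k)))" for k
  proof (rule trace_geneig[OF fin_all[OF sV] ph])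
    show "V (g k) \<subseteq> geneig (br ?h) (of_int k * 2)"
    proof
      fix v assume "v \<in> V (g k)"
      then have "v \<in> geneig (br ?h) (g k ?h)" using Vs h(1) by (auto simp: wt_def)
      then show "v \<in> geneig (br ?h) (of_int k * 2)" by (simp add: g_def h(2))
    qed
  qed
  have d: "direct ?L V" using L Vs by (intro wt_direct_sub) auto
  have "0 = trace ?W (br ?h)" using trace_commutator[OF fin_all[OF subspace_span] px py] by simp
  also have "\<dots> = (\<Sum>i\<in>?L. trace (V i) (br ?h))"
    using trace_direct[OF L(1) d fin_all[OF sV] ph lin_br] by simp
  also have "\<dots> = (\<Sum>k\<in>insert 1 ?S. trace (V (g k)) (br ?h))"
    by (rule sum.reindex_cong[OF inj_on_subset[OF inj]]) auto
  also have "\<dots> = (\<Sum>k\<in>insert 1 ?S. of_int (k * 2 * int (dim (V (g k)))))"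
    by (intro sum.cong refl) (simp add: tr)
  also have "\<dots> = of_int (\<Sum>k\<in>insert 1 ?S. k * 2 * int (dim (V (g k))))" by simp
  finally have "complex_of_int (\<Sum>k\<in>insert 1 ?S. k * 2 * int (dim (V (g k)))) = 0" by (rule sym)
  then have "(\<Sum>k\<in>insert 1 ?S. k * 2 * int (dim (V (g k)))) = 0" by (simp only: of_int_eq_0_iff)
  then have "2 * int (dim (V (g 1))) + (\<Sum>k\<in>?S. k * 2 * int (dim (V (g k)))) = 0"
    using fS by (subst (asm) sum.insert) auto
  moreover have "(\<Sum>k\<in>?S. k * 2 * int (dim (V (g k)))) = - 2 * (\<Sum>k\<in>?S. (- k) * int (dim (V (g k))))"
    by (simp add: sum_distrib_left algebra_simps sum_negf)
  \<comment> \<open>The space with index k contributes 2 k times its dimension to the trace, and the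
    line through x contributes 2. The nonpositive indices must balance this, which leaves total 1
    after division by 2.\<close>
  ultimately have s1: "(\<Sum>k\<in>?S. (- k) * int (dim (V (g k)))) = 1"
    using dim_span_single[OF x(2)] V1 by simp
  have "y \<noteq> 0" using y K_zero by auto
  then have n0: "wt (\<lambda>t. - a t) \<noteq> {0}" using y by auto
  then have m: "-1 \<in> ?S" using gm1 by simp
  have "(- (-1)) * int (dim (V (g (-1)))) \<le> (\<Sum>k\<in>?S. (- k) * int (dim (V (g k))))"
    by (rule member_le_sum[OF m _ fS]) (simp add: mult_nonpos_nonneg)
  then have "dim (wt (\<lambda>t. - a t)) \<le> 1" using s1 V2[of "-1"] gm1 by simp
  moreover have "(\<lambda>t. - a t) \<in> wts" using n0 uminus_canon[OF c] by (simp add: wts_def)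
  moreover from this have "dim (wt (\<lambda>t. - a t)) > 0" by (rule dim_wts)
  ultimately show ?thesis using t by (auto simp: Phi_def)
qed

text \<open>The bound concerns the negative of a root, and every root is the negative of a
  root.\<close>

lemma dim_wt_Phi: "a \<in> Phi \<Longrightarrow> dim (wt a) = 1"
  using dim_wt_uminus[of "\<lambda>t. - a t"] dim_wt_uminus[of a] by simp

lemma wt_Phi_span:
  assumes a: "a \<in> Phi" and x: "x \<in> wt a" "x \<noteq> 0"
  shows "wt a = span {x}"
proof -
  have "independent {x}" "{x} \<subseteq> wt a" using x by auto
  then obtain C where C: "{x} \<subseteq> C" "finite C" "span C = wt a" "card C = dim (wt a)"
    using fin_basis_extend[OF fin_wt] by metis
  then have "C = {x}" using dim_wt_Phi[OF a] by (metis card_1_singletonE insert_subset singletonD)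
  then show ?thesis using C by simp
qed

text \<open>The root space is a line and contains a genuine eigenvector, so all its elements are
  genuine eigenvectors. This identifies the generalized root spaces with
  \<open>root_space\<close>.\<close>

lemma wt_Phi_eigen:
  assumes a: "a \<in> Phi" and v: "v \<in> wt a" and t: "t \<in> H"
  shows "br t v = a t *s v"
proof -
  obtain x where x: "x \<in> wt a" "x \<noteq> 0" "\<forall>t\<in>H. br t x = a t *s x"
    using root_eigenvector[OF a] by blast
  have "v \<in> span {x}" using v wt_Phi_span[OF a x(1,2)] by simp
  then obtain c where "v = c *s x" by (auto simp: span_singleton)
  then show ?thesis using x(3) t by (simp add: br_scale_right mult.commute)
qed

lemma root_space_subset: "root_space scale br H a \<subseteq> wt a"
proof
  fix x assume x: "x \<in> root_space scale br H a"
  have "x \<in> geneig (br t) (a t)" if "t \<in> H" for t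
    by (rule geneig_step) (use x that in \<open>simp add: root_space_def geneig_zero\<close>)
  then show "x \<in> wt a" by (simp add: wt_def)
qed

lemma root_space_Phi: "a \<in> Phi \<Longrightarrow> root_space scale br H a = wt a"
  using root_space_subset wt_Phi_eigen by (auto simp: root_space_def)

lemma h_functional_wts: "a \<in> wts \<Longrightarrow> h_functional scale H a"
  using wts_add[of a] wts_scale[of a] wts_canon by (auto simp: h_functional_def canon_def)

lemma roots_eq: "roots scale br H = Phi"
proof
  show "Phi \<subseteq> roots scale br H"
    using h_functional_wts root_space_Phi by (auto simp: roots_def Phi_def wts_def)
  show "roots scale br H \<subseteq> Phi"
  proof
    fix a assume a: "a \<in> roots scale br H"
    have "0 \<in> root_space scale br H a" by (simp add: root_space_def)
    then have "wt a \<noteq> {0}" using a root_space_subset[of a] by (auto simp: roots_def)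
    then show "a \<in> Phi" using a by (auto simp: Phi_def wts_def canon_def roots_def h_functional_def)
  qed
qed

lemma uminus_Phi: "a \<in> Phi \<Longrightarrow> (\<lambda>t. - a t) \<in> Phi"
  using dim_wt_uminus by blast

lemma br_opposite:
  assumes a: "a \<in> Phi" and xy: "x \<in> wt a" "x \<noteq> 0" "y \<in> wt (\<lambda>t. - a t)" "y \<noteq> 0"
    and uv: "u \<in> wt a" "v \<in> wt (\<lambda>t. - a t)"
  shows "\<exists>c. br u v = c *s br x y"
proof -
  obtain c d where "u = c *s x" "v = d *s y"
    using uv wt_Phi_span[OF a xy(1,2)] wt_Phi_span[OF uminus_Phi[OF a] xy(3,4)]
    by (auto simp: span_singleton)
  then have "br u v = (c * d) *s br x y" by (simp add: br_scale_left br_scale_right)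
  then show ?thesis by blast
qed

section \<open>Coroots and the span of the simple coroots\<close>

abbreviation cor :: "('g \<Rightarrow> complex) \<Rightarrow> 'g" where
  "cor \<equiv> coroot scale br H"

text \<open>The brackets of opposite root spaces form a line on which a is not zero, so exactly one
  of them has value 2 under a. This is what makes the definite description in \<open>coroot\<close>
  meaningful.\<close>

lemma coroot_triple:
  assumes a: "a \<in> Phi"
  obtains x y where "x \<in> wt a" "x \<noteq> 0" "y \<in> wt (\<lambda>t. - a t)" "y \<noteq> 0" "cor a = br x y" "K x y \<noteq> 0"
    "cor a \<in> H" "a (cor a) = 2"
proof -
  obtain x y where x: "x \<in> wt a" "x \<noteq> 0" and y: "y \<in> wt (\<lambda>t. - a t)" "K x y \<noteq> 0"
      and h: "br x y \<in> H" "a (br x y) = 2"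
    using root_pair[OF a] by blast
  have y0: "y \<noteq> 0" using y K_zero by auto
  have m: "- a = (\<lambda>t. - a t)" by (simp add: fun_Compl_def)
  have r: "root_space scale br H a = wt a" "root_space scale br H (- a) = wt (\<lambda>t. - a t)"
    unfolding m using root_space_Phi a uminus_Phi by auto
  have "cor a = br x y" unfolding coroot_def r
  proof (rule the_equality)
    fix t assume t: "t \<in> {br u v |u v. u \<in> wt a \<and> v \<in> wt (\<lambda>t. - a t)} \<and> a t = 2"
    then obtain c where c: "t = c *s br x y" using br_opposite[OF a x y(1) y0] by blast
    then have "a t = c * 2" using wts_scale[OF Phi_wts[OF a] h(1)] h(2) by simp
    then show "t = br x y" using t c by simp
  qed (use x y h in blast)
  then show ?thesis using that x y y0 h by metis
qed

lemma coroot_H: "a \<in> Phi \<Longrightarrow> cor a \<in> H"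
  and coroot_2: "a \<in> Phi \<Longrightarrow> a (cor a) = 2"
  by (erule coroot_triple, assumption)+

lemma br_opposite_coroot:
  assumes "a \<in> Phi" "u \<in> wt a" "v \<in> wt (\<lambda>t. - a t)"
  shows "\<exists>c. br u v = c *s cor a"
proof -
  obtain x y where xy: "x \<in> wt a" "x \<noteq> 0" "y \<in> wt (\<lambda>t. - a t)" "y \<noteq> 0" "cor a = br x y"
    by (rule coroot_triple[OF assms(1)])
  show ?thesis unfolding xy(5) by (rule br_opposite[OF assms(1) xy(1-4) assms(2,3)])
qed

lemma coroot_sl2:
  assumes a: "a \<in> Phi"
  obtains x y where "br (cor a) x = 2 *s x" "br (cor a) y = (- 2) *s y" "br x y = cor a"
proof -
  obtain x y where xy: "x \<in> wt a" "y \<in> wt (\<lambda>t. - a t)" "cor a = br x y" "cor a \<in> H" "a (cor a) = 2"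
    by (rule coroot_triple[OF a])
  have "br (cor a) x = 2 *s x" "br (cor a) y = (- 2) *s y"
    using wt_Phi_eigen[OF a xy(1,4)] wt_Phi_eigen[OF uminus_Phi[OF a] xy(2,4)] xy(5) by simp_all
  then show ?thesis using that xy(3) by simp
qed

lemma K_coroot:
  assumes a: "a \<in> Phi"
  obtains c where "c \<noteq> 0" "\<And>t. t \<in> H \<Longrightarrow> K (cor a) t = c * a t"
proof -
  obtain x y where xy: "x \<in> wt a" "y \<in> wt (\<lambda>t. - a t)" "cor a = br x y" "K x y \<noteq> 0"
    by (rule coroot_triple[OF a])
  have "K (cor a) t = K x y * a t" if t: "t \<in> H" for t
  proof -
    have "br y t = a t *s y" using wt_Phi_eigen[OF uminus_Phi[OF a] xy(2) t] br_anti[of y t] by simp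
    then show ?thesis unfolding xy(3) K_invariant by (simp add: K_scale_right)
  qed
  then show ?thesis using that xy(4) by blast
qed

lemma H_coroots: "H = span (cor ` Phi)"
proof
  show "span (cor ` Phi) \<subseteq> H" using coroot_H by (intro span_minimal subspace_H) auto
  show "H \<subseteq> span (cor ` Phi)"
  proof (rule H_generated[OF subspace_span])
    fix a x y assume a: "a \<in> wts" and xy: "x \<in> wt a" "y \<in> wt (\<lambda>t. - a t)"
    show "br x y \<in> span (cor ` Phi)"
    proof (cases "a \<in> Phi")
      case True
      then obtain c where "br x y = c *s cor a" using br_opposite_coroot xy by blast
      then show ?thesis using True span_scale[OF span_base[of "cor a" "cor ` Phi"]] by simp
    next
      case False
      then have "wt a = H" "wt (\<lambda>t. - a t) = H"
        using wt_cong[of a "\<lambda>t. 0"] wt_cong[of "\<lambda>t. - a t" "\<lambda>t. 0"] wt_0 wt_not_Phi[OF a] by auto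
      then show ?thesis using xy H_abelian span_zero by simp
    qed
  qed
qed

lemma K_sum_left: "K (sum f A) z = (\<Sum>a\<in>A. K (f a) z)"
  unfolding K_commute[of _ z] by (rule K_sum_right)

text \<open>The map f sending v to the sum of K(h_i, v) h_i takes \<open>H\<close> into the span of
  the simple coroots h_i. If f t = 0, pairing with s under K gives a linear relation among the
  simple roots, so all of them, hence all roots, vanish at t and t = 0. Injectivity on
  \<open>H\<close> then forces equal dimensions.\<close>

lemma simple_coroots_span:
  assumes sr: "simple_roots scale br H n al"
  shows "span ((\<lambda>i. cor (al i)) ` {1..n}) = H"
proof (rule ccontr)
  let ?h = "\<lambda>i. cor (al i)"
  let ?S = "span (?h ` {1..n})"
  assume ne: "?S \<noteq> H"
  have al: "al i \<in> Phi" if "i \<in> {1..n}" for i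
    using sr that by (simp add: simple_roots_def roots_eq)
  have ind: "\<And>c. (\<forall>t\<in>H. (\<Sum>i=1..n. c i * al i t) = 0) \<Longrightarrow> \<forall>i\<in>{1..n}. c i = 0"
    and comb: "\<And>b. b \<in> Phi \<Longrightarrow> \<exists>k::nat \<Rightarrow> nat. (\<forall>t\<in>H. b t = (\<Sum>i=1..n. of_nat (k i) * al i t)) \<or>
        (\<forall>t\<in>H. b t = - (\<Sum>i=1..n. of_nat (k i) * al i t))"
    using sr by (auto simp: simple_roots_def roots_eq)
  have SH: "?S \<subseteq> H" using al coroot_H by (intro span_minimal subspace_H) auto
  have "\<forall>i\<in>{1..n}. \<exists>c. c \<noteq> 0 \<and> (\<forall>t\<in>H. K (?h i) t = c * al i t)"
    using K_coroot[OF al] by metis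
  then obtain c where c: "\<And>i. i \<in> {1..n} \<Longrightarrow> c i \<noteq> 0" "\<And>i t. i \<in> {1..n} \<Longrightarrow> t \<in> H \<Longrightarrow> K (?h i) t = c i * al i t"
    by metis
  define f where "f v = (\<Sum>i=1..n. K (?h i) v *s ?h i)" for v
  have f: "lin f"
    by (rule linI) (simp_all add: f_def K_add_right K_scale_right scale_left_distrib sum.distrib scale_sum_right)
  have fS: "f v \<in> ?S" for v
    unfolding f_def by (intro span_sum span_scale span_base) auto
  have ker: "t = 0" if t: "t \<in> H" "f t = 0" for t
  proof -
    have "\<forall>s\<in>H. (\<Sum>i=1..n. (K (?h i) t * c i) * al i s) = 0"
    proof
      fix s assume s: "s \<in> H"
      have "0 = K (f t) s" using t K_zero by simp
      also have "\<dots> = (\<Sum>i=1..n. (K (?h i) t * c i) * al i s)"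
        unfolding f_def K_sum_left by (intro sum.cong refl) (simp add: K_scale_left c(2) s)
      finally show "(\<Sum>i=1..n. (K (?h i) t * c i) * al i s) = 0" by simp
    qed
    from ind[OF this] have z: "al i t = 0" if "i \<in> {1..n}" for i
      using that c t by auto
    have "l t = 0" if l: "l \<in> wts" for l
    proof (cases "l \<in> Phi")
      case True
      have "(\<Sum>i=1..n. of_nat (k i) * al i t) = (0::complex)" for k :: "nat \<Rightarrow> nat"
        using z by (intro sum.neutral) auto
      then show ?thesis using comb[OF True] t(1) by fastforce
    qed (use wt_not_Phi l t in auto)
    then show ?thesis by (rule H_faithful[OF t(1)])
  qed
  obtain C where C: "finite C" "independent C" "span C = H" "card C = dim H"
    using fin_basis[OF fin_all[OF subspace_H]] by metis
  have inj: "inj_on f H"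
  proof (rule inj_onI)
    fix s t assume st: "s \<in> H" "t \<in> H" "f s = f t"
    then have "f (s - t) = 0" by (simp add: lin_diff[OF f])
    then show "s = t" using ker[of "s - t"] st subspace_diff[OF subspace_H] by simp
  qed
  interpret vp: vector_space_pair scale scale ..
  have iC: "independent (f ` C)"
    using vp.linear_independent_injective_image[OF f C(2)] inj C(3) by simp
  have "f ` C \<subseteq> ?S" using fS by auto
  then obtain D where D: "f ` C \<subseteq> D" "finite D" "card D = dim ?S"
    using fin_basis_extend[OF fin_all[OF subspace_span] iC] by metis
  have "C \<subseteq> H" using C(3) span_superset by blast
  then have "card (f ` C) = card C" using inj by (intro card_image inj_on_subset[OF inj])
  then have "dim H \<le> dim ?S" using C(4) D card_mono[OF D(2,1)] by simp
  moreover have "dim ?S < dim H" using fin_dim_less[OF fin_all[OF subspace_H] subspace_span] SH ne by blast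
  ultimately show False by simp
qed

lemma span_root_vectors:
  assumes E: "root_vectors scale br H E"
  shows "span (H \<union> E ` Phi) = UNIV"
proof -
  have "wt l \<subseteq> span (H \<union> E ` Phi)" if l: "l \<in> wts" for l
  proof (cases "l \<in> Phi")
    case True
    then have "E l \<in> wt l" "E l \<noteq> 0" using E root_space_Phi by (auto simp: root_vectors_def roots_eq)
    then have "wt l = span {E l}" by (rule wt_Phi_span[OF True])
    also have "\<dots> \<subseteq> span (H \<union> E ` Phi)" using True by (intro span_mono) auto
    finally show ?thesis .
  next
    case False
    then have "wt l = H" using wt_cong[of l "\<lambda>t. 0"] wt_0 wt_not_Phi[OF l] by auto
    then show ?thesis using span_superset by blast
  qed
  then have "span (\<Union>l\<in>wts. wt l) \<subseteq> span (H \<union> E ` Phi)"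
    by (intro span_minimal) auto
  then show ?thesis using span_wts by blast
qed

lemma root_vector_eigen:
  assumes E: "root_vectors scale br H E" and a: "a \<in> Phi" and t: "t \<in> H"
  shows "br t (E a) = a t *s E a"
  using wt_Phi_eigen[OF a _ t] E a root_space_Phi by (auto simp: root_vectors_def roots_eq)

end

section \<open>Semisimplicity of the Cartan element of an sl2-triple\<close>

text \<open>The commutation relations hold on the whole space, and only finite-dimensionality is
  confined to W. This fits matrices acting on functions on \<open>nat\<close>.\<close>

locale sl2_action = complex_vs scale
  for scale :: "complex \<Rightarrow> 'v::ab_group_add \<Rightarrow> 'v" (infixr "*s" 75) +
  fixes X Y h :: "'v \<Rightarrow> 'v" and W :: "'v set"
  assumes lin_X: "lin X" and lin_Y: "lin Y" and lin_h: "lin h" and fin_W: "fin W"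
    and X_W: "v \<in> W \<Longrightarrow> X v \<in> W" and Y_W: "v \<in> W \<Longrightarrow> Y v \<in> W" and h_W: "v \<in> W \<Longrightarrow> h v \<in> W"
    and hX: "h (X v) = X (h v) + 2 *s X v" and hY: "h (Y v) = Y (h v) - 2 *s Y v"
    and XY: "X (Y v) = Y (X v) + h v"
begin

lemmas lins = lin_add[OF lin_X] lin_add[OF lin_Y] lin_add[OF lin_h]
  lin_diff[OF lin_X] lin_diff[OF lin_Y] lin_diff[OF lin_h]
  lin_scale[OF lin_X] lin_scale[OF lin_Y] lin_scale[OF lin_h]
  lin_zero[OF lin_X] lin_zero[OF lin_Y] lin_zero[OF lin_h]

lemma subspace_W: "subspace W"
  using fin_W fin_subspace by auto

text \<open>D shifts generalized eigenvalues of h by d, and only finitely many occur on W. The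
  one-element index set lets the finiteness of weights speak about eigenvalues of the single
  operator h.\<close>

lemma ladder_nilpotent:
  assumes D: "lin D" "\<And>v. v \<in> W \<Longrightarrow> D v \<in> W" "\<And>v. h (D v) = D (h v) + d *s D v" "d \<noteq> 0"
    and v: "v \<in> W" "v \<in> geneig h c"
  shows "\<exists>k. (D ^^ k) v = 0"
proof -
  interpret op: operator_family scale "{()}" "\<lambda>_. h"
    by standard (auto simp: lins intro: geneig_inv lin_h)
  have D1: "D u \<in> geneig h (b + d)" if "u \<in> geneig h b" for u b
    using that
  proof induction
    case geneig_zero
    then show ?case by (simp add: lin_zero[OF D(1)] geneig.geneig_zero)
  next
    case (geneig_step u)
    have "h (D u) - (b + d) *s D u = D (h u - b *s u)"
      by (simp add: D(3) lin_diff[OF D(1)] lin_scale[OF D(1)] scale_left_distrib)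
    then show ?case using geneig_step.IH by (metis geneig.geneig_step)
  qed
  have Dk: "(D ^^ k) v \<in> W \<inter> geneig h (c + of_nat k * d)" for k
  proof (induction k)
    case (Suc k)
    then show ?case using D(2) D1[of "(D ^^ k) v" "c + of_nat k * d"]
      by (simp add: algebra_simps)
  qed (use v in simp)
  let ?g = "\<lambda>k::nat. \<lambda>_::unit. c + of_nat k * d"
  have "inj ?g" using D(4) by (auto simp: inj_def fun_eq_iff)
  then have "infinite (range ?g)" using finite_imageD infinite_UNIV_nat by blast
  then have "\<not> range ?g \<subseteq> {l \<in> op.canon. W \<inter> op.wt l \<noteq> {0}}"
    using op.finite_wts[OF fin_W] finite_subset by blast
  then obtain k where "W \<inter> op.wt (?g k) = {0}" by (auto simp: op.canon_def)
  then show ?thesis using Dk[of k] by (auto simp: op.wt_def)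
qed

lemma h_X_pow: "h u = c *s u + w \<Longrightarrow> h ((X ^^ k) u) = (c + 2 * of_nat k) *s (X ^^ k) u + (X ^^ k) w"
  by (induction k) (simp_all add: hX lins scale_left_distrib scale_right_distrib algebra_simps)

lemma h_Y_pow: "h u = c *s u + w \<Longrightarrow> h ((Y ^^ k) u) = (c - 2 * of_nat k) *s (Y ^^ k) u + (Y ^^ k) w"
proof (induction k)
  case (Suc k)
  have "h ((Y ^^ Suc k) u) = Y ((c - 2 * of_nat k) *s (Y ^^ k) u + (Y ^^ k) w) - 2 *s (Y ^^ Suc k) u"
    using hY[of "(Y ^^ k) u"] Suc by simp
  then show ?case by (simp add: lins algebra_simps)
qed simp

text \<open>The usual commutation formula for a highest weight vector, with a second term that
  records the off-diagonal entry w of a Jordan block of h.\<close>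

lemma X_Y_pow:
  assumes u: "X u = 0" "h u = c *s u + w"
  shows "X ((Y ^^ Suc k) u) = (of_nat (Suc k) * (c - of_nat k)) *s (Y ^^ k) u + of_nat (Suc k) *s (Y ^^ k) w"
proof (induction k)
  case 0
  show ?case using u by (simp add: XY lins)
next
  case (Suc k)
  have "X ((Y ^^ Suc (Suc k)) u) = Y (X ((Y ^^ Suc k) u)) + h ((Y ^^ Suc k) u)"
    using XY[of "(Y ^^ Suc k) u"] by simp
  also have "\<dots> = (of_nat (Suc k) * (c - of_nat k)) *s (Y ^^ Suc k) u + of_nat (Suc k) *s (Y ^^ Suc k) w
      + ((c - 2 * of_nat (Suc k)) *s (Y ^^ Suc k) u + (Y ^^ Suc k) w)"
    unfolding Suc h_Y_pow[OF u(2)] by (simp add: lins)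
  also have "\<dots> = (of_nat (Suc k) * (c - of_nat k) + (c - 2 * of_nat (Suc k))) *s (Y ^^ Suc k) u
      + (of_nat (Suc k) + 1) *s (Y ^^ Suc k) w"
    by (simp only: scale_left_distrib scale_one add.assoc add.left_commute)
  also have "of_nat (Suc k) * (c - of_nat k) + (c - 2 * of_nat (Suc k)) = of_nat (Suc (Suc k)) * (c - of_nat (Suc k))"
    by (simp add: algebra_simps)
  finally show ?case by (simp add: add.commute)
qed

lemma geneig_Jordan_block:
  assumes "h u = c *s u + w" "h w = c *s w"
  shows "u \<in> geneig h c" "w \<in> geneig h c"
proof -
  show w: "w \<in> geneig h c" by (rule geneig_step) (simp add: assms geneig_zero)
  show "u \<in> geneig h c" by (rule geneig_step) (simp add: assms w)
qed

lemma least_power: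
  fixes D :: "'v \<Rightarrow> 'v"
  assumes "(D ^^ k) v = (0::'v)" "v \<noteq> 0"
  obtains j where "(D ^^ j) v \<noteq> 0" "(D ^^ Suc j) v = 0"
proof -
  obtain m where m: "(D ^^ m) v = 0" "\<And>i. i < m \<Longrightarrow> (D ^^ i) v \<noteq> 0"
    using ex_least_nat_le[of "\<lambda>k. (D ^^ k) v = 0" k] assms by auto
  have "m \<noteq> 0" using m(1) assms(2) by (cases m) auto
  then show ?thesis using that[of "m - 1"] m by (cases m) auto
qed

text \<open>Applying X to the first vanishing vector \<open>(Y ^^ Suc j) w\<close> yields (j + 1)(c
  - j) = 0.\<close>

lemma highest_weight:
  assumes w: "w \<in> W" "w \<noteq> 0" "X w = 0" "h w = c *s w"
  obtains j :: nat where "c = of_nat j" "(Y ^^ j) w \<noteq> 0" "(Y ^^ Suc j) w = 0"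
proof -
  have hw: "h w = c *s w + 0" using w by simp
  have "w \<in> geneig h c" using geneig_Jordan_block[of w c 0] w by (simp add: lins)
  then obtain k where "(Y ^^ k) w = 0"
    using ladder_nilpotent[OF lin_Y Y_W _ _ w(1), of "-2" c] hY by auto
  then obtain j where j: "(Y ^^ j) w \<noteq> 0" "(Y ^^ Suc j) w = 0" using least_power w(2) by metis
  have "0 = (of_nat (Suc j) * (c - of_nat j)) *s (Y ^^ j) w"
    using X_Y_pow[OF w(3) hw, of j] j(2) lin_zero[OF funpow_lin[OF lin_Y]] by (simp add: lins)
  then have "of_nat (Suc j) * (c - of_nat j) = 0" using j(1) by simp
  then have "c = of_nat j" by (simp del: of_nat_Suc)
  then show ?thesis using that j by blast
qed

text \<open>With c = j, the coefficient (p + 1)(c - p) is nonzero for p > j and the w-terms vanish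
  there, so the vanishing of a high power of Y on u descends to exponent j + 1.\<close>

lemma no_Jordan_block_highest:
  assumes u: "u \<in> W" "X u = 0" "h u = c *s u + w" and w: "w \<in> W" "X w = 0" "h w = c *s w"
  shows "w = 0"
proof (rule ccontr)
  assume w0: "w \<noteq> 0"
  obtain j :: nat where j: "c = of_nat j" "(Y ^^ j) w \<noteq> 0" "(Y ^^ Suc j) w = 0"
    by (rule highest_weight[OF w(1) w0 w(2,3)])
  have Yw: "(Y ^^ p) w = 0" if "p \<ge> Suc j" for p
  proof -
    have "(Y ^^ p) w = (Y ^^ (p - Suc j)) ((Y ^^ Suc j) w)"
      using that by (metis comp_apply funpow_add le_add_diff_inverse2)
    then show ?thesis using j(3) lin_zero[OF funpow_lin[OF lin_Y]] by simp
  qed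
  have "u \<in> geneig h c" using geneig_Jordan_block[OF u(3) w(3)] by simp
  then obtain m where m: "(Y ^^ m) u = 0"
    using ladder_nilpotent[OF lin_Y Y_W _ _ u(1), of "-2" c] hY by auto
  have "(Y ^^ (Suc j + k)) u = 0 \<Longrightarrow> (Y ^^ Suc j) u = 0" for k
  proof (induction k)
    case (Suc k)
    let ?p = "Suc j + k"
    have "(Y ^^ Suc ?p) u = 0" using Suc.prems by simp
    then have "0 = (of_nat (Suc ?p) * (c - of_nat ?p)) *s (Y ^^ ?p) u + of_nat (Suc ?p) *s (Y ^^ ?p) w"
      using X_Y_pow[OF u(2,3), of ?p] by (simp add: lins)
    then have "(of_nat (Suc ?p) * (c - of_nat ?p)) *s (Y ^^ ?p) u = 0" using Yw[of ?p] by simp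
    moreover have "of_nat (Suc ?p) * (c - of_nat ?p) \<noteq> 0"
    proof -
      have "c - of_nat ?p = - of_nat (Suc k)" unfolding j(1) by simp
      then show ?thesis by (simp del: of_nat_Suc of_nat_add)
    qed
    ultimately have "(Y ^^ ?p) u = 0" by (simp only: scale_eq_0_iff) simp
    then show ?case by (rule Suc.IH)
  qed simp
  moreover have "(Y ^^ (Suc j + m)) u = 0"
    using m lin_zero[OF funpow_lin[OF lin_Y]] lin_zero[OF lin_Y] by (simp add: funpow_add)
  ultimately have "(Y ^^ Suc j) u = 0" by blast
  \<comment> \<open>At exponent j the coefficient c - j of the u-term is zero and only the w-term
    survives.\<close>
  then have "of_nat (Suc j) *s (Y ^^ j) w = 0"
    using X_Y_pow[OF u(2,3), of j] j(1) by (simp add: lins)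
  then show False using j(2) by (simp del: of_nat_Suc)
qed

text \<open>Twice the usual element XY + YX + h^2/2, ordered with X on the right so that on vectors
  killed by X only h contributes.\<close>

definition Casimir :: "'v \<Rightarrow> 'v" where
  "Casimir v = h (h v) + 2 *s h v + 4 *s Y (X v)"

lemma lin_Casimir: "lin Casimir"
  by (rule linI) (simp_all add: Casimir_def lins scale_right_distrib mult.commute algebra_simps)

lemma Casimir_W: "v \<in> W \<Longrightarrow> Casimir v \<in> W"
  unfolding Casimir_def using X_W Y_W h_W
  by (intro subspace_add[OF subspace_W] subspace_scale[OF subspace_W]) auto

lemma Casimir_h: "h (Casimir v) = Casimir (h v)"
  by (simp add: Casimir_def lins hX hY algebra_simps)

lemma Casimir_X: "X (Casimir v) = Casimir (X v)"
proof -
  have Xh: "X (h v) = h (X v) - 2 *s X v" for v by (simp add: hX)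
  have "X (h (h v)) = h (h (X v)) - 4 *s h (X v) + 4 *s X v"
    by (simp add: Xh lins algebra_simps)
       (simp add: hX lins algebra_simps flip: scale_left_distrib)
  moreover have "X (Y (X v)) = Y (X (X v)) + h (X v)" by (rule XY)
  ultimately show ?thesis
    by (simp add: Casimir_def lins Xh scale_right_distrib scale_right_diff_distrib)
       (simp add: algebra_simps flip: scale_left_distrib)
qed

lemma Casimir_X_pow: "(X ^^ k) (Casimir v) = Casimir ((X ^^ k) v)"
  by (induction k) (simp_all add: Casimir_X)

lemma Casimir_highest: "X v = 0 \<Longrightarrow> h v = c *s v \<Longrightarrow> Casimir v = (c * c + 2 * c) *s v"
  by (simp add: Casimir_def lins scale_left_distrib)

text \<open>The components of \<open>u\<close> on which the Casimir element acts through another highest weight are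
  removed one at a time, until \<open>u\<close> itself is killed by \<open>X\<close>.\<close>

lemma no_Jordan_block_X:
  assumes "u \<in> W" "(X ^^ Suc j) u = 0" "h u = c *s u + w" "w \<in> W" "X w = 0" "h w = c *s w"
  shows "w = 0"
  using assms
proof (induction j arbitrary: u w)
  case 0
  then show ?case using no_Jordan_block_highest[of u c w] by simp
next
  case (Suc j)
  let ?z = "(X ^^ Suc j) u"
  show ?case
  proof (rule ccontr)
    assume w0: "w \<noteq> 0"
    then have z0: "?z \<noteq> 0" using Suc.IH[OF Suc.prems(1) _ Suc.prems(3-6)] by blast
    let ?m = "c + 2 * of_nat (Suc j)"
    have XW: "(X ^^ k) u \<in> W" for k by (induction k) (use Suc.prems(1) X_W in auto)
    have "(X ^^ Suc j) w = 0"
      unfolding funpow_Suc_right comp_apply Suc.prems(5) by (rule lin_zero[OF funpow_lin[OF lin_X]])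
    then have hz: "h ?z = ?m *s ?z" using h_X_pow[OF Suc.prems(3), of "Suc j"] by simp
    have Xz: "X ?z = 0" using Suc.prems(2) by simp
    \<comment> \<open>Because w is a highest weight vector, c is a natural number. This makes the
      Casimir values c^2 + 2 c at the two highest weights c and \<open>?m\<close> distinct.\<close>
    obtain l :: nat where l: "c = of_nat l" by (rule highest_weight[OF Suc.prems(4) w0 Suc.prems(5,6)])
    let ?q = "\<lambda>c::complex. c * c + 2 * c"
    have "?q c - ?q ?m = - (2 * of_nat (Suc j) * (2 * of_nat l + 2 * of_nat (Suc j) + 2))"
      unfolding l by (simp add: algebra_simps del: of_nat_Suc)
    also have "\<dots> = - of_nat (2 * Suc j * (2 * l + 2 * Suc j + 2))"
      by (simp only: of_nat_mult of_nat_add of_nat_numeral)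
    also have "\<dots> \<noteq> 0" unfolding neg_equal_0_iff_equal of_nat_eq_0_iff by simp
    finally have qne: "?q c - ?q ?m \<noteq> 0" .
    \<comment> \<open>This operator kills \<open>?z\<close>, the last nonzero vector of the X-ladder
      of u, and so shortens the ladder, while it only rescales w by a nonzero factor.\<close>
    let ?C = "\<lambda>v. Casimir v - ?q ?m *s v"
    have Cw: "?C w = (?q c - ?q ?m) *s w"
      unfolding Casimir_highest[OF Suc.prems(5,6)] by (rule scale_left_diff_distrib[symmetric])
    have "?C w = 0"
    proof (rule Suc.IH[of "?C u"])
      show "?C u \<in> W" "?C w \<in> W"
        using Suc.prems Casimir_W subspace_diff[OF subspace_W] subspace_scale[OF subspace_W] by auto
      have "(X ^^ Suc j) (?C u) = Casimir ?z - ?q ?m *s ?z"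
        using lin_diff[OF funpow_lin[OF lin_X], of "Suc j"] lin_scale[OF funpow_lin[OF lin_X], of "Suc j"]
          Casimir_X_pow[of "Suc j"] by (simp only:)
      then show "(X ^^ Suc j) (?C u) = 0" using Casimir_highest[OF Xz hz] by simp
      have "h (?C u) = ?C (h u)" by (simp add: lins Casimir_h)
      also have "\<dots> = ?C (c *s u + w)" by (simp only: Suc.prems(3))
      also have "\<dots> = c *s ?C u + ?C w"
        by (simp add: lin_add[OF lin_Casimir] lin_scale[OF lin_Casimir] scale_right_distrib
            scale_right_diff_distrib mult.commute)
      finally show "h (?C u) = c *s ?C u + ?C w" .
      show "X (?C w) = 0" unfolding Cw by (simp add: lins Suc.prems)
      show "h (?C w) = c *s ?C w" unfolding Cw by (simp add: lins Suc.prems mult.commute)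
    qed
    then show False using Cw qne w0 by simp
  qed
qed

text \<open>The largest power of X that does not kill w carries the Jordan block to one whose
  eigenvector is killed by X.\<close>

lemma no_Jordan_block:
  assumes u: "u \<in> W" "h u = c *s u + w" and w: "h w = c *s w"
  shows "w = 0"
proof (rule ccontr)
  assume w0: "w \<noteq> 0"
  have "w = h u - c *s u" using u by simp
  then have wW: "w \<in> W" using u(1) h_W subspace_diff[OF subspace_W] subspace_scale[OF subspace_W] by metis
  note g = geneig_Jordan_block[OF u(2) w]
  have hX': "h (X v) = X (h v) + 2 *s X v" for v by (rule hX)
  obtain k where "(X ^^ k) w = 0" using ladder_nilpotent[OF lin_X X_W hX' _ wW g(2)] by auto
  then obtain i where i: "(X ^^ i) w \<noteq> 0" "(X ^^ Suc i) w = 0" using least_power w0 by metis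
  obtain m where m: "(X ^^ m) u = 0" using ladder_nilpotent[OF lin_X X_W hX' _ u(1) g(1)] by auto
  have inW: "(X ^^ i) v \<in> W" if "v \<in> W" for v by (induction i) (use that X_W in auto)
  have "(X ^^ Suc m) ((X ^^ i) u) = (X ^^ Suc i) ((X ^^ m) u)"
    by (metis add_Suc_shift add.commute comp_apply funpow_add)
  then have z: "(X ^^ Suc m) ((X ^^ i) u) = 0" using m lin_zero[OF funpow_lin[OF lin_X]] lin_zero[OF lin_X] by simp
  have "(X ^^ i) w = 0"
  proof (rule no_Jordan_block_X[OF inW[OF u(1)] z h_X_pow[OF u(2)] inW[OF wW]])
    show "X ((X ^^ i) w) = 0" using i by simp
    show "h ((X ^^ i) w) = (c + 2 * of_nat i) *s (X ^^ i) w"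
      using h_X_pow[of w c 0 i] w lin_zero[OF funpow_lin[OF lin_X]] by simp
  qed
  then show False using i by blast
qed

lemma geneig_eigen:
  assumes "v \<in> geneig h c" "v \<in> W" shows "h v = c *s v"
  using assms
proof (induction)
  case geneig_zero
  then show ?case by (simp add: lins)
next
  case (geneig_step v)
  let ?w = "h v - c *s v"
  have "?w \<in> W" using geneig_step.prems h_W subspace_diff[OF subspace_W] subspace_scale[OF subspace_W] by blast
  then have "h ?w = c *s ?w" by (rule geneig_step.IH)
  then have "?w = 0" using no_Jordan_block[OF geneig_step.prems, of c ?w] by simp
  then show ?case by simp
qed

end

section \<open>Diagonalization of representations\<close>

text \<open>The column vectors of dimension \<open>d\<close> are modelled by the functions on \<open>nat\<close> that vanish from index
  \<open>d\<close> on: unlike \<open>carrier_vec d\<close>, these live in a vector space that is a type.\<close>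

definition fscale :: "complex \<Rightarrow> (nat \<Rightarrow> complex) \<Rightarrow> nat \<Rightarrow> complex" where
  "fscale c f = (\<lambda>i. c * f i)"

interpretation fs: complex_vs fscale
  by unfold_locales (auto simp: fscale_def fun_eq_iff algebra_simps)

lemma fs_sum_apply: "(\<Sum>a\<in>A. f a) i = (\<Sum>a\<in>A. f a (i::nat) :: complex)"
  by (induction A rule: infinite_finite_induct) auto

definition mat_op :: "nat \<Rightarrow> complex mat \<Rightarrow> (nat \<Rightarrow> complex) \<Rightarrow> nat \<Rightarrow> complex" where
  "mat_op d A f = (\<lambda>i. if i < d then \<Sum>j<d. A $$ (i, j) * f j else 0)"

definition fvec :: "nat \<Rightarrow> (nat \<Rightarrow> complex) set" where
  "fvec d = {f. \<forall>i\<ge>d. f i = 0}"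

lemma mat_op_fvec: "mat_op d A f \<in> fvec d"
  by (simp add: mat_op_def fvec_def)

lemma lin_mat_op: "fs.lin (mat_op d A)"
  by (rule fs.linI) (auto simp: mat_op_def fscale_def fun_eq_iff algebra_simps sum.distrib sum_distrib_left)

lemma index_mult_carrier:
  assumes "A \<in> carrier_mat d d" "B \<in> carrier_mat d d" "i < d" "j < d"
  shows "(A * B) $$ (i, j) = (\<Sum>k<d. A $$ (i, k) * B $$ (k, j))"
  using assms by (simp add: scalar_prod_def lessThan_atLeast0)

lemma mat_op_mult:
  assumes "A \<in> carrier_mat d d" "B \<in> carrier_mat d d"
  shows "mat_op d (A * B) f = mat_op d A (mat_op d B f)"
proof
  fix i
  show "mat_op d (A * B) f i = mat_op d A (mat_op d B f) i"
  proof (cases "i < d")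
    case True
    have "(\<Sum>j<d. (A * B) $$ (i, j) * f j) = (\<Sum>j<d. \<Sum>k<d. A $$ (i, k) * (B $$ (k, j) * f j))"
      using True by (intro sum.cong refl) (simp add: index_mult_carrier[OF assms] sum_distrib_right mult.assoc)
    also have "\<dots> = (\<Sum>k<d. A $$ (i, k) * (\<Sum>j<d. B $$ (k, j) * f j))"
      by (subst sum.swap) (simp add: sum_distrib_left)
    finally show ?thesis using True by (simp add: mat_op_def)
  qed (simp add: mat_op_def)
qed

lemma mat_op_add:
  assumes "A \<in> carrier_mat d d" "B \<in> carrier_mat d d"
  shows "mat_op d (A + B) f = mat_op d A f + mat_op d B f"
  using assms by (auto simp: mat_op_def fun_eq_iff sum.distrib distrib_right)

lemma mat_op_minus:
  assumes "A \<in> carrier_mat d d" "B \<in> carrier_mat d d"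
  shows "mat_op d (A - B) f = mat_op d A f - mat_op d B f"
  using assms by (auto simp: mat_op_def fun_eq_iff sum_subtractf left_diff_distrib)

lemma mat_op_smult:
  assumes "A \<in> carrier_mat d d"
  shows "mat_op d (c \<cdot>\<^sub>m A) f = fscale c (mat_op d A f)"
  using assms by (auto simp: mat_op_def fscale_def fun_eq_iff sum_distrib_left mult.assoc)

definition funit :: "nat \<Rightarrow> nat \<Rightarrow> complex" where
  "funit i = (\<lambda>j. if j = i then 1 else 0)"

lemma fvec_expand: "f \<in> fvec d \<Longrightarrow> f = (\<Sum>i<d. fscale (f i) (funit i))"
proof
  fix j assume f: "f \<in> fvec d"
  have "(\<Sum>i<d. fscale (f i) (funit i)) j = (\<Sum>i<d. if j = i then f i else 0)"
    unfolding fs_sum_apply by (intro sum.cong refl) (auto simp: fscale_def funit_def)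
  also have "\<dots> = f j" using f by (auto simp: fvec_def)
  finally show "f j = (\<Sum>i<d. fscale (f i) (funit i)) j" by simp
qed

lemma inj_funit: "inj funit"
  by (rule injI) (metis funit_def zero_neq_one)

lemma subspace_fvec: "fs.subspace (fvec d)"
  by (auto simp: fs.subspace_def fvec_def fscale_def)

lemma fvec_basis:
  shows "fs.independent (funit ` {..<d})" "fs.span (funit ` {..<d}) = fvec d"
proof -
  show "fs.independent (funit ` {..<d})"
  proof (rule fs.independent_if_scalars_zero)
    fix f x assume s: "(\<Sum>x\<in>funit ` {..<d}. fscale (f x) x) = 0" and x: "x \<in> funit ` {..<d}"
    obtain i where i: "i < d" "x = funit i" using x by auto
    have "(\<Sum>x\<in>funit ` {..<d}. fscale (f x) x) = (\<Sum>k<d. fscale (f (funit k)) (funit k))"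
      by (rule sum.reindex_cong[OF inj_on_subset[OF inj_funit]]) auto
    then have "0 = (\<Sum>k<d. fscale (f (funit k)) (funit k)) i" using s by simp
    also have "\<dots> = (\<Sum>k<d. if i = k then f (funit k) else 0)"
      unfolding fs_sum_apply by (intro sum.cong refl) (auto simp: fscale_def funit_def)
    also have "\<dots> = f x" using i by simp
    finally show "f x = 0" by simp
  qed simp
  show "fs.span (funit ` {..<d}) = fvec d"
  proof
    show "fs.span (funit ` {..<d}) \<subseteq> fvec d"
      by (rule fs.span_minimal[OF _ subspace_fvec]) (auto simp: fvec_def funit_def)
    show "fvec d \<subseteq> fs.span (funit ` {..<d})"
    proof
      fix f assume "f \<in> fvec d"
      then have "f = (\<Sum>i<d. fscale (f i) (funit i))" by (rule fvec_expand)
      moreover have "\<dots> \<in> fs.span (funit ` {..<d})"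
        by (intro fs.span_sum fs.span_scale fs.span_base) auto
      ultimately show "f \<in> fs.span (funit ` {..<d})" by simp
    qed
  qed
qed

lemma fin_fvec: "fs.fin (fvec d)"
  using fs.fin_span[of "funit ` {..<d}"] fvec_basis(2) by simp

lemma dim_fvec: "fs.dim (fvec d) = d"
  using fs.dim_span_eq_card_independent[OF fvec_basis(1)] fvec_basis(2)
  by (simp add: card_image inj_on_subset[OF inj_funit])

lemma lie_rep_carrier: "lie_rep sc br d phi \<Longrightarrow> phi x \<in> carrier_mat d d"
  and lie_rep_add: "lie_rep sc br d phi \<Longrightarrow> phi (x + y) = phi x + phi y"
  and lie_rep_scale: "lie_rep sc br d phi \<Longrightarrow> phi (sc a x) = a \<cdot>\<^sub>m phi x"
  and lie_rep_br: "lie_rep sc br d phi \<Longrightarrow> phi (br x y) = phi x * phi y - phi y * phi x"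
  by (auto simp: lie_rep_def)

context
  fixes sc :: "complex \<Rightarrow> 'g::ab_group_add \<Rightarrow> 'g" and br d phi
  assumes rep: "lie_rep sc br d phi"
begin

lemma rep_op_br: "mat_op d (phi (br x y)) f = mat_op d (phi x) (mat_op d (phi y) f) - mat_op d (phi y) (mat_op d (phi x) f)"
  unfolding lie_rep_br[OF rep] using lie_rep_carrier[OF rep]
  by (subst mat_op_minus) (auto simp: mat_op_mult intro: mult_carrier_mat)

lemma rep_op_add: "mat_op d (phi (x + y)) f = mat_op d (phi x) f + mat_op d (phi y) f"
  unfolding lie_rep_add[OF rep] using lie_rep_carrier[OF rep] by (auto simp: mat_op_add)

lemma rep_op_scale: "mat_op d (phi (sc c x)) f = fscale c (mat_op d (phi x) f)"
  unfolding lie_rep_scale[OF rep] using lie_rep_carrier[OF rep] by (auto simp: mat_op_smult)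

end

context cartan_simple begin

text \<open>For coroots this is the absence of Jordan blocks in the sl2-action. Since the coroots
  span \<open>H\<close>, v is an eigenvector of every t in \<open>H\<close>; the eigenvalue must be
  l t, because a nonzero v cannot be an eigenvector for one value and a generalized eigenvector for
  another.\<close>

lemma rep_joint_eigen:
  assumes rep: "lie_rep scale br d phi"
    and v: "v \<in> fvec d" "\<And>t. t \<in> H \<Longrightarrow> v \<in> fs.geneig (mat_op d (phi t)) (l t)"
    and t: "t \<in> H"
  shows "mat_op d (phi t) v = fscale (l t) v"
proof -
  have 0: "mat_op d (phi 0) v = 0"
    using rep_op_scale[OF rep, of 0 0 v] by (simp add: fscale_def fun_eq_iff)
  have cor: "mat_op d (phi (cor a)) v = fscale (l (cor a)) v" if a: "a \<in> Phi" for a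
  proof -
    obtain x y where xy: "br (cor a) x = 2 *s x" "br (cor a) y = (- 2) *s y" "br x y = cor a"
      by (rule coroot_sl2[OF a])
    interpret sl: sl2_action fscale "mat_op d (phi x)" "mat_op d (phi y)" "mat_op d (phi (cor a))" "fvec d"
    proof
      fix v
      show "mat_op d (phi (cor a)) (mat_op d (phi x) v) = mat_op d (phi x) (mat_op d (phi (cor a)) v) + fscale 2 (mat_op d (phi x) v)"
        using rep_op_br[OF rep, of "cor a" x v] rep_op_scale[OF rep, of 2 x v] xy(1) by (simp add: algebra_simps)
      show "mat_op d (phi (cor a)) (mat_op d (phi y) v) = mat_op d (phi y) (mat_op d (phi (cor a)) v) - fscale 2 (mat_op d (phi y) v)"
        using rep_op_br[OF rep, of "cor a" y v] rep_op_scale[OF rep, of "- 2" y v] xy(2) by (simp add: algebra_simps)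
      show "mat_op d (phi x) (mat_op d (phi y) v) = mat_op d (phi y) (mat_op d (phi x) v) + mat_op d (phi (cor a)) v"
        using rep_op_br[OF rep, of x y v] xy(3) by simp
    qed (simp_all add: fs.lin_add[OF lin_mat_op] fs.lin_scale[OF lin_mat_op] mat_op_fvec fin_fvec)
    show ?thesis by (rule sl.geneig_eigen[OF v(2)[OF coroot_H[OF a]] v(1)])
  qed
  have "\<exists>c. mat_op d (phi s) v = fscale c v" if "s \<in> span (cor ` Phi)" for s
    using that
  proof (induction rule: span_induct_alt)
    case base
    show ?case using 0 by (intro exI[of _ 0]) (simp add: fscale_def fun_eq_iff)
  next
    case (step c x y)
    then obtain a b where ab: "mat_op d (phi x) v = fscale a v" "mat_op d (phi y) v = fscale b v"
      using cor by blast
    have "mat_op d (phi (c *s x + y)) v = fscale (c * a + b) v"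
      unfolding rep_op_add[OF rep] rep_op_scale[OF rep] ab by (simp add: fscale_def fun_eq_iff algebra_simps)
    then show ?case by blast
  qed
  then obtain c where c: "mat_op d (phi t) v = fscale c v" using t H_coroots by blast
  show ?thesis
  proof (cases "c = l t")
    case False
    then have "v = 0" using fs.geneig_eigenvector[OF lin_mat_op v(2)[OF t] c] by simp
    then show ?thesis using c by (simp add: fscale_def fun_eq_iff)
  qed (use c in simp)
qed

text \<open>The weight spaces span, so a basis can be selected from their union. Linearity of
  \<open>lam j\<close> is read off from the linearity of the action on the nonzero vector
  \<open>b j\<close>.\<close>

lemma rep_eigenbasis:
  assumes rep: "lie_rep scale br d phi"
  obtains b lam where "fs.independent (b ` {..<d})" "inj_on b {..<d}" "fs.span (b ` {..<d}) = fvec d"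
    "\<And>j. j < d \<Longrightarrow> h_functional scale H (lam j)"
    "\<And>j t. j < d \<Longrightarrow> t \<in> H \<Longrightarrow> mat_op d (phi t) (b j) = fscale (lam j t) (b j)"
proof -
  let ?R = "\<lambda>t. mat_op d (phi t)"
  interpret F: operator_family fscale H ?R
  proof
    fix s t v \<mu> assume st: "s \<in> H" "t \<in> H" and v: "v \<in> fs.geneig (?R t) \<mu>"
    have "?R s (?R t w) = ?R t (?R s w)" for w
    proof -
      have "?R 0 w = 0" using rep_op_scale[OF rep, of 0 0 w] by (simp add: fscale_def fun_eq_iff)
      then show ?thesis using rep_op_br[OF rep, of s t w] H_abelian[OF st] by simp
    qed
    then show "?R s v \<in> fs.geneig (?R t) \<mu>"
      using fs.geneig_commuting[OF lin_mat_op _ v] by blast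
  qed (simp_all add: fs.lin_add[OF lin_mat_op] fs.lin_scale[OF lin_mat_op])
  define S where "S = (\<Union>l\<in>F.canon. fvec d \<inter> F.wt l)"
  have S: "fvec d \<subseteq> fs.span S" unfolding S_def by (rule F.wt_span[OF fin_fvec mat_op_fvec])
  obtain B where B: "B \<subseteq> S" "fs.independent B" "S \<subseteq> fs.span B"
    using fs.maximal_independent_subset by metis
  have sB: "fs.span B = fvec d"
  proof
    show "fs.span B \<subseteq> fvec d"
      by (rule fs.span_minimal[OF _ subspace_fvec]) (use B(1) S_def in auto)
    show "fvec d \<subseteq> fs.span B"
      using S fs.span_minimal[OF B(3) fs.subspace_span] by blast
  qed
  then have "B \<subseteq> fvec d" using fs.span_superset by blast
  then have fB: "finite B" using fs.fin_independent[OF fin_fvec B(2)] by blast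
  have "card B = d" using fs.dim_span_eq_card_independent[OF B(2)] sB dim_fvec by simp
  then obtain b where b: "bij_betw b {..<d} B"
    using ex_bij_betw_nat_finite[OF fB] by (metis lessThan_atLeast0)
  then have bB: "b ` {..<d} = B" "inj_on b {..<d}" by (auto simp: bij_betw_def)
  have "\<forall>j<d. \<exists>l. l \<in> F.canon \<and> b j \<in> F.wt l"
  proof (intro allI impI)
    fix j assume "j < d"
    then have "b j \<in> S" using bB(1) B(1) by blast
    then show "\<exists>l. l \<in> F.canon \<and> b j \<in> F.wt l" unfolding S_def by blast
  qed
  then obtain lam where lam: "\<And>j. j < d \<Longrightarrow> lam j \<in> F.canon \<and> b j \<in> F.wt (lam j)" by metis
  have bd: "b j \<in> fvec d" "b j \<noteq> 0" if "j < d" for j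
    using that bB(1) \<open>B \<subseteq> fvec d\<close> B(2) fs.dependent_zero by auto
  have e: "?R t (b j) = fscale (lam j t) (b j)" if "j < d" "t \<in> H" for j t
    by (rule rep_joint_eigen[OF rep bd(1)[OF that(1)] _ that(2)]) (use lam[OF that(1)] in \<open>auto simp: F.wt_def\<close>)
  have hf: "h_functional scale H (lam j)" if j: "j < d" for j
  proof -
    have c: "x = y" if "fscale x (b j) = fscale y (b j)" for x y
      using that bd(2)[OF j] fs.scale_cancel_right by blast
    show ?thesis unfolding h_functional_def
    proof (intro conjI ballI allI impI)
      fix x y assume xy: "x \<in> H" "y \<in> H"
      show "lam j (x + y) = lam j x + lam j y"
        by (rule c) (use rep_op_add[OF rep, of x y "b j"] e j xy subspace_add[OF subspace_H xy]
          in \<open>simp add: fs.scale_left_distrib\<close>)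
    next
      fix a x assume x: "x \<in> H"
      show "lam j (a *s x) = a * lam j x"
        by (rule c) (use rep_op_scale[OF rep, of a x "b j"] e j x subspace_scale[OF subspace_H x] in simp)
    next
      fix x assume "x \<notin> H"
      then show "lam j x = 0" using lam[OF j] by (auto simp: F.canon_def)
    qed
  qed
  show ?thesis by (rule that[of b lam]) (use B bB sB hf e in auto)
qed

lemma rep_diagonal:
  assumes rep: "lie_rep scale br d phi"
  obtains P Q lam where "P \<in> carrier_mat d d" "Q \<in> carrier_mat d d" "P * Q = 1\<^sub>m d" "Q * P = 1\<^sub>m d"
    "\<And>j. j < d \<Longrightarrow> h_functional scale H (lam j)"
    "\<And>t. t \<in> H \<Longrightarrow> phi t = P * mat_diag d (\<lambda>j. lam j t) * Q"
proof -
  obtain b lam where b: "fs.independent (b ` {..<d})" "inj_on b {..<d}" "fs.span (b ` {..<d}) = fvec d"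
    and hf: "\<And>j. j < d \<Longrightarrow> h_functional scale H (lam j)"
    and e: "\<And>j t. j < d \<Longrightarrow> t \<in> H \<Longrightarrow> mat_op d (phi t) (b j) = fscale (lam j t) (b j)"
    using rep_eigenbasis[OF rep] by metis
  define P where "P = mat d d (\<lambda>(i, j). b j i)"
  define Q where "Q = mat d d (\<lambda>(j, i). fs.representation (b ` {..<d}) (funit i) (b j))"
  have PQc: "P \<in> carrier_mat d d" "Q \<in> carrier_mat d d" by (simp_all add: P_def Q_def)
  have PQ: "P * Q = 1\<^sub>m d"
  proof (rule eq_matI)
    fix k i assume "k < dim_row (1\<^sub>m d :: complex mat)" "i < dim_col (1\<^sub>m d :: complex mat)"
    then have ki: "k < d" "i < d" by auto
    have "funit i \<in> fs.span (b ` {..<d})" using ki unfolding b(3) by (simp add: fvec_def funit_def)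
    then have "funit i = (\<Sum>x\<in>b ` {..<d}. fscale (fs.representation (b ` {..<d}) (funit i) x) x)"
      using fs.rep_sum[OF _ b(1)] by simp
    also have "\<dots> = (\<Sum>j<d. fscale (fs.representation (b ` {..<d}) (funit i) (b j)) (b j))"
      by (rule sum.reindex_cong[OF b(2)]) auto
    finally have "funit i k = (\<Sum>j<d. fscale (fs.representation (b ` {..<d}) (funit i) (b j)) (b j)) k" by simp
    then show "(P * Q) $$ (k, i) = 1\<^sub>m d $$ (k, i)"
      using ki unfolding fs_sum_apply index_mult_carrier[OF PQc ki]
      by (simp add: P_def Q_def fscale_def funit_def mult.commute)
  qed (use PQc in auto)
  have QP: "Q * P = 1\<^sub>m d" by (rule mat_mult_left_right_inverse[OF PQc PQ])
  have "phi t = P * mat_diag d (\<lambda>j. lam j t) * Q" if t: "t \<in> H" for t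
  proof -
    note c = lie_rep_carrier[OF rep, of t]
    have "phi t * P = P * mat_diag d (\<lambda>j. lam j t)"
    proof (rule eq_matI)
      fix i j assume "i < dim_row (P * mat_diag d (\<lambda>j. lam j t))" "j < dim_col (P * mat_diag d (\<lambda>j. lam j t))"
      then have ij: "i < d" "j < d" using PQc by (auto simp: mat_diag_def)
      have "(phi t * P) $$ (i, j) = mat_op d (phi t) (b j) i"
        unfolding index_mult_carrier[OF c PQc(1) ij] using ij by (simp add: mat_op_def P_def)
      also have "\<dots> = lam j t * b j i" using e[OF ij(2) t] by (simp add: fscale_def)
      also have "\<dots> = (P * mat_diag d (\<lambda>j. lam j t)) $$ (i, j)"
        unfolding mat_diag_mult_right[OF PQc(1)] using ij by (simp add: P_def)
      finally show "(phi t * P) $$ (i, j) = (P * mat_diag d (\<lambda>j. lam j t)) $$ (i, j)" .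
    qed (use c PQc in \<open>auto simp: mat_diag_def\<close>)
    then have "P * mat_diag d (\<lambda>j. lam j t) * Q = phi t * P * Q" by simp
    also have "\<dots> = phi t" using assoc_mult_mat[OF c PQc] PQ c by simp
    finally show ?thesis by simp
  qed
  then show ?thesis using that PQc PQ QP hf by blast
qed

end

section \<open>Kronecker products and diagonalizable matrices\<close>

definition kron :: "nat \<Rightarrow> nat \<Rightarrow> complex mat \<Rightarrow> complex mat \<Rightarrow> complex mat" where
  "kron d e A B = mat (d * e) (d * e) (\<lambda>(i, j). A $$ (i div e, j div e) * B $$ (i mod e, j mod e))"

lemma kron_carrier [simp]: "kron d e A B \<in> carrier_mat (d * e) (d * e)"
  by (simp add: kron_def)

lemma div_mod_less: "i < d * e \<Longrightarrow> i div e < d \<and> i mod e < (e::nat)"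
  by (cases "e = 0") (auto simp: less_mult_imp_div_less)

lemma sum_div_mod: "(\<Sum>k<d * e. F (k div e) (k mod e)) = (\<Sum>a<d. \<Sum>b<e. F a (b::nat) :: 'a::comm_monoid_add)"
proof -
  have "(\<Sum>k<d * e. F (k div e) (k mod e)) = (\<Sum>a<d. \<Sum>k\<in>{a * e..<a * e + e}. F (k div e) (k mod e))"
    by (rule sum.nat_group[symmetric])
  also have "\<dots> = (\<Sum>a<d. \<Sum>b<e. F ((b + a * e) div e) ((b + a * e) mod e))"
  proof (rule sum.cong)
    fix a
    show "sum (\<lambda>k. F (k div e) (k mod e)) {a * e..<a * e + e} = sum (\<lambda>b. F ((b + a * e) div e) ((b + a * e) mod e)) {..<e}"
      using sum.shift_bounds_nat_ivl[of "\<lambda>k. F (k div e) (k mod e)" 0 "a * e" e]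
      by (simp add: lessThan_atLeast0 add.commute)
  qed simp
  also have "\<dots> = (\<Sum>a<d. \<Sum>b<e. F a b)"
    by (intro sum.cong refl) auto
  finally show ?thesis .
qed

lemma prod_div_mod: "(\<Prod>k<d * e. F (k div e) (k mod e)) = (\<Prod>a<d. \<Prod>b<e. F a (b::nat) :: 'a::comm_monoid_mult)"
proof -
  have "(\<Prod>k<d * e. F (k div e) (k mod e)) = (\<Prod>a<d. \<Prod>k\<in>{a * e..<a * e + e}. F (k div e) (k mod e))"
    by (rule prod.nat_group[symmetric])
  also have "\<dots> = (\<Prod>a<d. \<Prod>b<e. F ((b + a * e) div e) ((b + a * e) mod e))"
  proof (rule prod.cong)
    fix a
    show "prod (\<lambda>k. F (k div e) (k mod e)) {a * e..<a * e + e} = prod (\<lambda>b. F ((b + a * e) div e) ((b + a * e) mod e)) {..<e}"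
      using prod.shift_bounds_nat_ivl[of "\<lambda>k. F (k div e) (k mod e)" 0 "a * e" e]
      by (simp add: lessThan_atLeast0 add.commute)
  qed simp
  also have "\<dots> = (\<Prod>a<d. \<Prod>b<e. F a b)"
    by (intro prod.cong refl) auto
  finally show ?thesis .
qed

lemma kron_mult:
  assumes "A \<in> carrier_mat d d" "C \<in> carrier_mat d d" "B \<in> carrier_mat e e" "D \<in> carrier_mat e e"
  shows "kron d e A B * kron d e C D = kron d e (A * C) (B * D)"
proof (rule eq_matI)
  fix i j assume "i < dim_row (kron d e (A * C) (B * D))" "j < dim_col (kron d e (A * C) (B * D))"
  then have ij: "i < d * e" "j < d * e" by (auto simp: kron_def)
  note dm = div_mod_less[OF ij(1)] div_mod_less[OF ij(2)]
  have "(kron d e A B * kron d e C D) $$ (i, j)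
      = (\<Sum>k<d * e. A $$ (i div e, k div e) * B $$ (i mod e, k mod e) * (C $$ (k div e, j div e) * D $$ (k mod e, j mod e)))"
    unfolding index_mult_carrier[OF kron_carrier kron_carrier ij] by (rule sum.cong) (simp_all add: kron_def ij)
  also have "\<dots> = (\<Sum>a<d. \<Sum>b<e. A $$ (i div e, a) * B $$ (i mod e, b) * (C $$ (a, j div e) * D $$ (b, j mod e)))"
    by (rule sum_div_mod[where F = "\<lambda>a b. A $$ (i div e, a) * B $$ (i mod e, b) * (C $$ (a, j div e) * D $$ (b, j mod e))"])
  also have "\<dots> = (\<Sum>a<d. A $$ (i div e, a) * C $$ (a, j div e)) * (\<Sum>b<e. B $$ (i mod e, b) * D $$ (b, j mod e))"
    by (simp add: sum_product mult_ac)
  also have "\<dots> = kron d e (A * C) (B * D) $$ (i, j)"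
    using ij dm by (simp add: kron_def index_mult_carrier[OF assms(1,2)] index_mult_carrier[OF assms(3,4)] del: index_mult_mat)
  finally show "(kron d e A B * kron d e C D) $$ (i, j) = kron d e (A * C) (B * D) $$ (i, j)" .
qed (auto simp: kron_def)

lemma kron_one: "kron d e (1\<^sub>m d) (1\<^sub>m e) = 1\<^sub>m (d * e)"
proof (rule eq_matI)
  fix i j assume "i < dim_row (1\<^sub>m (d * e) :: complex mat)" "j < dim_col (1\<^sub>m (d * e) :: complex mat)"
  then have ij: "i < d * e" "j < d * e" by auto
  have "i = j" if "i div e = j div e" "i mod e = j mod e" using that by (metis div_mult_mod_eq)
  then show "kron d e (1\<^sub>m d) (1\<^sub>m e) $$ (i, j) = 1\<^sub>m (d * e) $$ (i, j)"
    using ij div_mod_less[OF ij(1)] div_mod_less[OF ij(2)] by (auto simp: kron_def)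
qed (auto simp: kron_def)

definition tensor_rep :: "nat \<Rightarrow> ('g \<Rightarrow> complex mat) \<Rightarrow> nat \<Rightarrow> ('g \<Rightarrow> complex mat) \<Rightarrow> 'g \<Rightarrow> complex mat" where
  "tensor_rep d phi e psi x = kron d e (phi x) (1\<^sub>m e) + kron d e (1\<^sub>m d) (psi x)"

lemma mat_distrib:
  assumes "A \<in> carrier_mat n n" "B \<in> carrier_mat n n" "C \<in> carrier_mat n n" "D \<in> carrier_mat n n"
  shows "(A + B) * (C + D) = (A * C + A * D) + (B * C + B * D)"
  using add_mult_distrib_mat[OF assms(1,2) add_carrier_mat[OF assms(4), of C]]
    mult_add_distrib_mat[OF assms(1,3,4)] mult_add_distrib_mat[OF assms(2,3,4)] by simp

text \<open>The mixed terms of A with B' and of A' with B occur in both products and cancel.\<close>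

lemma tensor_commutator:
  assumes A: "A \<in> carrier_mat d d" "A' \<in> carrier_mat d d" and B: "B \<in> carrier_mat e e" "B' \<in> carrier_mat e e"
  defines "T \<equiv> \<lambda>A B. kron d e A (1\<^sub>m e) + kron d e (1\<^sub>m d) B"
  shows "T (A * A' - A' * A) (B * B' - B' * B) = T A B * T A' B' - T A' B' * T A B"
proof -
  have e: "T A B * T A' B' = (kron d e (A * A') (1\<^sub>m e) + kron d e A B') + (kron d e A' B + kron d e (1\<^sub>m d) (B * B'))"
    if "A \<in> carrier_mat d d" "A' \<in> carrier_mat d d" "B \<in> carrier_mat e e" "B' \<in> carrier_mat e e" for A A' B B'
    unfolding T_def mat_distrib[OF kron_carrier kron_carrier kron_carrier kron_carrier] using that
    by (simp add: kron_mult)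
  show ?thesis unfolding e[OF A B] e[OF A(2,1) B(2,1)] unfolding T_def
  proof (rule eq_matI)
    fix i j
    assume "i < dim_row (kron d e (A * A') (1\<^sub>m e) + kron d e A B' + (kron d e A' B + kron d e (1\<^sub>m d) (B * B')) -
        (kron d e (A' * A) (1\<^sub>m e) + kron d e A' B + (kron d e A B' + kron d e (1\<^sub>m d) (B' * B))))"
      "j < dim_col (kron d e (A * A') (1\<^sub>m e) + kron d e A B' + (kron d e A' B + kron d e (1\<^sub>m d) (B * B')) -
        (kron d e (A' * A) (1\<^sub>m e) + kron d e A' B + (kron d e A B' + kron d e (1\<^sub>m d) (B' * B))))"
    then have ij: "i < d * e" "j < d * e" by (auto simp: kron_def)
    note dm = div_mod_less[OF ij(1)] div_mod_less[OF ij(2)]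
    have m: "(A * A' - A' * A) $$ (i div e, j div e) = (A * A') $$ (i div e, j div e) - (A' * A) $$ (i div e, j div e)"
      "(B * B' - B' * B) $$ (i mod e, j mod e) = (B * B') $$ (i mod e, j mod e) - (B' * B) $$ (i mod e, j mod e)"
      using A B dm by (auto simp del: index_mult_mat(1))
    show "(kron d e (A * A' - A' * A) (1\<^sub>m e) + kron d e (1\<^sub>m d) (B * B' - B' * B)) $$ (i, j) =
      (kron d e (A * A') (1\<^sub>m e) + kron d e A B' + (kron d e A' B + kron d e (1\<^sub>m d) (B * B')) -
        (kron d e (A' * A) (1\<^sub>m e) + kron d e A' B + (kron d e A B' + kron d e (1\<^sub>m d) (B' * B)))) $$ (i, j)"
      using ij dm by (simp add: kron_def m algebra_simps del: index_mult_mat(1) index_minus_mat(1))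
        (simp add: kron_def m algebra_simps del: index_mult_mat(1))
  qed (auto simp: kron_def)
qed

lemma lie_rep_tensor:
  assumes phi: "lie_rep sc br d phi" and psi: "lie_rep sc br e psi"
  shows "lie_rep sc br (d * e) (tensor_rep d phi e psi)"
  unfolding lie_rep_def
proof (intro conjI allI)
  note c = lie_rep_carrier[OF phi] lie_rep_carrier[OF psi]
  show "tensor_rep d phi e psi x \<in> carrier_mat (d * e) (d * e)" for x
    unfolding tensor_rep_def by (intro add_carrier_mat) simp
  show "tensor_rep d phi e psi (x + y) = tensor_rep d phi e psi x + tensor_rep d phi e psi y" for x y
    unfolding tensor_rep_def lie_rep_add[OF phi] lie_rep_add[OF psi]
  proof (rule eq_matI, goal_cases)
    case (1 i j)
    then have ij: "i < d * e" "j < d * e" by (auto simp: kron_def)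
    show ?case using ij div_mod_less[OF ij(1)] div_mod_less[OF ij(2)] c[of x] c[of y]
      by (simp add: kron_def algebra_simps)
  qed (auto simp: kron_def)
  show "tensor_rep d phi e psi (sc a x) = a \<cdot>\<^sub>m tensor_rep d phi e psi x" for a x
    unfolding tensor_rep_def lie_rep_scale[OF phi] lie_rep_scale[OF psi]
  proof (rule eq_matI, goal_cases)
    case (1 i j)
    then have ij: "i < d * e" "j < d * e" by (auto simp: kron_def)
    show ?case using ij div_mod_less[OF ij(1)] div_mod_less[OF ij(2)] c[of x]
      by (simp add: kron_def algebra_simps)
  qed (auto simp: kron_def)
  show "tensor_rep d phi e psi (br x y) =
      tensor_rep d phi e psi x * tensor_rep d phi e psi y - tensor_rep d phi e psi y * tensor_rep d phi e psi x" for x y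
    unfolding tensor_rep_def lie_rep_br[OF phi] lie_rep_br[OF psi]
    by (rule tensor_commutator) (rule c)+
qed

section \<open>Diagonalizable matrices: kernels, eigenvectors, determinants\<close>

lemma mat_diag_jordan_matrix:
  "mat_diag (length xs) (\<lambda>j. xs ! j) = jordan_matrix (map (\<lambda>x. (1, x :: complex)) xs)"
proof (induction xs)
  case Nil
  show ?case by (rule eq_matI) (auto simp: mat_diag_def jordan_matrix_def)
next
  case (Cons x xs)
  let ?J = "jordan_matrix (map (\<lambda>x. (1, x)) xs)"
  have J: "?J \<in> carrier_mat (length xs) (length xs)" unfolding Cons[symmetric] by simp
  have "jordan_matrix (map (\<lambda>x. (1, x)) (x # xs)) =
      four_block_mat (jordan_block 1 x) (0\<^sub>m 1 (length xs)) (0\<^sub>m (length xs) 1) ?J"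
    unfolding jordan_matrix_def using J by (simp add: Let_def jordan_matrix_def)
  also have "\<dots> = four_block_mat (jordan_block 1 x) (0\<^sub>m 1 (length xs)) (0\<^sub>m (length xs) 1)
      (mat_diag (length xs) (\<lambda>j. xs ! j))" unfolding Cons ..
  also have "\<dots> = mat_diag (length (x # xs)) (\<lambda>j. (x # xs) ! j)"
    by (rule eq_matI) (auto simp: mat_diag_def jordan_block_def nth_Cons')
  finally show ?case by simp
qed

text \<open>A diagonal matrix is a Jordan matrix with blocks of size one, and the dimension of a
  generalized eigenspace is invariant under similarity. Eigenvalue 0 with exponent 1 gives the
  kernel.\<close>

lemma kernel_dim_conj_diag:
  assumes P: "P \<in> carrier_mat d d" "Q \<in> carrier_mat d d" "P * Q = 1\<^sub>m d" "Q * P = 1\<^sub>m d"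
  shows "kernel_dim (P * mat_diag d f * Q) = card {j. j < d \<and> f j = (0::complex)}"
proof -
  let ?M = "P * mat_diag d f * Q" and ?xs = "map f [0..<d]"
  have M: "?M \<in> carrier_mat d d" using P by auto
  have xs: "mat_diag d f = jordan_matrix (map (\<lambda>x. (1, x)) ?xs)"
    unfolding mat_diag_jordan_matrix[symmetric] by (rule eq_matI) (auto simp: mat_diag_def)
  have "similar_mat_wit ?M (mat_diag d f) P Q"
    unfolding similar_mat_wit_def Let_def using P M by auto
  then have "similar_mat ?M (mat_diag d f)" unfolding similar_mat_def by blast
  then have "dim_gen_eigenspace ?M 0 1 = dim_gen_eigenspace (mat_diag d f) 0 1"
    using dim_gen_eigenspace_similar by metis
  also have "\<dots> = (\<Sum>n\<leftarrow>map fst [(n, e)\<leftarrow>map (\<lambda>x. (1, x)) ?xs. e = 0]. min 1 n)"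
    unfolding xs by (rule dim_gen_eigenspace_jordan_matrix)
  also have "\<dots> = length (filter (\<lambda>x. x = 0) ?xs)"
  proof -
    have "(\<Sum>n\<leftarrow>map fst [(n, e)\<leftarrow>map (\<lambda>x. (1, x)) xs. e = 0]. min 1 n) = length (filter (\<lambda>x. x = (0::complex)) xs)" for xs
      by (induction xs) auto
    then show ?thesis .
  qed
  also have "\<dots> = card {j. j < d \<and> f j = 0}"
    unfolding length_filter_conv_card by (rule arg_cong[where f = card]) auto
  finally have "dim_gen_eigenspace ?M 0 1 = card {j. j < d \<and> f j = 0}" .
  moreover have "char_matrix A 0 ^\<^sub>m 1 = A" if A: "A \<in> carrier_mat d d" for A :: "complex mat"
  proof -
    have "char_matrix A 0 = A" unfolding char_matrix_def by (rule eq_matI) (use A in auto)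
    then show ?thesis using A by simp
  qed
  note this[OF M]
  ultimately show ?thesis by (simp add: dim_gen_eigenspace_def)
qed

lemma conj_diag_eigen:
  fixes f :: "nat \<Rightarrow> complex"
  assumes P: "P \<in> carrier_mat d d" "Q \<in> carrier_mat d d" "P * Q = 1\<^sub>m d" "Q * P = 1\<^sub>m d"
    and v: "v \<in> carrier_vec d"
  shows "(P * mat_diag d f * Q) *\<^sub>v v = c \<cdot>\<^sub>v v \<longleftrightarrow> (\<forall>j<d. f j * (Q *\<^sub>v v) $ j = c * (Q *\<^sub>v v) $ j)"
proof -
  let ?w = "Q *\<^sub>v v" and ?D = "mat_diag d f"
  have w: "?w \<in> carrier_vec d" using P v by auto
  have Dw: "?D *\<^sub>v ?w \<in> carrier_vec d" by (rule mult_mat_vec_carrier[OF mat_diag_dim w])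
  have e: "(P * ?D * Q) *\<^sub>v v = P *\<^sub>v (?D *\<^sub>v ?w)"
    using P v w by (simp add: assoc_mult_mat_vec[of _ d d _ d])
  have "P *\<^sub>v (?D *\<^sub>v ?w) = c \<cdot>\<^sub>v v \<longleftrightarrow> ?D *\<^sub>v ?w = c \<cdot>\<^sub>v ?w"
  proof
    assume "P *\<^sub>v (?D *\<^sub>v ?w) = c \<cdot>\<^sub>v v"
    then have "Q *\<^sub>v (P *\<^sub>v (?D *\<^sub>v ?w)) = Q *\<^sub>v (c \<cdot>\<^sub>v v)" by simp
    moreover have "Q *\<^sub>v (P *\<^sub>v (?D *\<^sub>v ?w)) = (Q * P) *\<^sub>v (?D *\<^sub>v ?w)"
      by (rule assoc_mult_mat_vec[symmetric, OF P(2,1) Dw])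
    ultimately show "?D *\<^sub>v ?w = c \<cdot>\<^sub>v ?w" using P Dw v by (simp add: mult_mat_vec[OF P(2) v])
  next
    assume "?D *\<^sub>v ?w = c \<cdot>\<^sub>v ?w"
    then have "P *\<^sub>v (?D *\<^sub>v ?w) = c \<cdot>\<^sub>v (P *\<^sub>v ?w)" by (simp add: mult_mat_vec[OF P(1) w])
    also have "P *\<^sub>v ?w = (P * Q) *\<^sub>v v" by (rule assoc_mult_mat_vec[symmetric, OF P(1,2) v])
    finally show "P *\<^sub>v (?D *\<^sub>v ?w) = c \<cdot>\<^sub>v v" using P v by simp
  qed
  also have "\<dots> \<longleftrightarrow> (\<forall>j<d. f j * ?w $ j = c * ?w $ j)"
  proof -
    have j: "(?D *\<^sub>v ?w) $ j = f j * ?w $ j" if "j < d" for j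
    proof -
      have "(?D *\<^sub>v ?w) $ j = (\<Sum>i = 0..<d. (if j = i then f i else 0) * ?w $ i)"
        using that w P by (simp add: mat_diag_def scalar_prod_def)
      also have "\<dots> = (\<Sum>i = 0..<d. if j = i then f i * ?w $ i else 0)" by (intro sum.cong) auto
      finally show ?thesis using that by simp
    qed
    show ?thesis
    proof
      assume "?D *\<^sub>v ?w = c \<cdot>\<^sub>v ?w"
      then show "\<forall>j<d. f j * ?w $ j = c * ?w $ j" using j w P by (metis carrier_vecD index_smult_vec(1))
    next
      assume a: "\<forall>j<d. f j * ?w $ j = c * ?w $ j"
      show "?D *\<^sub>v ?w = c \<cdot>\<^sub>v ?w"
      proof (rule eq_vecI)
        fix i assume "i < dim_vec (c \<cdot>\<^sub>v ?w)"
        then have i: "i < d" "i < dim_vec ?w" using carrier_vecD[OF w] by simp_all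
        then show "(?D *\<^sub>v ?w) $ i = (c \<cdot>\<^sub>v ?w) $ i"
          using j[OF i(1)] a[rule_format, OF i(1)] index_smult_vec(1)[OF i(2), of c] by (simp only:)
      qed (use carrier_vecD[OF w] carrier_vecD[OF Dw] in \<open>simp only: index_smult_vec(2)\<close>)
    qed
  qed
  finally show ?thesis unfolding e .
qed

lemma det_conj_diag:
  assumes P: "P \<in> carrier_mat d d" "Q \<in> carrier_mat d d" "P * Q = 1\<^sub>m d"
  shows "det (c \<cdot>\<^sub>m 1\<^sub>m d + P * mat_diag d f * Q) = (\<Prod>j<d. c + f j :: complex)"
proof -
  let ?C = "c \<cdot>\<^sub>m 1\<^sub>m d :: complex mat" and ?D = "mat_diag d f"
  have C: "?C \<in> carrier_mat d d" "?D \<in> carrier_mat d d" by simp_all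
  have "P * ?C * Q = ?C"
    using mult_smult_distrib[OF P(1) one_carrier_mat, of c] mult_smult_assoc_mat[OF P(1,2), of c] P by simp
  then have "?C + P * ?D * Q = P * ?C * Q + P * ?D * Q" by simp
  also have "\<dots> = P * (?C + ?D) * Q"
    using mult_add_distrib_mat[OF P(1) C] add_mult_distrib_mat[OF mult_carrier_mat[OF P(1) C(1)] mult_carrier_mat[OF P(1) C(2)] P(2)]
    by simp
  also have "c \<cdot>\<^sub>m 1\<^sub>m d + mat_diag d f = mat_diag d (\<lambda>j. c + f j)"
    by (rule eq_matI) (auto simp: mat_diag_def)
  finally have "det (c \<cdot>\<^sub>m 1\<^sub>m d + P * mat_diag d f * Q) = det P * det (mat_diag d (\<lambda>j. c + f j)) * det Q"
    using P by (simp add: det_mult[of _ d])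
  also have "\<dots> = det (P * Q) * det (mat_diag d (\<lambda>j. c + f j))"
    using P(1,2) by (simp add: det_mult[of _ d])
  also have "det (mat_diag d (\<lambda>j. c + f j)) = (\<Prod>j<d. c + f j)"
  proof -
    have "det (mat_diag d (\<lambda>j. c + f j)) = prod_list (diag_mat (mat_diag d (\<lambda>j. c + f j)))"
      by (rule det_upper_triangular) (auto simp: mat_diag_def)
    also have "diag_mat (mat_diag d (\<lambda>j. c + f j)) = map (\<lambda>j. c + f j) [0..<d]"
      by (auto simp: diag_mat_def mat_diag_def)
    finally show ?thesis by (simp add: prod.list_conv_set_nth lessThan_atLeast0)
  qed
  finally show ?thesis using P by simp
qed

section \<open>Weights and tensor products\<close>

lemma lie_rep_zero: "lie_rep sc br d phi \<Longrightarrow> vector_space sc \<Longrightarrow> phi 0 = 0\<^sub>m d d"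
proof -
  assume rep: "lie_rep sc br d phi" and vs: "vector_space sc"
  interpret vector_space sc by (rule vs)
  have "phi 0 = 0 \<cdot>\<^sub>m phi 0" using lie_rep_scale[OF rep, of 0 0] by simp
  also have "\<dots> = 0\<^sub>m d d" by (rule eq_matI) (use lie_rep_carrier[OF rep, of 0] in auto)
  finally show ?thesis .
qed

lemma lie_rep_sum:
  assumes rep: "lie_rep sc br d phi" and vs: "vector_space sc" and rk: "r < d" "k < d"
  shows "phi (\<Sum>i\<in>I. sc (c i) (x i)) $$ (r, k) = (\<Sum>i\<in>I. c i * phi (x i) $$ (r, k))"
proof (induction I rule: infinite_finite_induct)
  case (insert i I)
  have "phi (sc (c i) (x i) + (\<Sum>i\<in>I. sc (c i) (x i))) $$ (r, k)
      = c i * phi (x i) $$ (r, k) + phi (\<Sum>i\<in>I. sc (c i) (x i)) $$ (r, k)"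
    unfolding lie_rep_add[OF rep] lie_rep_scale[OF rep]
    using lie_rep_carrier[OF rep, of "x i"] lie_rep_carrier[OF rep, of "\<Sum>i\<in>I. sc (c i) (x i)"] rk by simp
  then show ?case using insert by simp
qed (use lie_rep_zero[OF rep vs] rk in simp_all)

lemma h_functional_sum:
  assumes l: "h_functional sc H l" and vs: "vector_space sc" and H: "Modules.module.subspace sc H"
    and x: "\<And>i. i \<in> I \<Longrightarrow> x i \<in> H"
  shows "l (\<Sum>i\<in>I. sc (c i) (x i)) = (\<Sum>i\<in>I. c i * l (x i))"
proof -
  interpret vector_space sc by (rule vs)
  have 0: "l 0 = 0" using l subspace_0[OF H] unfolding h_functional_def by (metis mult_zero_left scale_zero_left)
  show ?thesis using x
  proof (induction I rule: infinite_finite_induct)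
    case (insert i I)
    then have m: "sc (c i) (x i) \<in> H" "(\<Sum>i\<in>I. sc (c i) (x i)) \<in> H"
      using H by (auto intro: subspace_scale subspace_sum)
    have "l (sc (c i) (x i) + (\<Sum>i\<in>I. sc (c i) (x i))) = c i * l (x i) + l (\<Sum>i\<in>I. sc (c i) (x i))"
      using l m insert.prems by (simp add: h_functional_def)
    then show ?case using insert by simp
  qed (simp_all add: 0)
qed

text \<open>A simultaneous diagonalization of \<open>H\<close>; \<open>lam\<close> lists the
  weights, each as often as its multiplicity.\<close>

definition diag_rep :: "(complex \<Rightarrow> 'g::ab_group_add \<Rightarrow> 'g) \<Rightarrow> 'g set \<Rightarrow> nat \<Rightarrow> ('g \<Rightarrow> complex mat) \<Rightarrow>
    complex mat \<Rightarrow> complex mat \<Rightarrow> (nat \<Rightarrow> 'g \<Rightarrow> complex) \<Rightarrow> bool" where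
  "diag_rep sc H d phi P Q lam \<longleftrightarrow> P \<in> carrier_mat d d \<and> Q \<in> carrier_mat d d \<and> P * Q = 1\<^sub>m d \<and> Q * P = 1\<^sub>m d \<and>
     (\<forall>j<d. h_functional sc H (lam j)) \<and> (\<forall>t\<in>H. phi t = P * mat_diag d (\<lambda>j. lam j t) * Q)"

lemma diag_repD:
  assumes "diag_rep sc H d phi P Q lam"
  shows "P \<in> carrier_mat d d" "Q \<in> carrier_mat d d" "P * Q = 1\<^sub>m d" "Q * P = 1\<^sub>m d"
    "\<And>j. j < d \<Longrightarrow> h_functional sc H (lam j)" "\<And>t. t \<in> H \<Longrightarrow> phi t = P * mat_diag d (\<lambda>j. lam j t) * Q"
  using assms by (auto simp: diag_rep_def)

lemma h_functional_eqI:
  assumes "h_functional sc H l" "h_functional sc H m" "\<And>t. t \<in> H \<Longrightarrow> l t = m t"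
  shows "l = m"
proof
  fix t show "l t = m t" using assms by (cases "t \<in> H") (auto simp: h_functional_def)
qed

lemma weight_space_diag:
  assumes D: "diag_rep sc H d phi P Q lam" and l: "h_functional sc H l"
  shows "weight_space H d phi l = {v \<in> carrier_vec d. \<forall>j<d. lam j \<noteq> l \<longrightarrow> (Q *\<^sub>v v) $ j = 0}"
proof -
  note d = diag_repD[OF D]
  have "(\<forall>t\<in>H. phi t *\<^sub>v v = l t \<cdot>\<^sub>v v) \<longleftrightarrow> (\<forall>j<d. lam j \<noteq> l \<longrightarrow> (Q *\<^sub>v v) $ j = 0)"
    if v: "v \<in> carrier_vec d" for v
  proof -
    have "(\<forall>t\<in>H. phi t *\<^sub>v v = l t \<cdot>\<^sub>v v) \<longleftrightarrow> (\<forall>t\<in>H. \<forall>j<d. lam j t * (Q *\<^sub>v v) $ j = l t * (Q *\<^sub>v v) $ j)"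
      using conj_diag_eigen[OF d(1-4) v] d(6) by simp
    also have "\<dots> \<longleftrightarrow> (\<forall>j<d. lam j \<noteq> l \<longrightarrow> (Q *\<^sub>v v) $ j = 0)"
    proof
      assume a: "\<forall>t\<in>H. \<forall>j<d. lam j t * (Q *\<^sub>v v) $ j = l t * (Q *\<^sub>v v) $ j"
      show "\<forall>j<d. lam j \<noteq> l \<longrightarrow> (Q *\<^sub>v v) $ j = 0"
      proof (intro allI impI)
        fix j assume j: "j < d" "lam j \<noteq> l"
        then obtain t where "t \<in> H" "lam j t \<noteq> l t" using h_functional_eqI[OF d(5)[OF j(1)] l] by blast
        then show "(Q *\<^sub>v v) $ j = 0" using a j(1) by auto
      qed
    next
      assume "\<forall>j<d. lam j \<noteq> l \<longrightarrow> (Q *\<^sub>v v) $ j = 0"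
      then show "\<forall>t\<in>H. \<forall>j<d. lam j t * (Q *\<^sub>v v) $ j = l t * (Q *\<^sub>v v) $ j" by auto
    qed
    finally show ?thesis .
  qed
  then show ?thesis unfolding weight_space_def by blast
qed

text \<open>The weight space is the kernel of one diagonalizable matrix, with entry 0 at the
  positions of weight l and 1 elsewhere, so its dimension is a \<open>kernel_dim\<close>.\<close>

lemma weight_mult_diag:
  assumes D: "diag_rep sc H d phi P Q lam" and l: "h_functional sc H l"
  shows "weight_mult H d phi l = card {j. j < d \<and> lam j = l}"
proof -
  note d = diag_repD[OF D]
  let ?f = "\<lambda>j. if lam j = l then 0 else (1 :: complex)"
  let ?M = "P * mat_diag d ?f * Q"
  have M: "?M \<in> carrier_mat d d" using d by auto
  have z: "0 \<cdot>\<^sub>v v = 0\<^sub>v d" if "v \<in> carrier_vec d" for v :: "complex vec"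
    by (rule eq_vecI) (use that in auto)
  have "v \<in> weight_space H d phi l \<longleftrightarrow> v \<in> mat_kernel ?M" for v
  proof -
    have "v \<in> mat_kernel ?M \<longleftrightarrow> v \<in> carrier_vec d \<and> ?M *\<^sub>v v = 0 \<cdot>\<^sub>v v"
      unfolding mat_kernel[OF M] using z by auto
    also have "\<dots> \<longleftrightarrow> v \<in> carrier_vec d \<and> (\<forall>j<d. ?f j * (Q *\<^sub>v v) $ j = 0)"
      using conj_diag_eigen[OF d(1-4), of v ?f 0] unfolding mult_zero_left by blast
    also have "\<dots> \<longleftrightarrow> v \<in> weight_space H d phi l"
    proof -
      have "?f j * x = 0 \<longleftrightarrow> (lam j \<noteq> l \<longrightarrow> x = 0)" for j x by simp
      then show ?thesis unfolding weight_space_diag[OF D l] by simp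
    qed
    finally show ?thesis by simp
  qed
  then have "weight_space H d phi l = mat_kernel ?M" by blast
  then have "weight_mult H d phi l = kernel_dim ?M"
    unfolding weight_mult_def kernel_dim_def carrier_matD(2)[OF M] by simp
  also have "\<dots> = card {j. j < d \<and> ?f j = 0}" by (rule kernel_dim_conj_diag[OF d(1-4)])
  also have "{j. j < d \<and> ?f j = 0} = {j. j < d \<and> lam j = l}" by auto
  finally show ?thesis .
qed

lemma weights_diag:
  assumes D: "diag_rep sc H d phi P Q lam"
  shows "weights sc H d phi = lam ` {..<d}"
proof -
  note d = diag_repD[OF D]
  have "weight_space H d phi l \<noteq> {0\<^sub>v d} \<longleftrightarrow> (\<exists>j<d. lam j = l)" if l: "h_functional sc H l" for l
  proof
    assume a: "weight_space H d phi l \<noteq> {0\<^sub>v d}"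
    show "\<exists>j<d. lam j = l"
    proof (rule ccontr)
      assume n: "\<not> ?thesis"
      have "v = 0\<^sub>v d" if "v \<in> weight_space H d phi l" for v
      proof -
        have v: "v \<in> carrier_vec d" "\<forall>j<d. (Q *\<^sub>v v) $ j = 0"
          using that n unfolding weight_space_diag[OF D l] by auto
        have "Q *\<^sub>v v = 0\<^sub>v d" by (rule eq_vecI) (use v d in auto)
        then have "P *\<^sub>v (Q *\<^sub>v v) = 0\<^sub>v d" using d by auto
        moreover have "P *\<^sub>v (Q *\<^sub>v v) = (P * Q) *\<^sub>v v" by (rule assoc_mult_mat_vec[symmetric, OF d(1,2) v(1)])
        ultimately show ?thesis using d v by simp
      qed
      moreover have "0\<^sub>v d \<in> weight_space H d phi l"
        unfolding weight_space_diag[OF D l] using d by auto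
      ultimately show False using a by blast
    qed
  next
    assume "\<exists>j<d. lam j = l"
    then obtain j where j: "j < d" "lam j = l" by blast
    let ?v = "P *\<^sub>v unit_vec d j"
    have v: "?v \<in> carrier_vec d" using d by auto
    have Qv: "Q *\<^sub>v ?v = unit_vec d j"
    proof -
      have "Q *\<^sub>v ?v = (Q * P) *\<^sub>v unit_vec d j"
        by (rule assoc_mult_mat_vec[symmetric, OF d(2,1)]) simp
      then show ?thesis using d by simp
    qed
    have "?v \<in> weight_space H d phi l"
      unfolding weight_space_diag[OF D l] using v Qv j by auto
    moreover have "?v \<noteq> 0\<^sub>v d"
    proof
      assume "?v = 0\<^sub>v d"
      moreover have "Q *\<^sub>v 0\<^sub>v d = 0\<^sub>v d" by (rule eq_vecI) (use d(2) in auto)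
      ultimately have "unit_vec d j = (0\<^sub>v d :: complex vec)" using Qv by simp
      then have "unit_vec d j $ j = (0\<^sub>v d :: complex vec) $ j" by simp
      then show False using j by simp
    qed
    ultimately show "weight_space H d phi l \<noteq> {0\<^sub>v d}" by blast
  qed
  then show ?thesis using d(5) unfolding weights_def by auto
qed

lemma prod_multiplicities:
  "(\<Prod>l\<in>lam ` {..<d::nat}. F l ^ card {j. j < d \<and> lam j = l}) = (\<Prod>j<d. F (lam j) :: complex)"
proof -
  have "(\<Prod>j<d. F (lam j)) = (\<Prod>l\<in>lam ` {..<d}. \<Prod>j\<in>{j. j \<in> {..<d} \<and> lam j = l}. F (lam j))"
    by (rule prod.image_gen) simp
  also have "\<dots> = (\<Prod>l\<in>lam ` {..<d}. F l ^ card {j. j < d \<and> lam j = l})"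
    by (intro prod.cong refl) simp
  finally show ?thesis by simp
qed

context cartan_simple begin

lemma vector_space_scale: "vector_space scale" ..

lemma rep_diag_rep:
  assumes "lie_rep scale br d phi"
  obtains P Q lam where "diag_rep scale H d phi P Q lam"
  using rep_diagonal[OF assms] unfolding diag_rep_def by metis

definition lin_elt :: "nat \<Rightarrow> (nat \<Rightarrow> 'g \<Rightarrow> complex) \<Rightarrow> (nat \<Rightarrow> complex) \<Rightarrow> 'g" where
  "lin_elt n al z = (\<Sum>i=1..n. z i *s cor (al i))"

lemma simple_root_Phi: "simple_roots scale br H n al \<Longrightarrow> i \<in> {1..n} \<Longrightarrow> al i \<in> Phi"
  by (simp add: simple_roots_def roots_eq)

lemma lin_elt_H: "simple_roots scale br H n al \<Longrightarrow> lin_elt n al z \<in> H"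
  unfolding lin_elt_def using simple_root_Phi coroot_H
  by (intro subspace_sum[OF subspace_H] subspace_scale[OF subspace_H]) blast

lemma cp_lin_det:
  assumes rep: "lie_rep scale br d phi"
  shows "cp_lin scale br H n al d phi z = det (z 0 \<cdot>\<^sub>m 1\<^sub>m d + phi (lin_elt n al z))"
  unfolding cp_lin_def
proof (rule arg_cong[where f = det], rule eq_matI, goal_cases)
  case (1 r c)
  then show ?case using lie_rep_carrier[OF rep, of "lin_elt n al z"]
    by (auto simp: lin_elt_def lie_rep_sum[OF rep vector_space_scale])
qed (use lie_rep_carrier[OF rep, of "lin_elt n al z"] in auto)

definition full_elt :: "nat \<Rightarrow> (nat \<Rightarrow> 'g \<Rightarrow> complex) \<Rightarrow> (('g \<Rightarrow> complex) \<Rightarrow> 'g) \<Rightarrow> (('g \<Rightarrow> complex) cpvar \<Rightarrow> complex) \<Rightarrow> 'g" where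
  "full_elt n al E z = lin_elt n al (\<lambda>i. z (ZH i)) + (\<Sum>a\<in>Phi. z (ZE a) *s E a)"

lemma cp_full_det:
  assumes rep: "lie_rep scale br d phi"
  shows "cp_full scale br H n al E d phi z = det (z Z0 \<cdot>\<^sub>m 1\<^sub>m d + phi (full_elt n al E z))"
  unfolding cp_full_def roots_eq
proof (rule arg_cong[where f = det], rule eq_matI, goal_cases)
  case (1 r c)
  then have rc: "r < d" "c < d" using lie_rep_carrier[OF rep, of "full_elt n al E z"] by auto
  have "phi (full_elt n al E z) $$ (r, c) = phi (lin_elt n al (\<lambda>i. z (ZH i))) $$ (r, c)
      + phi (\<Sum>a\<in>Phi. z (ZE a) *s E a) $$ (r, c)"
    unfolding full_elt_def lie_rep_add[OF rep] using rc lie_rep_carrier[OF rep, of "\<Sum>a\<in>Phi. z (ZE a) *s E a"] by simp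
  then show ?case using rc lie_rep_carrier[OF rep, of "full_elt n al E z"]
    by (simp add: lin_elt_def lie_rep_sum[OF rep vector_space_scale])
qed (use lie_rep_carrier[OF rep, of "full_elt n al E z"] in auto)

lemma cp_lin_diag:
  assumes sr: "simple_roots scale br H n al" and rep: "lie_rep scale br d phi"
    and D: "diag_rep scale H d phi P Q lam"
  shows "cp_lin scale br H n al d phi z = (\<Prod>j<d. z 0 + lam j (lin_elt n al z))"
  unfolding cp_lin_det[OF rep] diag_repD(6)[OF D lin_elt_H[OF sr]]
  by (rule det_conj_diag[OF diag_repD(1-3)[OF D]])

text \<open>Indexing by basis vectors instead of distinct weights removes the exponents, so that
  symmetry, associativity and the comparison with tensor products become reindexing of plain
  products.\<close>

lemma res_prod_reps_diag:
  assumes sr: "simple_roots scale br H n al"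
    and D: "diag_rep scale H d phi P Q lam" and D': "diag_rep scale H e psi P' Q' mu"
  shows "res_prod_reps scale br H n al d phi e psi z =
    (\<Prod>j<d. \<Prod>k<e. z 0 + (lam j (lin_elt n al z) + mu k (lin_elt n al z)))"
proof -
  have c: "cor (al i) \<in> H" if "i \<in> {1..n}" for i using coroot_H simple_root_Phi[OF sr that] by blast
  let ?t = "lin_elt n al z"
  define F where "F l m = z 0 + (l ?t + m ?t)" for l m
  have F: "z 0 + (\<Sum>i=1..n. (l (cor (al i)) + m (cor (al i))) * z i) = F l m"
    if "h_functional scale H l" "h_functional scale H m" for l m
  proof -
    have "k ?t = (\<Sum>i=1..n. k (cor (al i)) * z i)" if "h_functional scale H k" for k
      unfolding lin_elt_def using h_functional_sum[OF that vector_space_scale subspace_H, where c = z and I = "{1..n}" and x = "\<lambda>i. cor (al i)"] c by (simp add: mult.commute)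
    then show ?thesis using that by (simp add: F_def distrib_right sum.distrib)
  qed
  have hf: "h_functional scale H l" if "l \<in> lam ` {..<d}" for l using that diag_repD(5)[OF D] by auto
  have hf': "h_functional scale H m" if "m \<in> mu ` {..<e}" for m using that diag_repD(5)[OF D'] by auto
  have "res_prod_reps scale br H n al d phi e psi z =
    (\<Prod>l\<in>lam ` {..<d}. \<Prod>m\<in>mu ` {..<e}. F l m ^ (card {j. j < d \<and> lam j = l} * card {k. k < e \<and> mu k = m}))"
    unfolding res_prod_reps_def weights_diag[OF D] weights_diag[OF D']
    by (intro prod.cong refl) (simp only: F[OF hf hf'] weight_mult_diag[OF D hf] weight_mult_diag[OF D' hf'])
  also have "\<dots> = (\<Prod>l\<in>lam ` {..<d}. (\<Prod>m\<in>mu ` {..<e}. F l m ^ card {k. k < e \<and> mu k = m}) ^ card {j. j < d \<and> lam j = l})"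
    by (intro prod.cong refl) (simp add: prod_power_distrib flip: power_mult, simp add: mult.commute)
  also have "\<dots> = (\<Prod>j<d. \<Prod>k<e. F (lam j) (mu k))"
    unfolding prod_multiplicities[where F = "F _"] by (rule prod_multiplicities)
  finally show ?thesis unfolding F_def .
qed

end

lemma diag_rep_tensor:
  assumes D: "diag_rep sc H d phi P Q lam" and D': "diag_rep sc H e psi P' Q' mu"
  shows "diag_rep sc H (d * e) (tensor_rep d phi e psi) (kron d e P P') (kron d e Q Q')
    (\<lambda>i t. lam (i div e) t + mu (i mod e) t)"
proof -
  note d = diag_repD[OF D] and d' = diag_repD[OF D']
  have PQ: "kron d e P P' * kron d e Q Q' = 1\<^sub>m (d * e)" "kron d e Q Q' * kron d e P P' = 1\<^sub>m (d * e)"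
    using kron_mult[OF d(1,2) d'(1,2)] kron_mult[OF d(2,1) d'(2,1)] d d' kron_one by simp_all
  have hf: "h_functional sc H (\<lambda>t. lam (i div e) t + mu (i mod e) t)" if "i < d * e" for i
    using d(5)[of "i div e"] d'(5)[of "i mod e"] div_mod_less[OF that] by (auto simp: h_functional_def algebra_simps)
  have "tensor_rep d phi e psi t =
      kron d e P P' * mat_diag (d * e) (\<lambda>i. lam (i div e) t + mu (i mod e) t) * kron d e Q Q'" if t: "t \<in> H" for t
  proof -
    let ?D = "mat_diag d (\<lambda>j. lam j t)" and ?D' = "mat_diag e (\<lambda>j. mu j t)"
    let ?K = "kron d e P P'" and ?L = "kron d e Q Q'"
    have 1: "kron d e (P * ?D * Q) (1\<^sub>m e) = ?K * kron d e ?D (1\<^sub>m e) * ?L"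
      unfolding kron_mult[OF d(1) mat_diag_dim d'(1) one_carrier_mat]
        kron_mult[OF mult_carrier_mat[OF d(1) mat_diag_dim] d(2) mult_carrier_mat[OF d'(1) one_carrier_mat] d'(2)]
      using d' by simp
    have 2: "kron d e (1\<^sub>m d) (P' * ?D' * Q') = ?K * kron d e (1\<^sub>m d) ?D' * ?L"
      unfolding kron_mult[OF d(1) one_carrier_mat d'(1) mat_diag_dim]
        kron_mult[OF mult_carrier_mat[OF d(1) one_carrier_mat] d(2) mult_carrier_mat[OF d'(1) mat_diag_dim] d'(2)]
      using d by simp
    have 3: "kron d e ?D (1\<^sub>m e) + kron d e (1\<^sub>m d) ?D' = mat_diag (d * e) (\<lambda>i. lam (i div e) t + mu (i mod e) t)"
    proof (rule eq_matI, goal_cases)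
      case (1 i j)
      then have ij: "i < d * e" "j < d * e" by (auto simp: mat_diag_def)
      have "i = j" if "i div e = j div e" "i mod e = j mod e" using that by (metis div_mult_mod_eq)
      then show ?case using ij div_mod_less[OF ij(1)] div_mod_less[OF ij(2)]
        by (auto simp: kron_def mat_diag_def)
    qed (auto simp: kron_def mat_diag_def)
    have "tensor_rep d phi e psi t = ?K * kron d e ?D (1\<^sub>m e) * ?L + ?K * kron d e (1\<^sub>m d) ?D' * ?L"
      unfolding tensor_rep_def d(6)[OF t] d'(6)[OF t] 1 2 ..
    also have "\<dots> = ?K * (kron d e ?D (1\<^sub>m e) + kron d e (1\<^sub>m d) ?D') * ?L"
      using mult_add_distrib_mat[OF kron_carrier[of d e P P'] kron_carrier[of d e ?D "1\<^sub>m e"] kron_carrier[of d e "1\<^sub>m d" ?D']]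
        add_mult_distrib_mat[OF mult_carrier_mat[OF kron_carrier[of d e P P'] kron_carrier[of d e ?D "1\<^sub>m e"]]
          mult_carrier_mat[OF kron_carrier[of d e P P'] kron_carrier[of d e "1\<^sub>m d" ?D']] kron_carrier[of d e Q Q']]
      by simp
    finally show ?thesis unfolding 3 .
  qed
  then show ?thesis unfolding diag_rep_def using PQ hf by auto
qed

context cartan_simple begin

lemma cp_lin_tensor:
  assumes sr: "simple_roots scale br H n al" and phi: "lie_rep scale br d phi" and psi: "lie_rep scale br e psi"
  shows "cp_lin scale br H n al (d * e) (tensor_rep d phi e psi) = res_prod_reps scale br H n al d phi e psi"
proof
  fix z
  obtain P Q lam where D: "diag_rep scale H d phi P Q lam" by (rule rep_diag_rep[OF phi])
  obtain P' Q' mu where D': "diag_rep scale H e psi P' Q' mu" by (rule rep_diag_rep[OF psi])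
  show "cp_lin scale br H n al (d * e) (tensor_rep d phi e psi) z = res_prod_reps scale br H n al d phi e psi z"
    unfolding cp_lin_diag[OF sr lie_rep_tensor[OF phi psi] diag_rep_tensor[OF D D']] res_prod_reps_diag[OF sr D D']
    by (rule prod_div_mod[where F = "\<lambda>a b. z 0 + (lam a (lin_elt n al z) + mu b (lin_elt n al z))"])
qed

end

section \<open>Restriction of invariants to the Cartan subalgebra\<close>

lemma sum_multiplicities:
  assumes "finite L" "lam ` {..<d::nat} \<subseteq> L"
  shows "(\<Sum>j<d. F (lam j) :: complex) = (\<Sum>l\<in>L. of_nat (card {j. j < d \<and> lam j = l}) * F l)"
proof -
  have "(\<Sum>j<d. F (lam j)) = (\<Sum>l\<in>lam ` {..<d}. \<Sum>j\<in>{j. j \<in> {..<d} \<and> lam j = l}. F (lam j))"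
    by (rule sum.image_gen) simp
  also have "\<dots> = (\<Sum>l\<in>lam ` {..<d}. of_nat (card {j. j < d \<and> lam j = l}) * F l)"
    by (intro sum.cong refl) simp
  also have "\<dots> = (\<Sum>l\<in>L. of_nat (card {j. j < d \<and> lam j = l}) * F l)"
  proof (rule sum.mono_neutral_left[OF assms])
    show "\<forall>l\<in>L - lam ` {..<d}. of_nat (card {j. j < d \<and> lam j = l}) * F l = 0"
    proof
      fix l assume "l \<in> L - lam ` {..<d}"
      then have "{j. j < d \<and> lam j = l} = {}" by auto
      then show "of_nat (card {j. j < d \<and> lam j = l}) * F l = 0" by (simp only: card.empty) simp
    qed
  qed
  finally show ?thesis .
qed

text \<open>Equal power sums give equal sums of every polynomial over the two families. A polynomial
  vanishing at all occurring values other than c, but not at c, isolates the multiplicity of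
  c.\<close>

lemma power_sums_card:
  fixes f g :: "nat \<Rightarrow> complex"
  assumes "\<And>k. (\<Sum>j<d. f j ^ k) = (\<Sum>j<d. g j ^ k)"
  shows "card {j. j < d \<and> f j = c} = card {j. j < d \<and> g j = c}"
proof -
  define S where "S = f ` {..<d} \<union> g ` {..<d} - {c}"
  define p where "p = (\<Prod>s\<in>S. [:- s, 1:])"
  have fin: "finite S" by (simp add: S_def)
  have S: "(\<Sum>j<d. poly p (h j)) = of_nat (card {j. j < d \<and> h j = c}) * poly p c"
    if "h ` {..<d} \<subseteq> insert c S" for h :: "nat \<Rightarrow> complex"
  proof -
    have z: "poly p s = 0" if "s \<in> S" for s
      unfolding p_def poly_prod using that fin by (simp add: prod_zero_iff)
    have "(\<Sum>j<d. poly p (h j)) = (\<Sum>j\<in>{j. j < d \<and> h j = c}. poly p (h j))"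
      by (rule sum.mono_neutral_right) (use that z in auto)
    also have "\<dots> = of_nat (card {j. j < d \<and> h j = c}) * poly p c" by simp
    finally show ?thesis .
  qed
  have e: "(\<Sum>j<d. poly p (h j)) = (\<Sum>i\<le>degree p. coeff p i * (\<Sum>j<d. h j ^ i))" for h
    unfolding poly_altdef by (subst sum.swap) (simp add: sum_distrib_left)
  have "(\<Sum>j<d. poly p (f j)) = (\<Sum>j<d. poly p (g j))" unfolding e assms ..
  moreover have "f ` {..<d} \<subseteq> insert c S" "g ` {..<d} \<subseteq> insert c S" by (auto simp: S_def)
  note S[OF this(1)] S[OF this(2)]
  ultimately have "of_nat (card {j. j < d \<and> f j = c}) * poly p c = of_nat (card {j. j < d \<and> g j = c}) * poly p c"
    by (simp only:)
  moreover have "poly p c \<noteq> 0" unfolding p_def poly_prod using fin by (auto simp: prod_zero_iff S_def)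
  ultimately show ?thesis by simp
qed

lemma prod_eq_of_card:
  fixes f g :: "nat \<Rightarrow> complex"
  assumes "\<And>c. card {j. j < d \<and> f j = c} = card {j. j < d \<and> g j = c}"
  shows "(\<Prod>j<d. x + f j) = (\<Prod>j<d. x + g j)"
proof -
  have "f ` {..<d} = g ` {..<d}"
  proof -
    have *: "c \<in> h ` {..<d} \<longleftrightarrow> card {j. j < d \<and> h j = c} \<noteq> 0" for h :: "nat \<Rightarrow> complex" and c
      by auto
    show ?thesis unfolding set_eq_iff * assms by simp
  qed
  then show ?thesis
    using prod_multiplicities[of "\<lambda>c. x + c" d f] prod_multiplicities[of "\<lambda>c. x + c" d g] assms by simp
qed

text \<open>Both sides are values of monic polynomials with roots -f j and -g j; agreeing
  everywhere, these have the same roots with multiplicities.\<close>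

lemma card_eq_of_prod:
  fixes f g :: "nat \<Rightarrow> complex"
  assumes "\<And>x. (\<Prod>j<d. x + f j) = (\<Prod>j<d. x + g j)"
  shows "card {j. j < d \<and> f j = c} = card {j. j < d \<and> g j = c}"
proof -
  let ?p = "\<lambda>f. \<Prod>j<d. [:f j, 1:]"
  have "poly (?p f) = poly (?p g)" using assms by (auto simp: poly_prod add.commute)
  then have pp: "proots (?p f) = proots (?p g)" by (simp only: poly_eq_poly_eq_iff)
  have pr: "proots (?p h) = (\<Sum>j<d. {#- h j#})" for h by (subst proots_prod) auto
  have cn: "count (proots (?p h)) (- c) = card {j. j < d \<and> h j = c}" for h :: "nat \<Rightarrow> complex"
  proof -
    have "count (proots (?p h)) (- c) = count (\<Sum>j<d. {#- h j#}) (- c)" by (simp only: pr)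
    also have "count (\<Sum>j<d. {#- h j#}) (- c) = (\<Sum>j<d. if h j = c then 1 else 0)"
      unfolding count_sum by (intro sum.cong) auto
    also have "\<dots> = card {j. j < d \<and> h j = c}"
      by (subst sum.inter_filter[symmetric]) auto
    finally show ?thesis .
  qed
  show ?thesis using cn[of f] cn[of g] pp by (simp only:)
qed

definition mtrace :: "complex mat \<Rightarrow> complex" where
  "mtrace A = (\<Sum>i<dim_row A. A $$ (i, i))"

lemma mtrace_commute:
  assumes "A \<in> carrier_mat d d" "B \<in> carrier_mat d d"
  shows "mtrace (A * B) = mtrace (B * A)"
proof -
  have e: "mtrace (A * B) = (\<Sum>i<d. \<Sum>k<d. A $$ (i, k) * B $$ (k, i))"
    if "A \<in> carrier_mat d d" "B \<in> carrier_mat d d" for A B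
    unfolding mtrace_def using that by (intro sum.cong) (auto simp: index_mult_carrier simp del: index_mult_mat(1))
  show ?thesis unfolding e[OF assms] e[OF assms(2,1)]
    by (subst sum.swap) (simp add: mult.commute)
qed

lemma mtrace_add: "A \<in> carrier_mat d d \<Longrightarrow> B \<in> carrier_mat d d \<Longrightarrow> mtrace (A + B) = mtrace A + mtrace B"
  and mtrace_minus: "A \<in> carrier_mat d d \<Longrightarrow> B \<in> carrier_mat d d \<Longrightarrow> mtrace (A - B) = mtrace A - mtrace B"
  and mtrace_smult: "A \<in> carrier_mat d d \<Longrightarrow> mtrace (c \<cdot>\<^sub>m A) = c * mtrace A"
  by (auto simp: mtrace_def sum.distrib sum_subtractf sum_distrib_left)

text \<open>The dimension argument fixes the empty product, since matrices of all sizes share one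
  type.\<close>

fun mlist :: "nat \<Rightarrow> complex mat list \<Rightarrow> complex mat" where
  "mlist d [] = 1\<^sub>m d"
| "mlist d (A # As) = A * mlist d As"

lemma mlist_carrier: "(\<And>A. A \<in> set As \<Longrightarrow> A \<in> carrier_mat d d) \<Longrightarrow> mlist d As \<in> carrier_mat d d"
  by (induction As) (auto intro!: mult_carrier_mat[of _ d d])

lemma mlist_append:
  "(\<And>A. A \<in> set As \<union> set Bs \<Longrightarrow> A \<in> carrier_mat d d) \<Longrightarrow> mlist d (As @ Bs) = mlist d As * mlist d Bs"
proof (induction As)
  case Nil
  then show ?case using mlist_carrier[of Bs d] by simp
next
  case (Cons A As)
  have "A \<in> carrier_mat d d" "mlist d As \<in> carrier_mat d d" "mlist d Bs \<in> carrier_mat d d"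
    using Cons.prems by (auto intro!: mlist_carrier)
  then show ?case using Cons by (simp add: assoc_mult_mat[of _ d d _ d _ d])
qed

lemma mlist_conj:
  assumes PQ: "P \<in> carrier_mat d d" "Q \<in> carrier_mat d d" "P * Q = 1\<^sub>m d" "Q * P = 1\<^sub>m d"
    and "\<And>B. B \<in> set Bs \<Longrightarrow> B \<in> carrier_mat d d"
  shows "mlist d (map (\<lambda>B. P * B * Q) Bs) = P * mlist d Bs * Q"
  using assms(5)
proof (induction Bs)
  case Nil
  show ?case using PQ by simp
next
  case (Cons B Bs)
  let ?M = "mlist d Bs"
  have c: "B \<in> carrier_mat d d" "?M \<in> carrier_mat d d" using Cons.prems by (auto intro!: mlist_carrier)
  have "mlist d (map (\<lambda>B. P * B * Q) (B # Bs)) = (P * B * Q) * (P * ?M * Q)" using Cons by simp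
  also have "\<dots> = P * B * (Q * P) * ?M * Q"
    using PQ(1,2) c by (simp add: assoc_mult_mat[of _ d d _ d _ d])
  also have "\<dots> = P * (B * ?M) * Q" using PQ c by (simp add: assoc_mult_mat[of _ d d _ d _ d])
  finally show ?case by simp
qed

lemma mtrace_conj:
  assumes "P \<in> carrier_mat d d" "Q \<in> carrier_mat d d" "Q * P = 1\<^sub>m d" "B \<in> carrier_mat d d"
  shows "mtrace (P * B * Q) = mtrace B"
proof -
  have "mtrace (P * B * Q) = mtrace (P * (B * Q))" using assms by (simp add: assoc_mult_mat[of _ d d _ d _ d])
  also have "\<dots> = mtrace (B * Q * P)" by (rule mtrace_commute[of _ d]) (use assms in auto)
  also have "B * Q * P = B" using assms by (simp add: assoc_mult_mat[of _ d d _ d _ d])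
  finally show ?thesis .
qed

lemma upper_triangular_mult:
  assumes A: "A \<in> carrier_mat d d" "upper_triangular A" and B: "B \<in> carrier_mat d d" "upper_triangular B"
  shows "upper_triangular (A * B)" "i < d \<Longrightarrow> (A * B) $$ (i, i) = A $$ (i, i) * (B $$ (i, i) :: complex)"
proof -
  have z: "A $$ (i, k) * B $$ (k, j) = 0" if "i < d" "k < d" "j < d" "k < i \<or> j < k" for i j k
    using that A B by (auto simp: upper_triangular_def)
  show "upper_triangular (A * B)"
  proof
    fix i j assume "j < i" "i < dim_row (A * B)"
    then have ij: "i < d" "j < d" "j < i" using A by auto
    show "(A * B) $$ (i, j) = 0" unfolding index_mult_carrier[OF A(1) B(1) ij(1,2)]
      by (intro sum.neutral ballI z) (use ij in auto)
  qed
  assume i: "i < d"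
  have "(A * B) $$ (i, i) = (\<Sum>k<d. if k = i then A $$ (i, i) * B $$ (i, i) else 0)"
    unfolding index_mult_carrier[OF A(1) B(1) i i] by (intro sum.cong refl) (use z i in \<open>auto simp: neq_iff\<close>)
  then show "(A * B) $$ (i, i) = A $$ (i, i) * B $$ (i, i)" using i by simp
qed

lemma mlist_upper_triangular:
  assumes B: "B \<in> carrier_mat d d" "upper_triangular B"
  shows "upper_triangular (mlist d (replicate k B)) \<and> (\<forall>i<d. mlist d (replicate k B) $$ (i, i) = B $$ (i, i) ^ k)"
proof (induction k)
  case (Suc k)
  have "mlist d (replicate k B) \<in> carrier_mat d d" by (rule mlist_carrier) (use B in auto)
  then show ?case using upper_triangular_mult[OF B, of "mlist d (replicate k B)"] Suc
    by (simp del: index_mult_mat)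
qed simp

text \<open>In Schur form both the shifted determinant and the traces of powers depend on the
  diagonal only; f is that diagonal.\<close>

lemma schur_spectrum:
  fixes A :: "complex mat"
  assumes A: "A \<in> carrier_mat d d"
  obtains f where "\<And>x. det (x \<cdot>\<^sub>m 1\<^sub>m d + A) = (\<Prod>j<d. x + f j)"
    "\<And>k. mtrace (mlist d (replicate k A)) = (\<Sum>j<d. f j ^ k)"
proof -
  obtain as where "char_poly A = (\<Prod>a\<leftarrow>as. [:- a, 1:])" using char_poly_factorized[OF A] by blast
  then obtain B where B: "B \<in> carrier_mat d d" "upper_triangular B" "similar_mat A B"
    using schur_decomposition_exists[OF A] by blast
  obtain P Q where w: "similar_mat_wit A B P Q" using B(3) unfolding similar_mat_def by blast
  have PQ: "P \<in> carrier_mat d d" "Q \<in> carrier_mat d d" "P * Q = 1\<^sub>m d" "Q * P = 1\<^sub>m d" "A = P * B * Q"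
    by (fact similar_mat_witD[OF carrier_matD(1)[OF A, symmetric] w])+
  let ?f = "\<lambda>j. B $$ (j, j)"
  show ?thesis
  proof (rule that[of ?f])
    fix x :: complex
    let ?C = "x \<cdot>\<^sub>m 1\<^sub>m d :: complex mat"
    have C: "?C \<in> carrier_mat d d" by simp
    have "P * ?C * Q = ?C"
      using mult_smult_distrib[OF PQ(1) one_carrier_mat, of x] mult_smult_assoc_mat[OF PQ(1,2), of x] PQ by simp
    then have "?C + A = P * ?C * Q + P * B * Q" using PQ(5) by simp
    also have "\<dots> = P * (?C + B) * Q"
      using mult_add_distrib_mat[OF PQ(1) C B(1)]
        add_mult_distrib_mat[OF mult_carrier_mat[OF PQ(1) C] mult_carrier_mat[OF PQ(1) B(1)] PQ(2)] by simp
    finally have e: "?C + A = P * (?C + B) * Q" .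
    have "det (?C + A) = det P * det (?C + B) * det Q"
      unfolding e using PQ(1,2) B C by (simp add: det_mult[of _ d])
    also have "\<dots> = det (P * Q) * det (?C + B)" using PQ(1,2) by (simp add: det_mult[of _ d])
    also have "det (?C + B) = prod_list (diag_mat (?C + B))"
      by (rule det_upper_triangular[of _ d]) (use B in \<open>auto simp: upper_triangular_def\<close>)
    also have "diag_mat (?C + B) = map (\<lambda>j. x + ?f j) [0..<d]" using B by (auto simp: diag_mat_def)
    finally show "det (?C + A) = (\<Prod>j<d. x + ?f j)"
      using PQ by (simp add: prod.list_conv_set_nth lessThan_atLeast0)
  next
    fix k
    let ?M = "mlist d (replicate k B)"
    have M: "?M \<in> carrier_mat d d" by (rule mlist_carrier) (use B in auto)
    have "mlist d (replicate k A) = P * ?M * Q"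
      using mlist_conj[OF PQ(1-4), of "replicate k B"] B PQ(5) by simp
    then have "mtrace (mlist d (replicate k A)) = mtrace ?M" using mtrace_conj[OF PQ(1,2,4) M] by simp
    also have "\<dots> = (\<Sum>j<d. ?f j ^ k)" unfolding mtrace_def using M mlist_upper_triangular[OF B(1,2)] by simp
    finally show "mtrace (mlist d (replicate k A)) = (\<Sum>j<d. ?f j ^ k)" .
  qed
qed

lemma det_eq_of_traces:
  assumes "A \<in> carrier_mat d d" "B \<in> carrier_mat d d"
    and "\<And>k. mtrace (mlist d (replicate k A)) = mtrace (mlist d (replicate k B))"
  shows "det (x \<cdot>\<^sub>m 1\<^sub>m d + A) = det (x \<cdot>\<^sub>m 1\<^sub>m d + B)"
proof -
  obtain f where f: "\<And>x. det (x \<cdot>\<^sub>m 1\<^sub>m d + A) = (\<Prod>j<d. x + f j)"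
    "\<And>k. mtrace (mlist d (replicate k A)) = (\<Sum>j<d. f j ^ k)" using schur_spectrum[OF assms(1)] by metis
  obtain g where g: "\<And>x. det (x \<cdot>\<^sub>m 1\<^sub>m d + B) = (\<Prod>j<d. x + g j)"
    "\<And>k. mtrace (mlist d (replicate k B)) = (\<Sum>j<d. g j ^ k)" using schur_spectrum[OF assms(2)] by metis
  show ?thesis unfolding f(1) g(1)
    by (rule prod_eq_of_card[OF power_sums_card]) (use assms(3) f(2) g(2) in simp)
qed

section \<open>Cyclic functionals on words that vanish on \<open>H\<close>\<close>

context cartan_simple begin

text \<open>Infinitesimal form of Chevalley's restriction principle. The difference of the trace forms of two
  representations is such a functional \<open>T\<close> on words. Once \<open>T\<close> vanishes on words of smaller length,
  it is symmetric, and invariance under a root vector removes the letters outside \<open>H\<close> one by one.\<close>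

context
  fixes T :: "'g list \<Rightarrow> complex" and E :: "('g \<Rightarrow> complex) \<Rightarrow> 'g"
  assumes E: "root_vectors scale br H E"
    and T_add: "\<And>us x y vs. T (us @ (x + y) # vs) = T (us @ x # vs) + T (us @ y # vs)"
    and T_scale: "\<And>us c x vs. T (us @ (c *s x) # vs) = c * T (us @ x # vs)"
    and T_br: "\<And>us x y vs. T (us @ x # y # vs) - T (us @ y # x # vs) = T (us @ br x y # vs)"
    and T_rotate: "\<And>x us. T (x # us) = T (us @ [x])"
    and T_H: "\<And>hs. set hs \<subseteq> H \<Longrightarrow> T hs = 0"
begin

text \<open>Each exchange of y with the letter behind it costs a word in which that letter is
  replaced by its bracket with y. For an empty prefix, cyclicity identifies the two end positions of
  y and leaves invariance under ad y.\<close>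

lemma ad_move_letter:
  "T (ps @ y # xs) = T (ps @ xs @ [y]) + (\<Sum>i<length xs. T (ps @ xs[i := br y (xs ! i)]))"
proof (induction xs arbitrary: ps)
  case (Cons x xs)
  have "T (ps @ y # x # xs) = T (ps @ x # y # xs) + T (ps @ br y x # xs)"
    using T_br[of ps y x xs] by (simp add: algebra_simps)
  also have "T (ps @ x # y # xs) = T ((ps @ [x]) @ xs @ [y])
      + (\<Sum>i<length xs. T ((ps @ [x]) @ xs[i := br y (xs ! i)]))"
    using Cons[of "ps @ [x]"] by simp
  finally show ?case by (simp add: sum.lessThan_Suc_shift del: sum.lessThan_Suc)
qed simp

lemma ad_invariant: "(\<Sum>i<length xs. T (xs[i := br y (xs ! i)])) = 0"
  using ad_move_letter[of "[]" y xs] T_rotate[of y xs] by simp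

context
  fixes k :: nat
  assumes IH: "\<And>xs. length xs < k \<Longrightarrow> T xs = 0"
begin

lemma swap_letters: "length us + length vs + 2 = k \<Longrightarrow> T (us @ x # y # vs) = T (us @ y # x # vs)"
  using T_br[of us x y vs] IH[of "us @ br x y # vs"] by simp

lemma letter_to_front: "length (ps @ us @ x # vs) = k \<Longrightarrow> T (ps @ us @ x # vs) = T (ps @ x # us @ vs)"
proof (induction us arbitrary: ps)
  case (Cons u us)
  have "T (ps @ (u # us) @ x # vs) = T ((ps @ [u]) @ x # us @ vs)"
    using Cons.IH[of "ps @ [u]"] Cons.prems by simp
  also have "\<dots> = T (ps @ x # u # us @ vs)" using swap_letters[of ps "us @ vs" u x] Cons.prems by simp
  finally show ?case by simp
qed simp

lemma permute_suffix: "mset xs = mset ys \<Longrightarrow> length (ps @ xs) = k \<Longrightarrow> T (ps @ xs) = T (ps @ ys)"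
proof (induction xs arbitrary: ps ys)
  case (Cons x xs)
  have "x \<in> set ys" using Cons.prems(1) by (metis list.set_intros(1) mset_eq_setD)
  then obtain us vs where ys: "ys = us @ x # vs" by (auto simp: in_set_conv_decomp)
  have l: "length (ps @ ys) = k" using Cons.prems mset_eq_length[OF Cons.prems(1)] by simp
  have "T (ps @ ys) = T (ps @ x # us @ vs)" using letter_to_front[of ps us x vs] l ys by simp
  moreover have "T ((ps @ [x]) @ xs) = T ((ps @ [x]) @ us @ vs)"
    by (rule Cons.IH) (use Cons.prems ys in auto)
  ultimately show ?case by simp
qed simp

lemma permute_word: "mset xs = mset ys \<Longrightarrow> length xs = k \<Longrightarrow> T xs = T ys"
  using permute_suffix[of xs ys "[]"] by simp

text \<open>Invariance under \<open>E a\<close> is applied to the word with \<open>cor a\<close> in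
  the place of \<open>E a\<close>. Terms that change a letter of \<open>us\<close> vanish by the
  hypothesis on j leading letters. A letter g from \<open>H\<close> turns into -a(g) times
  \<open>E a\<close>, which gives nothing if a g = 0 and otherwise, after reordering, the given
  word. The coefficients add up to minus 2 plus a nonnegative sum, the 2 coming from the inserted
  coroot.\<close>

lemma root_letter_special:
  assumes C: "\<And>us hs. length us = j \<Longrightarrow> set hs \<subseteq> H \<Longrightarrow> length us + length hs = k \<Longrightarrow> T (us @ hs) = 0"
    and a: "a \<in> Phi" and us: "length us = j"
    and hs: "\<And>h. h \<in> set hs \<Longrightarrow> h \<in> H \<and> (h = cor a \<or> a h = 0)" and len: "Suc (length us + length hs) = k"
  shows "T (us @ E a # hs) = 0"
proof -
  let ?gs = "cor a # hs" and ?T = "T (us @ E a # hs)"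
  have gs: "g \<in> H \<and> (g = cor a \<or> a g = 0)" if "g \<in> set ?gs" for g
    using that hs coroot_H[OF a] by auto
  have gsH: "set ?gs \<subseteq> H" using gs by blast
  have "(\<Sum>i<length (us @ ?gs). T ((us @ ?gs)[i := br (E a) ((us @ ?gs) ! i)])) = 0" by (rule ad_invariant)
  also have "(\<Sum>i<length (us @ ?gs). T ((us @ ?gs)[i := br (E a) ((us @ ?gs) ! i)]))
      = (\<Sum>i\<in>{..<length us} \<union> {length us..<length us + length ?gs}. T ((us @ ?gs)[i := br (E a) ((us @ ?gs) ! i)]))"
    by (rule sum.cong) auto
  also have "\<dots> = (\<Sum>i<length us. T ((us @ ?gs)[i := br (E a) ((us @ ?gs) ! i)]))
      + (\<Sum>i\<in>{length us..<length us + length ?gs}. T ((us @ ?gs)[i := br (E a) ((us @ ?gs) ! i)]))"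
    by (rule sum.union_disjoint) auto
  also have "(\<Sum>i<length us. T ((us @ ?gs)[i := br (E a) ((us @ ?gs) ! i)])) = 0"
  proof (intro sum.neutral ballI)
    fix i assume "i \<in> {..<length us}"
    then have "(us @ ?gs)[i := br (E a) ((us @ ?gs) ! i)] = us[i := br (E a) (us ! i)] @ ?gs"
      by (simp add: list_update_append nth_append)
    then show "T ((us @ ?gs)[i := br (E a) ((us @ ?gs) ! i)]) = 0"
      using C[of "us[i := br (E a) (us ! i)]" ?gs] us gsH len by simp
  qed
  also have "(\<Sum>i\<in>{length us..<length us + length ?gs}. T ((us @ ?gs)[i := br (E a) ((us @ ?gs) ! i)]))
      = (\<Sum>p<length ?gs. T (us @ ?gs[p := br (E a) (?gs ! p)]))"
    using sum.shift_bounds_nat_ivl[of "\<lambda>i. T ((us @ ?gs)[i := br (E a) ((us @ ?gs) ! i)])" 0 "length us" "length ?gs"]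
    by (simp add: lessThan_atLeast0 add.commute list_update_append nth_append)
  also have "\<dots> = (\<Sum>p<length ?gs. - a (?gs ! p) * ?T)"
  proof (rule sum.cong)
    fix p assume p: "p \<in> {..<length ?gs}"
    let ?g = "?gs ! p"
    have g: "?g \<in> H" "?g = cor a \<or> a ?g = 0" using gs[of ?g] p nth_mem[of p ?gs] by auto
    have b: "br (E a) ?g = (- a ?g) *s E a" using root_vector_eigen[OF E a g(1)] br_anti[of "E a" ?g] by simp
    have "T (us @ ?gs[p := br (E a) ?g]) = - a ?g * T (us @ ?gs[p := E a])"
    proof -
      have "T (us @ ?gs[p := x]) = T ((us @ take p ?gs) @ x # drop (Suc p) ?gs)" for x
        using p upd_conv_take_nth_drop[of p ?gs x] by simp
      then show ?thesis unfolding b using T_scale[of "us @ take p ?gs" "- a ?g" "E a" "drop (Suc p) ?gs"] by simp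
    qed
    \<comment> \<open>Replacing a coroot by \<open>E a\<close> leaves a permutation of the original
      word, and words of length k may be permuted.\<close>
    moreover have "T (us @ ?gs[p := E a]) = ?T" if "?g = cor a"
    proof (rule permute_word)
      have "mset (?gs[p := E a]) = add_mset (E a) (mset ?gs - {#?g#})" using p by (intro mset_update) simp
      then show "mset (us @ ?gs[p := E a]) = mset (us @ E a # hs)" unfolding that by simp
      have "length (us @ ?gs[p := E a]) = length us + length ?gs" by (simp only: length_append length_list_update)
      then show "length (us @ ?gs[p := E a]) = k" using len by simp
    qed
    ultimately show "T (us @ ?gs[p := br (E a) ?g]) = - a ?g * ?T" using g(2) by auto
  qed simp
  also have "\<dots> = - (\<Sum>p<length ?gs. a (?gs ! p)) * ?T"
    by (simp only: sum_distrib_right sum_negf mult_minus_left)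
  also have "(\<Sum>p<length ?gs. a (?gs ! p)) = 2 + (\<Sum>h\<leftarrow>hs. a h)"
  proof -
    have "(\<Sum>p<length xs. a (xs ! p)) = (\<Sum>h\<leftarrow>xs. a h)" for xs
      by (simp add: sum_list_sum_nth lessThan_atLeast0)
    from this[of ?gs] show ?thesis using coroot_2[OF a] by simp
  qed
  finally have "(2 + (\<Sum>h\<leftarrow>hs. a h)) * ?T = 0"
    by (simp only: add_0_left mult_minus_left neg_equal_0_iff_equal)
  \<comment> \<open>Each a h is 0 or 2, so the sum cannot cancel the leading 2.\<close>
  moreover have "\<exists>m::nat. (\<Sum>h\<leftarrow>hs. a h) = of_nat m" using hs
  proof (induction hs)
    case (Cons h hs)
    then obtain m :: nat where "(\<Sum>h\<leftarrow>hs. a h) = of_nat m" by auto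
    moreover have "a h = 0 \<or> a h = 2" using Cons.prems[of h] coroot_2[OF a] by auto
    ultimately show ?case by (auto intro: exI[of _ "m + 2"] exI[of _ m])
  qed (auto intro: exI[of _ 0])
  then obtain m :: nat where "(\<Sum>h\<leftarrow>hs. a h) = of_nat m" by blast
  then have "2 + (\<Sum>h\<leftarrow>hs. a h) = of_nat (m + 2)" by simp
  then have "2 + (\<Sum>h\<leftarrow>hs. a h) \<noteq> 0" by (simp only: of_nat_eq_0_iff)
  ultimately show ?thesis by simp
qed

text \<open>By linearity in each letter, every letter from \<open>H\<close> is split into a multiple
  of \<open>cor a\<close> and an element killed by a. The list \<open>hs\<close> collects the
  letters already split, \<open>gs\<close> those still to come.\<close>

lemma root_letter:
  assumes C: "\<And>us hs. length us = j \<Longrightarrow> set hs \<subseteq> H \<Longrightarrow> length us + length hs = k \<Longrightarrow> T (us @ hs) = 0"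
    and a: "a \<in> Phi" and us: "length us = j"
    and hs: "\<And>h. h \<in> set hs \<Longrightarrow> h \<in> H \<and> (h = cor a \<or> a h = 0)" and gs: "set gs \<subseteq> H"
    and len: "Suc (length us + length hs + length gs) = k"
  shows "T (us @ E a # hs @ gs) = 0"
  using hs gs len
proof (induction gs arbitrary: hs)
  case Nil
  then show ?case using root_letter_special[OF C a us Nil.prems(1)] by simp
next
  case (Cons g gs)
  have g: "g \<in> H" using Cons.prems by simp
  have "T (us @ E a # (hs @ [x]) @ gs) = 0" if "x \<in> H" "x = cor a \<or> a x = 0" for x
    by (rule Cons.IH) (use Cons.prems that in auto)
  then have z: "T ((us @ E a # hs) @ x # gs) = 0" if "x \<in> H" "x = cor a \<or> a x = 0" for x
    using that by simp
  \<comment> \<open>The half compensates for a (cor a) = 2, so that a vanishes on the remainder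
    \<open>?x\<close>.\<close>
  let ?c = "a g / 2" and ?x = "g + (- (a g / 2)) *s cor a"
  have w: "a \<in> wts" using Phi_wts a by auto
  have cH: "(- ?c) *s cor a \<in> H" by (rule subspace_scale[OF subspace_H coroot_H[OF a]])
  have "a ?x = a g + (- ?c) * a (cor a)"
    by (simp only: wts_add[OF w g cH] wts_scale[OF w coroot_H[OF a]])
  then have "a ?x = 0" by (simp only: coroot_2[OF a]) simp
  moreover have "?x \<in> H" by (rule subspace_add[OF subspace_H g cH])
  ultimately have "T ((us @ E a # hs) @ ?x # gs) = 0" using z by blast
  moreover have "T ((us @ E a # hs) @ (?c *s cor a) # gs) = 0"
    unfolding T_scale using z[of "cor a"] coroot_H[OF a] by simp
  moreover have "g = ?c *s cor a + ?x" by (simp add: scale_minus_left)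
  ultimately have "T ((us @ E a # hs) @ g # gs) = 0"
    using T_add[of "us @ E a # hs" "?c *s cor a" ?x gs] by simp
  then show ?case by simp
qed

text \<open>The induction lowers the number of leading letters outside the control of
  \<open>H\<close>. The last of them is expanded in \<open>H\<close> and the root vectors: a part in
  \<open>H\<close> joins the Cartan letters, and a root vector is removed by invariance.\<close>

lemma vanishing_step: "set hs \<subseteq> H \<Longrightarrow> length us + length hs = k \<Longrightarrow> T (us @ hs) = 0"
proof (induction "length us" arbitrary: us hs)
  case 0
  then show ?case using T_H by simp
next
  case (Suc j)
  have C: "\<And>us hs. length us = j \<Longrightarrow> set hs \<subseteq> H \<Longrightarrow> length us + length hs = k \<Longrightarrow> T (us @ hs) = 0"
    using Suc.hyps by blast
  obtain us' u where us: "us = us' @ [u]" using Suc.hyps(2) by (cases us rule: rev_cases) auto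
  have T0: "T (us' @ 0 # hs) = 0" using T_scale[of us' 0 0 hs] by simp
  have "u \<in> span (H \<union> E ` Phi)" using span_root_vectors[OF E] by simp
  then have "T (us' @ u # hs) = 0"
  proof (induction rule: span_induct_alt)
    case base
    show ?case by (rule T0)
  next
    case (step c x y)
    have "T (us' @ x # hs) = 0"
    proof (cases "x \<in> H")
      case True
      then show ?thesis using C[of us' "x # hs"] Suc.prems Suc.hyps(2) us by simp
    next
      case False
      then obtain a where "a \<in> Phi" "x = E a" using step by auto
      then show ?thesis using root_letter[OF C, where hs = "[]" and gs = hs and us = us' and a = a] Suc.prems Suc.hyps(2) us by simp
    qed
    then show ?case using step unfolding T_add T_scale by simp
  qed
  then show ?case using us by simp
qed

end

lemma vanishing_of_vanishing_on_H: "T xs = 0"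
proof (induction "length xs" arbitrary: xs rule: less_induct)
  case less
  show ?case using vanishing_step[of "length xs" "[]" xs] less by simp
qed

end

end

section \<open>The resolution product\<close>

lemma mlist_mat_diag:
  "mlist d (map (\<lambda>h. mat_diag d (\<lambda>j. lam j h)) hs) = mat_diag d (\<lambda>j. \<Prod>h\<leftarrow>hs. lam j h)"
  by (induction hs) auto

section \<open>Traces of words in a representation\<close>

definition word_trace :: "nat \<Rightarrow> ('g \<Rightarrow> complex mat) \<Rightarrow> 'g list \<Rightarrow> complex" where
  "word_trace d phi xs = mtrace (mlist d (map phi xs))"

context
  fixes sc :: "complex \<Rightarrow> 'g::ab_group_add \<Rightarrow> 'g" and br d phi
  assumes rep: "lie_rep sc br d phi"
begin

lemma mlist_rep_carrier: "mlist d (map phi xs) \<in> carrier_mat d d"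
  by (rule mlist_carrier) (use lie_rep_carrier[OF rep] in auto)

lemma word_trace_split: "word_trace d phi (us @ vs) = mtrace (mlist d (map phi us) * mlist d (map phi vs))"
proof -
  have "mlist d (map phi us @ map phi vs) = mlist d (map phi us) * mlist d (map phi vs)"
    by (rule mlist_append) (use lie_rep_carrier[OF rep] in auto)
  then show ?thesis by (simp add: word_trace_def)
qed

lemma word_trace_add:
  "word_trace d phi (us @ (x + y) # vs) = word_trace d phi (us @ x # vs) + word_trace d phi (us @ y # vs)"
proof -
  let ?U = "mlist d (map phi us)" and ?V = "mlist d (map phi vs)"
  note c = mlist_rep_carrier lie_rep_carrier[OF rep]
  have "?U * ((phi x + phi y) * ?V) = ?U * (phi x * ?V) + ?U * (phi y * ?V)"
    using add_mult_distrib_mat[OF c(2) c(2) c(1), of x y vs]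
      mult_add_distrib_mat[OF c(1) mult_carrier_mat[OF c(2) c(1)] mult_carrier_mat[OF c(2) c(1)]] by simp
  then show ?thesis unfolding word_trace_split
    using mtrace_add[OF mult_carrier_mat[OF c(1) mult_carrier_mat[OF c(2) c(1)]] mult_carrier_mat[OF c(1) mult_carrier_mat[OF c(2) c(1)]]]
    by (simp add: lie_rep_add[OF rep])
qed

lemma word_trace_scale: "word_trace d phi (us @ sc c x # vs) = c * word_trace d phi (us @ x # vs)"
proof -
  let ?U = "mlist d (map phi us)" and ?V = "mlist d (map phi vs)"
  note cr = mlist_rep_carrier lie_rep_carrier[OF rep]
  have "?U * ((c \<cdot>\<^sub>m phi x) * ?V) = c \<cdot>\<^sub>m (?U * (phi x * ?V))"
    using mult_smult_assoc_mat[OF cr(2) cr(1), of c x vs]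
      mult_smult_distrib[OF cr(1) mult_carrier_mat[OF cr(2) cr(1)], of us c x vs] by simp
  then show ?thesis unfolding word_trace_split
    using mtrace_smult[OF mult_carrier_mat[OF cr(1) mult_carrier_mat[OF cr(2) cr(1)]]]
    by (simp add: lie_rep_scale[OF rep])
qed

lemma word_trace_br:
  "word_trace d phi (us @ x # y # vs) - word_trace d phi (us @ y # x # vs) = word_trace d phi (us @ br x y # vs)"
proof -
  let ?U = "mlist d (map phi us)" and ?V = "mlist d (map phi vs)"
  have c: "?U \<in> carrier_mat d d" "?V \<in> carrier_mat d d" "phi x \<in> carrier_mat d d" "phi y \<in> carrier_mat d d"
    using mlist_rep_carrier lie_rep_carrier[OF rep] by auto
  have p: "phi x * phi y \<in> carrier_mat d d" "phi y * phi x \<in> carrier_mat d d"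
    "phi x * (phi y * ?V) \<in> carrier_mat d d" "phi y * (phi x * ?V) \<in> carrier_mat d d"
    using c by auto
  have "(phi x * phi y - phi y * phi x) * ?V = phi x * (phi y * ?V) - phi y * (phi x * ?V)"
    using minus_mult_distrib_mat[OF p(1,2) c(2)] assoc_mult_mat[OF c(3,4,2)] assoc_mult_mat[OF c(4,3,2)] by simp
  then have "?U * ((phi x * phi y - phi y * phi x) * ?V) = ?U * (phi x * (phi y * ?V)) - ?U * (phi y * (phi x * ?V))"
    using mult_minus_distrib_mat[OF c(1) p(3,4)] by simp
  then show ?thesis unfolding word_trace_split
    using mtrace_minus[OF mult_carrier_mat[OF c(1) p(3)] mult_carrier_mat[OF c(1) p(4)]]
    by (simp add: lie_rep_br[OF rep])
qed

lemma word_trace_rotate: "word_trace d phi (x # us) = word_trace d phi (us @ [x])"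
  unfolding word_trace_split[of us "[x]"] unfolding word_trace_def
  using mtrace_commute[OF lie_rep_carrier[OF rep] mlist_rep_carrier, of x us] lie_rep_carrier[OF rep, of x] by simp

end

lemma word_trace_diag:
  assumes D: "diag_rep sc H d phi P Q lam" and hs: "set hs \<subseteq> H"
  shows "word_trace d phi hs = (\<Sum>j<d. \<Prod>h\<leftarrow>hs. lam j h)"
proof -
  note d = diag_repD[OF D]
  let ?Ds = "map (\<lambda>h. mat_diag d (\<lambda>j. lam j h)) hs"
  have "map phi hs = map (\<lambda>B. P * B * Q) ?Ds" using hs d(6) by auto
  moreover have "mlist d (map (\<lambda>B. P * B * Q) ?Ds) = P * mlist d ?Ds * Q"
    by (rule mlist_conj[OF d(1-4)]) auto
  ultimately have "mlist d (map phi hs) = P * mlist d ?Ds * Q" by (simp only:)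
  then have "word_trace d phi hs = mtrace (mat_diag d (\<lambda>j. \<Prod>h\<leftarrow>hs. lam j h))"
    unfolding word_trace_def mlist_mat_diag using mtrace_conj[OF d(1,2,4) mat_diag_dim] by simp
  then show ?thesis by (simp add: mtrace_def mat_diag_def)
qed

section \<open>Recovering the weights from the linearized polynomial\<close>

context cartan_simple begin

text \<open>A point that works for N is moved along a direction on which the new functional is not
  zero; each functional excludes at most one parameter c, and the field is infinite.\<close>

lemma separating_element:
  assumes "finite N" "\<And>f. f \<in> N \<Longrightarrow> h_functional scale H f \<and> (\<exists>t\<in>H. f t \<noteq> 0)"
  shows "\<exists>h\<in>H. \<forall>f\<in>N. f h \<noteq> 0"
  using assms
proof (induction N rule: finite_induct)
  case empty
  then show ?case using subspace_0[OF subspace_H] by auto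
next
  case (insert f N)
  then obtain h where h: "h \<in> H" "\<forall>g\<in>N. g h \<noteq> 0" by auto
  obtain u where u: "u \<in> H" "f u \<noteq> 0" using insert.prems by blast
  have "finite ((\<lambda>g. - g h / g u) ` insert f N)" using insert.hyps by simp
  \<comment> \<open>For g with g u = 0 the quotient is 0 by convention, which merely excludes c =
    0.\<close>
  then obtain c :: complex where c: "c \<notin> (\<lambda>g. - g h / g u) ` insert f N"
    using ex_new_if_finite infinite_UNIV_char_0 by blast
  have cu: "c *s u \<in> H" by (rule subspace_scale[OF subspace_H u(1)])
  have "g (h + c *s u) \<noteq> 0" if g: "g \<in> insert f N" for g
  proof -
    have e: "g (h + c *s u) = g h + c * g u"
      using insert.prems[OF g] h(1) cu u(1) by (auto simp: h_functional_def)
    show ?thesis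
    proof (cases "g u = 0")
      case True
      then have "g \<in> N" using g u by auto
      then show ?thesis using e True h by simp
    next
      case False
      have "c \<noteq> - g h / g u" using c g by blast
      then show ?thesis unfolding e using False
        by (metis add.inverse_unique eq_divide_eq add.commute)
    qed
  qed
  then show ?case using subspace_add[OF subspace_H h(1) cu] by blast
qed

lemma separating_weights:
  assumes L: "finite L" "\<And>l. l \<in> L \<Longrightarrow> h_functional scale H l"
  obtains h where "h \<in> H" "inj_on (\<lambda>l. l h) L"
proof -
  let ?N = "(\<lambda>(l, m) t. l t - m t) ` {(l, m). l \<in> L \<and> m \<in> L \<and> l \<noteq> m}"
  have "\<exists>h\<in>H. \<forall>f\<in>?N. f h \<noteq> 0"
  proof (rule separating_element)
    have "{(l, m). l \<in> L \<and> m \<in> L \<and> l \<noteq> m} \<subseteq> L \<times> L" by auto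
    then have "finite {(l, m). l \<in> L \<and> m \<in> L \<and> l \<noteq> m}" by (rule finite_subset) (simp add: L(1))
    then show "finite ?N" by (rule finite_imageI)
    fix f assume "f \<in> ?N"
    then obtain l m where f: "f = (\<lambda>t. l t - m t)" "l \<in> L" "m \<in> L" "l \<noteq> m" by auto
    have "h_functional scale H f" using L(2)[OF f(2)] L(2)[OF f(3)] unfolding f(1) h_functional_def
      by (simp add: algebra_simps)
    moreover have "\<exists>t\<in>H. f t \<noteq> 0" using h_functional_eqI[OF L(2)[OF f(2)] L(2)[OF f(3)]] f(1,4) by auto
    ultimately show "h_functional scale H f \<and> (\<exists>t\<in>H. f t \<noteq> 0)" by blast
  qed
  then obtain h where h: "h \<in> H" "\<forall>f\<in>?N. f h \<noteq> 0" by blast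
  have "inj_on (\<lambda>l. l h) L"
  proof (rule inj_onI, rule ccontr)
    fix l m assume "l \<in> L" "m \<in> L" "l h = m h" "l \<noteq> m"
    then have "(\<lambda>t. l t - m t) \<in> ?N" by (intro image_eqI[of _ _ "(l, m)"]) auto
    from bspec[OF h(2) this] have "l h - m h \<noteq> 0" .
    then show False using \<open>l h = m h\<close> by simp
  qed
  then show ?thesis using that h(1) by blast
qed

context
  fixes n :: nat and al :: "nat \<Rightarrow> 'g \<Rightarrow> complex" and E :: "('g \<Rightarrow> complex) \<Rightarrow> 'g"
  assumes sr: "simple_roots scale br H n al" and E: "root_vectors scale br H E"
begin

abbreviation "rep \<equiv> lie_rep scale br"
abbreviation "lin_cp \<equiv> cp_lin scale br H n al"
abbreviation "full_cp \<equiv> cp_full scale br H n al E"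
abbreviation "lin_CP \<equiv> CP_lin scale br H n al"
abbreviation "full_CP \<equiv> CP scale br H n al E"
abbreviation "prod_reps \<equiv> res_prod_reps scale br H n al"
abbreviation "prod_lin \<equiv> res_prod_lin scale br H n al"
abbreviation "prod_full \<equiv> res_prod scale br H n al E"
abbreviation "linearize \<equiv> rho scale br H n al E"

lemma lin_elt_surj:
  assumes "h \<in> H" shows "\<exists>z. h = lin_elt n al z"
proof -
  have "h \<in> span ((\<lambda>i. cor (al i)) ` {1..n})" using assms simple_coroots_span[OF sr] by simp
  then show ?thesis
  proof (induction rule: span_induct_alt)
    case base
    show ?case by (intro exI[of _ "\<lambda>_. 0"]) (simp add: lin_elt_def)
  next
    case (step c x y)
    then obtain i z where i: "i \<in> {1..n}" "x = cor (al i)" and z: "y = lin_elt n al z" by auto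
    have "lin_elt n al (\<lambda>k. (if k = i then c else 0) + z k)
        = (\<Sum>k=1..n. if k = i then c *s cor (al k) else 0) + lin_elt n al z"
      unfolding lin_elt_def sum.distrib[symmetric] by (intro sum.cong refl) (auto simp: scale_left_distrib)
    also have "\<dots> = c *s x + y" using i z by simp
    finally show ?case by metis
  qed
qed

lemma lin_elt_upd: "lin_elt n al (z(0 := x)) = lin_elt n al z"
  unfolding lin_elt_def by (intro sum.cong) auto

text \<open>The polynomials are given as functions, so the dimension is read off from a value: at z
  0 = 2 and all other variables 0 it is 2 to the power of the dimension.\<close>

lemma lin_cp_degree:
  assumes phi: "rep d phi" and psi: "rep e psi" and eq: "lin_cp d phi = lin_cp e psi"
  shows "d = e"
proof -
  let ?z = "\<lambda>i::nat. if i = 0 then 2 else 0 :: complex"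
  have z: "lin_elt n al ?z = 0" unfolding lin_elt_def by (intro sum.neutral) auto
  have "lin_cp d phi ?z = 2 ^ d" if r: "rep d phi" for d phi
  proof -
    obtain P Q lam where D: "diag_rep scale H d phi P Q lam" by (rule rep_diag_rep[OF r])
    have "lam j 0 = 0" if "j < d" for j
      using h_functional_sum[OF diag_repD(5)[OF D that] vector_space_scale subspace_H, of "{}"] by simp
    then show ?thesis unfolding cp_lin_diag[OF sr r D] z by simp
  qed
  then have "(2::complex) ^ d = 2 ^ e" using phi psi eq by metis
  then have "of_nat (2 ^ d) = (of_nat (2 ^ e) :: complex)" by simp
  then have "(2::nat) ^ d = 2 ^ e" by (simp only: of_nat_eq_iff)
  then show ?thesis by simp
qed

text \<open>At an h separating all weights of both representations, the polynomial in z 0 alone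
  determines the multiset of values of the weights at h, hence the weights with multiplicities. An
  arbitrary F is allowed so that products of values over a word can be inserted.\<close>

lemma lin_cp_weights:
  assumes phi: "rep d phi" and psi: "rep d psi" and eq: "lin_cp d phi = lin_cp d psi"
    and D: "diag_rep scale H d phi P Q lam" and D': "diag_rep scale H d psi P' Q' mu"
  shows "(\<Sum>j<d. F (lam j)) = (\<Sum>j<d. F (mu j) :: complex)"
proof -
  let ?L = "lam ` {..<d} \<union> mu ` {..<d}"
  obtain h where h: "h \<in> H" "inj_on (\<lambda>l. l h) ?L"
    by (rule separating_weights[of ?L]) (use diag_repD(5)[OF D] diag_repD(5)[OF D'] in auto)
  obtain z where z: "h = lin_elt n al z" using lin_elt_surj[OF h(1)] by blast
  \<comment> \<open>Only z 0 varies: \<open>lin_elt\<close> ignores index 0, so the point h stays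
    fixed.\<close>
  have "(\<Prod>j<d. x + lam j h) = (\<Prod>j<d. x + mu j h)" for x
    using cp_lin_diag[OF sr phi D, of "z(0 := x)"] cp_lin_diag[OF sr psi D', of "z(0 := x)"] eq
    by (simp add: lin_elt_upd z)
  then have c: "card {j. j < d \<and> lam j h = x} = card {j. j < d \<and> mu j h = x}" for x
    by (rule card_eq_of_prod)
  have "card {j. j < d \<and> lam j = l} = card {j. j < d \<and> mu j = l}" if l: "l \<in> ?L" for l
  proof -
    have "{j. j < d \<and> lam j = l} = {j. j < d \<and> lam j h = l h}" "{j. j < d \<and> mu j = l} = {j. j < d \<and> mu j h = l h}"
      using inj_on_eq_iff[OF h(2) _ l] by blast+
    then show ?thesis using c by simp
  qed
  then show ?thesis
    using sum_multiplicities[of ?L lam d F] sum_multiplicities[of ?L mu d F] by simp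
qed

lemma full_cp_eq:
  assumes phi: "rep d phi" and psi: "rep e psi" and eq: "lin_cp d phi = lin_cp e psi"
  shows "full_cp d phi = full_cp e psi"
proof -
  have de: "d = e" using lin_cp_degree assms by blast
  note psi' = psi[folded de] and eq' = eq[folded de]
  obtain P Q lam where D: "diag_rep scale H d phi P Q lam" by (rule rep_diag_rep[OF phi])
  obtain P' Q' mu where D': "diag_rep scale H d psi P' Q' mu" by (rule rep_diag_rep[OF psi'])
  have w: "word_trace d phi xs - word_trace d psi xs = 0" for xs
  proof (rule vanishing_of_vanishing_on_H[OF E])
    fix hs assume hs: "set hs \<subseteq> H"
    show "word_trace d phi hs - word_trace d psi hs = 0"
      unfolding word_trace_diag[OF D hs] word_trace_diag[OF D' hs]
      using lin_cp_weights[OF phi psi' eq' D D', of "\<lambda>l. \<Prod>h\<leftarrow>hs. l h"] by simp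
  qed (simp_all add: word_trace_add[OF phi] word_trace_add[OF psi'] word_trace_scale[OF phi] word_trace_scale[OF psi']
      word_trace_rotate[OF phi] word_trace_rotate[OF psi'] right_diff_distrib
      flip: word_trace_br[OF phi] word_trace_br[OF psi'])
  have "mtrace (mlist d (replicate k (phi x))) = mtrace (mlist d (replicate k (psi x)))" for k x
    using w[of "replicate k x"] by (simp add: word_trace_def)
  then have "full_cp d phi z = full_cp d psi z" for z
    unfolding cp_full_det[OF phi] cp_full_det[OF psi']
    by (rule det_eq_of_traces[OF lie_rep_carrier[OF phi] lie_rep_carrier[OF psi']])
  then show ?thesis using de by auto
qed

text \<open>The linearized polynomial is a specialization of the full one and hence a function of
  it, which makes the choice in \<open>rho\<close> irrelevant.\<close>

lemma lin_of_full: "lin_cp d phi z = full_cp d phi (\<lambda>v. case v of Z0 \<Rightarrow> z 0 | ZH i \<Rightarrow> z i | ZE a \<Rightarrow> 0)"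
  by (simp add: cp_lin_def cp_full_def cong: if_cong)

lemma rho_full:
  assumes "rep d phi"
  shows "linearize (full_cp d phi) = lin_cp d phi"
  unfolding rho_def
proof (rule some_equality)
  fix p assume "\<exists>e psi. rep e psi \<and> full_cp d phi = full_cp e psi \<and> p = lin_cp e psi"
  then obtain e psi where "full_cp d phi = full_cp e psi" "p = lin_cp e psi" by blast
  then show "p = lin_cp d phi" by (auto simp: lin_of_full)
qed (use assms in blast)

text \<open>For a fixed second factor the product is a product of values of the first linearized
  polynomial, with z 0 shifted by the weights of the second. So it depends on the first
  representation through its polynomial alone, and symmetrically for the second; the two
  replacements are made one after the other.\<close>

lemma res_prod_reps_cong:
  assumes "rep d phi" "rep d' phi'" "rep e psi" "rep e' psi'"
    and "lin_cp d phi = lin_cp d' phi'" "lin_cp e psi = lin_cp e' psi'"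
  shows "prod_reps d phi e psi = prod_reps d' phi' e' psi'"
proof
  fix z
  have *: "prod_reps d phi e psi z = (\<Prod>k<e. lin_cp d phi (z(0 := z 0 + mu k (lin_elt n al z))))"
    if a: "rep d phi" "diag_rep scale H e psi P Q mu" for d phi e psi P Q mu
  proof -
    obtain P' Q' lam where D: "diag_rep scale H d phi P' Q' lam" by (rule rep_diag_rep[OF a(1)])
    show ?thesis unfolding res_prod_reps_diag[OF sr D a(2)] cp_lin_diag[OF sr a(1) D] lin_elt_upd
      by (subst prod.swap) (simp add: add_ac)
  qed
  have **: "prod_reps d phi e psi z = (\<Prod>j<d. lin_cp e psi (z(0 := z 0 + lam j (lin_elt n al z))))"
    if a: "rep e psi" "diag_rep scale H d phi P Q lam" for d phi e psi P Q lam
  proof -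
    obtain P' Q' mu where D: "diag_rep scale H e psi P' Q' mu" by (rule rep_diag_rep[OF a(1)])
    show ?thesis unfolding res_prod_reps_diag[OF sr a(2) D] cp_lin_diag[OF sr a(1) D] lin_elt_upd
      by (simp add: add_ac)
  qed
  obtain P Q mu where D: "diag_rep scale H e psi P Q mu" by (rule rep_diag_rep[OF assms(3)])
  obtain P' Q' lam where D': "diag_rep scale H d' phi' P' Q' lam" by (rule rep_diag_rep[OF assms(2)])
  have "prod_reps d phi e psi z = prod_reps d' phi' e psi z"
    unfolding *[OF assms(1) D] *[OF assms(2) D] assms(5) ..
  also have "\<dots> = prod_reps d' phi' e' psi' z"
    unfolding **[OF assms(3) D'] **[OF assms(4) D'] assms(6) ..
  finally show "prod_reps d phi e psi z = prod_reps d' phi' e' psi' z" .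
qed

section \<open>Tensor products, monoid laws and the isomorphism\<close>

lemma res_prod_lin_cp:
  assumes "rep d phi" "rep e psi"
  shows "prod_lin (lin_cp d phi) (lin_cp e psi) = lin_cp (d * e) (tensor_rep d phi e psi)"
  unfolding res_prod_lin_def cp_lin_tensor[OF sr assms]
proof (rule some_equality)
  fix r assume "\<exists>d' phi' e' psi'. rep d' phi' \<and> rep e' psi' \<and> lin_cp d phi = lin_cp d' phi' \<and>
      lin_cp e psi = lin_cp e' psi' \<and> r = prod_reps d' phi' e' psi'"
  then obtain d' phi' e' psi' where r: "rep d' phi'" "rep e' psi'" "lin_cp d phi = lin_cp d' phi'"
      "lin_cp e psi = lin_cp e' psi'" "r = prod_reps d' phi' e' psi'" by blast
  show "r = prod_reps d phi e psi"
    unfolding r(5) by (rule res_prod_reps_cong[OF assms(1) r(1) assms(2) r(2-4), symmetric])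
qed (use assms in blast)

lemma rho_bij: "bij_betw (linearize) (full_CP) (lin_CP)"
  unfolding bij_betw_def
proof
  show "inj_on (linearize) (full_CP)"
  proof (rule inj_onI)
    fix f g assume f: "f \<in> full_CP" and g: "g \<in> full_CP"
      and e: "linearize f = linearize g"
    obtain d phi where f': "rep d phi" "f = full_cp d phi" using f by (auto simp: CP_def)
    obtain k psi where g': "rep k psi" "g = full_cp k psi" using g by (auto simp: CP_def)
    have "lin_cp d phi = lin_cp k psi" using e unfolding f'(2) g'(2) rho_full[OF f'(1)] rho_full[OF g'(1)] .
    then show "f = g" unfolding f'(2) g'(2) by (rule full_cp_eq[OF f'(1) g'(1)])
  qed
  show "linearize ` full_CP = lin_CP"
  proof
    show "linearize ` full_CP \<subseteq> lin_CP"
      using rho_full by (auto simp: CP_def CP_lin_def)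
    show "lin_CP \<subseteq> linearize ` full_CP"
    proof
      fix p assume "p \<in> lin_CP"
      then obtain d phi where p: "rep d phi" "p = lin_cp d phi" by (auto simp: CP_lin_def)
      then have "p = linearize (full_cp d phi)" using rho_full by simp
      then show "p \<in> linearize ` full_CP" using p by (auto simp: CP_def)
    qed
  qed
qed

text \<open>The inverse in \<open>res_prod\<close> can be evaluated because the product of the
  linearized polynomials is visibly the image of the full polynomial of the tensor product.\<close>

lemma res_prod_full:
  assumes "rep d phi" "rep e psi"
  shows "prod_full (full_cp d phi) (full_cp e psi) = full_cp (d * e) (tensor_rep d phi e psi)"
proof -
  have t: "rep (d * e) (tensor_rep d phi e psi)" by (rule lie_rep_tensor[OF assms])
  then have m: "full_cp (d * e) (tensor_rep d phi e psi) \<in> full_CP" by (auto simp: CP_def)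
  have i: "inj_on (linearize) (full_CP)" using rho_bij by (simp add: bij_betw_def)
  show ?thesis
    unfolding res_prod_def rho_full[OF assms(1)] rho_full[OF assms(2)] res_prod_lin_cp[OF assms] rho_full[OF t, symmetric]
    by (rule inv_into_f_f[OF i m])
qed

lemma tensor_commute:
  assumes "rep d phi" "rep e psi"
  shows "lin_cp (d * e) (tensor_rep d phi e psi) = lin_cp (e * d) (tensor_rep e psi d phi)"
proof
  fix z
  obtain P Q lam where D: "diag_rep scale H d phi P Q lam" by (rule rep_diag_rep[OF assms(1)])
  obtain P' Q' mu where D': "diag_rep scale H e psi P' Q' mu" by (rule rep_diag_rep[OF assms(2)])
  show "lin_cp (d * e) (tensor_rep d phi e psi) z = lin_cp (e * d) (tensor_rep e psi d phi) z"
    unfolding cp_lin_tensor[OF sr assms] cp_lin_tensor[OF sr assms(2,1)]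
      res_prod_reps_diag[OF sr D D'] res_prod_reps_diag[OF sr D' D]
    by (subst prod.swap) (simp add: add_ac)
qed

text \<open>Both sides are the triple product over the weights of the three factors, shifted by z 0.
  It is stated for linearized polynomials, from which \<open>full_cp_eq\<close> transfers it to the
  full ones.\<close>

lemma tensor_assoc:
  assumes "rep d phi" "rep e psi" "rep f chi"
  shows "lin_cp (d * e * f) (tensor_rep (d * e) (tensor_rep d phi e psi) f chi)
    = lin_cp (d * (e * f)) (tensor_rep d phi (e * f) (tensor_rep e psi f chi))"
proof
  fix z
  obtain P Q lam where D: "diag_rep scale H d phi P Q lam" by (rule rep_diag_rep[OF assms(1)])
  obtain P' Q' mu where D': "diag_rep scale H e psi P' Q' mu" by (rule rep_diag_rep[OF assms(2)])
  obtain P'' Q'' nu where D'': "diag_rep scale H f chi P'' Q'' nu" by (rule rep_diag_rep[OF assms(3)])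
  let ?t = "lin_elt n al z"
  have "lin_cp (d * e * f) (tensor_rep (d * e) (tensor_rep d phi e psi) f chi) z
      = (\<Prod>i<d * e. \<Prod>l<f. z 0 + (lam (i div e) ?t + mu (i mod e) ?t + nu l ?t))"
    unfolding cp_lin_tensor[OF sr lie_rep_tensor[OF assms(1,2)] assms(3)]
      res_prod_reps_diag[OF sr diag_rep_tensor[OF D D'] D''] ..
  also have "\<dots> = (\<Prod>j<d. \<Prod>k<e. \<Prod>l<f. z 0 + (lam j ?t + mu k ?t + nu l ?t))"
    by (rule prod_div_mod[where F = "\<lambda>j k. \<Prod>l<f. z 0 + (lam j ?t + mu k ?t + nu l ?t)"])
  also have "\<dots> = (\<Prod>j<d. \<Prod>i<e * f. z 0 + (lam j ?t + (mu (i div f) ?t + nu (i mod f) ?t)))"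
  proof (rule prod.cong)
    fix j
    show "(\<Prod>k<e. \<Prod>l<f. z 0 + (lam j ?t + mu k ?t + nu l ?t))
        = (\<Prod>i<e * f. z 0 + (lam j ?t + (mu (i div f) ?t + nu (i mod f) ?t)))"
      using prod_div_mod[where F = "\<lambda>k l. z 0 + (lam j ?t + (mu k ?t + nu l ?t))" and d = e and e = f]
      by (simp add: add.assoc)
  qed simp
  also have "\<dots> = lin_cp (d * (e * f)) (tensor_rep d phi (e * f) (tensor_rep e psi f chi)) z"
    unfolding cp_lin_tensor[OF sr assms(1) lie_rep_tensor[OF assms(2,3)]]
      res_prod_reps_diag[OF sr D diag_rep_tensor[OF D' D'']] ..
  finally show "lin_cp (d * e * f) (tensor_rep (d * e) (tensor_rep d phi e psi) f chi) z
    = lin_cp (d * (e * f)) (tensor_rep d phi (e * f) (tensor_rep e psi f chi)) z" .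
qed

abbreviation triv :: "'g \<Rightarrow> complex mat" where
  "triv \<equiv> \<lambda>_. 0\<^sub>m 1 1"

lemma rep_triv: "rep 1 triv"
  unfolding lie_rep_def by (auto intro!: eq_matI)

lemma lin_cp_triv: "lin_cp 1 triv = (\<lambda>z. z 0)"
proof
  fix z
  have "cp_lin scale br H n al 1 triv z = det (mat 1 1 (\<lambda>(r, c). z 0))"
    unfolding cp_lin_def by (rule arg_cong[where f = det], rule eq_matI) auto
  then show "lin_cp 1 triv z = z 0" by (simp add: det_single)
qed

lemma full_cp_triv: "full_cp 1 triv = (\<lambda>z. z Z0)"
proof
  fix z
  have "cp_full scale br H n al E 1 triv z = det (mat 1 1 (\<lambda>(r, c). z Z0))"
    unfolding cp_full_def by (rule arg_cong[where f = det], rule eq_matI) auto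
  then show "full_cp 1 triv z = z Z0" by (simp add: det_single)
qed

lemma tensor_triv:
  assumes "rep d phi"
  shows "lin_cp (1 * d) (tensor_rep 1 triv d phi) = lin_cp d phi"
proof
  fix z
  obtain P Q lam where D: "diag_rep scale H d phi P Q lam" by (rule rep_diag_rep[OF assms])
  have "diag_rep scale H 1 triv (1\<^sub>m 1) (1\<^sub>m 1) (\<lambda>_ _. 0)"
    unfolding diag_rep_def by (auto simp: h_functional_def mat_diag_def intro!: eq_matI)
  then show "lin_cp (1 * d) (tensor_rep 1 triv d phi) z = lin_cp d phi z"
    unfolding cp_lin_tensor[OF sr rep_triv assms] cp_lin_diag[OF sr assms D]
    using res_prod_reps_diag[OF sr _ D] by simp
qed

lemma CP_cases:
  assumes "f \<in> full_CP" obtains d phi where "rep d phi" "f = full_cp d phi"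
  using assms by (auto simp: CP_def)

lemma CP_lin_cases:
  assumes "f \<in> lin_CP" obtains d phi where "rep d phi" "f = lin_cp d phi"
  using assms by (auto simp: CP_lin_def)

lemma full_cp_CP: "rep d phi \<Longrightarrow> full_cp d phi \<in> full_CP"
  and lin_cp_CP: "rep d phi \<Longrightarrow> lin_cp d phi \<in> lin_CP"
  by (auto simp: CP_def CP_lin_def)

lemma comm_monoid_CP_lin: "Group.comm_monoid (CP_lin_monoid scale br H n al)"
proof (rule comm_monoidI; unfold CP_lin_monoid_def; simp)
  show "(\<lambda>z. z 0) \<in> lin_CP" using lin_cp_CP[OF rep_triv] lin_cp_triv by simp
  fix f g assume "f \<in> lin_CP" "g \<in> lin_CP"
  then obtain d phi e psi where f: "rep d phi" "f = lin_cp d phi" and g: "rep e psi" "g = lin_cp e psi"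
    by (elim CP_lin_cases)
  show "prod_lin f g \<in> lin_CP"
    unfolding f(2) g(2) res_prod_lin_cp[OF f(1) g(1)] by (rule lin_cp_CP[OF lie_rep_tensor[OF f(1) g(1)]])
  show "prod_lin f g = prod_lin g f"
    unfolding f(2) g(2) res_prod_lin_cp[OF f(1) g(1)] res_prod_lin_cp[OF g(1) f(1)]
    by (rule tensor_commute[OF f(1) g(1)])
  fix k assume "k \<in> lin_CP"
  then obtain c chi where k: "rep c chi" "k = lin_cp c chi" by (rule CP_lin_cases)
  show "prod_lin (prod_lin f g) k
      = prod_lin f (prod_lin g k)"
    unfolding f(2) g(2) k(2) res_prod_lin_cp[OF f(1) g(1)] res_prod_lin_cp[OF g(1) k(1)]
      res_prod_lin_cp[OF lie_rep_tensor[OF f(1) g(1)] k(1)] res_prod_lin_cp[OF f(1) lie_rep_tensor[OF g(1) k(1)]]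
    by (rule tensor_assoc[OF f(1) g(1) k(1)])
next
  fix f assume "f \<in> lin_CP"
  then obtain d phi where f: "rep d phi" "f = lin_cp d phi" by (rule CP_lin_cases)
  show "prod_lin (\<lambda>z. z 0) f = f"
    unfolding f(2) lin_cp_triv[symmetric] res_prod_lin_cp[OF rep_triv f(1)] by (rule tensor_triv[OF f(1)])
qed

lemma comm_monoid_CP: "Group.comm_monoid (CP_monoid scale br H n al E)"
proof (rule comm_monoidI; unfold CP_monoid_def; simp)
  show "(\<lambda>z. z Z0) \<in> full_CP" using full_cp_CP[OF rep_triv] full_cp_triv by simp
  fix f g assume "f \<in> full_CP" "g \<in> full_CP"
  then obtain d phi e psi where f: "rep d phi" "f = full_cp d phi" and g: "rep e psi" "g = full_cp e psi"
    by (elim CP_cases)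
  note t = lie_rep_tensor[OF f(1) g(1)]
  show "prod_full f g \<in> full_CP"
    unfolding f(2) g(2) res_prod_full[OF f(1) g(1)] by (rule full_cp_CP[OF t])
  show "prod_full f g = prod_full g f"
    unfolding f(2) g(2) res_prod_full[OF f(1) g(1)] res_prod_full[OF g(1) f(1)]
    by (rule full_cp_eq[OF t lie_rep_tensor[OF g(1) f(1)] tensor_commute[OF f(1) g(1)]])
  fix k assume "k \<in> full_CP"
  then obtain c chi where k: "rep c chi" "k = full_cp c chi" by (rule CP_cases)
  note t' = lie_rep_tensor[OF g(1) k(1)]
  show "prod_full (prod_full f g) k
      = prod_full f (prod_full g k)"
    unfolding f(2) g(2) k(2) res_prod_full[OF f(1) g(1)] res_prod_full[OF g(1) k(1)]
      res_prod_full[OF t k(1)] res_prod_full[OF f(1) t']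
    by (rule full_cp_eq[OF lie_rep_tensor[OF t k(1)] lie_rep_tensor[OF f(1) t'] tensor_assoc[OF f(1) g(1) k(1)]])
next
  fix f assume "f \<in> full_CP"
  then obtain d phi where f: "rep d phi" "f = full_cp d phi" by (rule CP_cases)
  show "prod_full (\<lambda>z. z Z0) f = f"
    unfolding f(2) full_cp_triv[symmetric] res_prod_full[OF rep_triv f(1)]
    by (rule full_cp_eq[OF lie_rep_tensor[OF rep_triv f(1)] f(1) tensor_triv[OF f(1)]])
qed

lemma rho_iso: "linearize \<in> iso (CP_monoid scale br H n al E) (CP_lin_monoid scale br H n al)"
proof -
  have "linearize (prod_full f g)
      = prod_lin (linearize f) (linearize g)"
    if fg: "f \<in> full_CP" "g \<in> full_CP" for f g
  proof -
    obtain d phi e psi where f: "rep d phi" "f = full_cp d phi" and g: "rep e psi" "g = full_cp e psi"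
      using fg by (elim CP_cases)
    show ?thesis
      unfolding f(2) g(2) res_prod_full[OF f(1) g(1)] rho_full[OF f(1)] rho_full[OF g(1)]
        rho_full[OF lie_rep_tensor[OF f(1) g(1)]] res_prod_lin_cp[OF f(1) g(1)] ..
  qed
  then show ?thesis
    using rho_bij by (auto simp: iso_def hom_def CP_monoid_def CP_lin_monoid_def bij_betw_def)
qed

lemma rho_one: "linearize (\<lambda>z. z Z0) = (\<lambda>z. z 0)"
  using rho_full[OF rep_triv] unfolding full_cp_triv lin_cp_triv .

end

end

lemma cartan_simpleI:
  assumes s: "simple_lie_algebra sc br" and c: "cartan_subalgebra sc br H"
  shows "cartan_simple sc br H"
proof -
  have l: "lie_algebra sc br" and f: "lie_fin_dim sc" using s by (auto simp: simple_lie_algebra_def)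
  interpret vector_space sc using l by (simp add: lie_algebra_def)
  interpret complex_vs sc ..
  have "fin UNIV" using f by (auto simp: lie_fin_dim_def fin_def)
  then show ?thesis using l s c
    by unfold_locales (auto simp: cartan_subalgebra_def)
qed

theorem theorem4p4:
  fixes sc :: "complex \<Rightarrow> 'g::ab_group_add \<Rightarrow> 'g"
    and br :: "'g \<Rightarrow> 'g \<Rightarrow> 'g"
    and H :: "'g set" and n :: nat and al :: "nat \<Rightarrow> 'g \<Rightarrow> complex"
    and E :: "('g \<Rightarrow> complex) \<Rightarrow> 'g"
  assumes "simple_lie_algebra sc br"
    and "cartan_subalgebra sc br H"
    and "simple_roots sc br H n al"
    and "root_vectors sc br H E"
  shows "Group.comm_monoid (CP_monoid sc br H n al E)
    \<and> Group.comm_monoid (CP_lin_monoid sc br H n al)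
    \<and> rho sc br H n al E \<in> iso (CP_monoid sc br H n al E) (CP_lin_monoid sc br H n al)
    \<and> rho sc br H n al E (\<lambda>z. z Z0) = (\<lambda>z. z 0)"
proof -
  interpret cartan_simple sc br H by (rule cartan_simpleI[OF assms(1,2)])
  show ?thesis
    using comm_monoid_CP[OF assms(3,4)] comm_monoid_CP_lin[OF assms(3,4)] rho_iso[OF assms(3,4)] rho_one[OF assms(3,4)]
    by blast
qed

end
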